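(* Consider data $\{u_t,y_t\}_{t=1}^N$ generated by the true system, input, and noise described in the context, and let the ARX order $n=n(N)$ satisfy $n(N)\to\infty$ and $n(N)^{4+\delta}/N\to 0$ as $N\to\infty$ for some $\delta>0$. Let $\hat\theta^k_N$, $k\ge 0$, be the MORSM (Model Order Reduction Steiglitz--McBride) iterates defined in the context. Then for every $k\ge 0$, $$\hat\theta^k_N\to\theta_\circ \quad\text{as } N\to\infty, \text{ with probability } 1,$$ where $\theta_\circ=[f_1^\circ,\dots,f_m^\circ,l_1^\circ,\dots,l_m^\circ]^\top$.
   Context: $q^{-1}$ is the backward shift, $q^{-1}x_t=x_{t-1}$. True system: $y_t=G^\circ(q)u_t+H^\circ(q)e_t$ with $G^\circ=L^\circ/F^\circ$, $L^\circ(q)=l_1^\circ q^{-1}+\dots+l_m^\circ q^{-m}$, $F^\circ(q)=1+f_1^\circ q^{-1}+\dots+f_m^\circ q^{-m}$, and $H^\circ=C^\circ/D^\circ$ with $C^\circ,D^\circ$ monic polynomials in $q^{-1}$ of finite degree; $G^\circ$, $H^\circ$, $1/H^\circ$ are stable; $L^\circ,F^\circ$ have no common factors, nor do $C^\circ,D^\circ$. The order $m$ is known. Input: $u_t=F_u(q)w_t$ where $F_u$ is a stable, inversely stable, finite-dimensional filter, $\{w_t\}$ is independent of $\{e_t\}$, and with $\mathcal F_{t-1}$ the $\sigma$-algebra generated by $\{e_s,w_s: s\le t-1\}$: $E[w_t\mid\mathcal F_{t-1}]=0$, $E[w_t^2\mid\mathcal F_{t-1}]=\sigma_\circ^2$,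 $|w_t|\le C$ for all $t$. Noise: $E[e_t\mid\mathcal F_{t-1}]=0$, $E[e_t^2\mid\mathcal F_{t-1}]=\sigma_\circ^2$, $|e_t|^{10}\le C$ for all $t$, for a finite constant $C$. Write $A^\circ(q)=1/H^\circ(q)=1+\sum_{k\ge1}a_k^\circ q^{-k}$ and $B^\circ(q)=G^\circ(q)/H^\circ(q)=\sum_{k\ge1}b_k^\circ q^{-k}$. ARX step: for $\eta^n=[a_1,\dots,a_n,b_1,\dots,b_n]^\top$ let $A(q,\eta^n)=1+\sum_{k=1}^n a_kq^{-k}$, $B(q,\eta^n)=\sum_{k=1}^n b_kq^{-k}$. Let $\varphi_t^n=[-y_{t-1},\dots,-y_{t-n},u_{t-1},\dots,u_{t-n}]^\top$, $R_N^n=\frac1N\sum_{t=1}^N\varphi_t^n(\varphi_t^n)^\top$, $r_N^n=\frac1N\sum_{t=1}^N\varphi_t^ny_t$, and for a fixed small $\delta'>0$ let $R^n_{N,\mathrm{reg}}=R^n_N$ if $\|[R^n_N]^{-1}\|_2<2/\delta'$ and $R^n_{N,\mathrm{reg}}=R^n_N+\frac{\delta'}{2}I_{2n}$ otherwise. Set $\hat\eta_N=[R^{n(N)}_{N,\mathrm{reg}}]^{-1}r^{n(N)}_N$. MORSM iterates: for $\theta=[f_1,\dots,f_m,l_1,\dots,l_m]^\top$ let $F(q,\theta)=1+\sum_{k=1}^m f_kq^{-k}$, $L(q,\theta)=\sum_{k=1}^m l_kq^{-k}$. Define filtered signals $y_t(\eta,\theta)=\frac{B(q,\eta)}{F(q,\theta)}u_t$,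 $u_t(\eta,\theta)=\frac{A(q,\eta)}{F(q,\theta)}u_t$ (these are the pre-filtered data $y_t^{pf}=B(q,\hat\eta_N)u_t$, $u^{pf}_t=A(q,\hat\eta_N)u_t$ filtered by $1/F(q,\theta)$), regressor $\varphi^m_t(\eta,\theta)=[-y_{t-1}(\eta,\theta),\dots,-y_{t-m}(\eta,\theta),u_{t-1}(\eta,\theta),\dots,u_{t-m}(\eta,\theta)]^\top$, $R^m(\eta,\theta)=\frac1N\sum_{t=m+1}^N\varphi^m_t(\eta,\theta)\varphi^m_t(\eta,\theta)^\top$, $r^m(\eta,\theta)=\frac1N\sum_{t=m+1}^N\varphi^m_t(\eta,\theta)y_t(\eta,\theta)$. The initial estimate $\hat\theta^0_N$ is this least-squares estimate computed with no filtering (i.e. with $F\equiv1$), and $\hat\theta^{k+1}_N=[R^m(\hat\eta_N,\hat\theta^k_N)]^{-1}r^m(\hat\eta_N,\hat\theta^k_N)$ for $k\ge0$. *)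

theory Defs
  imports "HOL-Probability.Probability"
          "HOL-Computational_Algebra.Polynomial_FPS"
          "HOL-Computational_Algebra.Polynomial_Factorial"
          "Jordan_Normal_Form.Gauss_Jordan_Elimination"
begin

text \<open>A polynomial P :: real poly represents P(q) = sum_k coeff P k q^(-k), i.e. the
  polynomial variable is the backward shift q^(-1).  The rational filter P/Q (Q(0) = 1)
  has impulse response given by the power series coefficients of P/Q.\<close>

definition imp :: "real poly \<Rightarrow> real poly \<Rightarrow> nat \<Rightarrow> real" where
  "imp P Q k = fps_nth (fps_of_poly P / fps_of_poly Q) k"

definition stable_filter :: "real poly \<Rightarrow> real poly \<Rightarrow> bool" where
  "stable_filter P Q \<longleftrightarrow> summable (\<lambda>k. \<bar>imp P Q k\<bar>)"

definition conv :: "(nat \<Rightarrow> real) \<Rightarrow> (int \<Rightarrow> real) \<Rightarrow> int \<Rightarrow> real" where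
  "conv h x t = (\<Sum>k. h k * x (t - int k))"

text \<open>Data record: only samples t = 1..N are available; unavailable samples are zero.\<close>
definition trunc :: "nat \<Rightarrow> (int \<Rightarrow> real) \<Rightarrow> int \<Rightarrow> real" where
  "trunc N x t = (if 1 \<le> t \<and> t \<le> int N then x t else 0)"

definition vnorm2 :: "real vec \<Rightarrow> real" where
  "vnorm2 v = sqrt (\<Sum>i<dim_vec v. (v $ i)\<^sup>2)"

definition mat_norm2 :: "real mat \<Rightarrow> real" where
  "mat_norm2 A = Sup {vnorm2 (A *\<^sub>v v) | v. v \<in> carrier_vec (dim_col A) \<and> vnorm2 v = 1}"

definition minv :: "real mat \<Rightarrow> real mat" where
  "minv A = the (mat_inverse A)"

definition arx_phi :: "nat \<Rightarrow> (int \<Rightarrow> real) \<Rightarrow> (int \<Rightarrow> real) \<Rightarrow> int \<Rightarrow> nat \<Rightarrow> real" where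
  "arx_phi n y u t i = (if i < n then - y (t - int (i + 1)) else u (t - int (i - n + 1)))"

definition arx_R :: "nat \<Rightarrow> nat \<Rightarrow> (int \<Rightarrow> real) \<Rightarrow> (int \<Rightarrow> real) \<Rightarrow> real mat" where
  "arx_R N n y u = mat (2*n) (2*n)
     (\<lambda>(i,j). (1 / real N) * (\<Sum>t\<in>{1..int N}. arx_phi n y u t i * arx_phi n y u t j))"

definition arx_r :: "nat \<Rightarrow> nat \<Rightarrow> (int \<Rightarrow> real) \<Rightarrow> (int \<Rightarrow> real) \<Rightarrow> real vec" where
  "arx_r N n y u = vec (2*n) (\<lambda>i. (1 / real N) * (\<Sum>t\<in>{1..int N}. arx_phi n y u t i * y t))"

definition reg_mat :: "real \<Rightarrow> real mat \<Rightarrow> real mat" where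
  "reg_mat \<delta>' R = (if mat_inverse R \<noteq> None \<and> mat_norm2 (minv R) < 2 / \<delta>' then R
                    else R + (\<delta>' / 2) \<cdot>\<^sub>m 1\<^sub>m (dim_row R))"

definition eta_hat :: "real \<Rightarrow> nat \<Rightarrow> nat \<Rightarrow> (int \<Rightarrow> real) \<Rightarrow> (int \<Rightarrow> real) \<Rightarrow> real vec" where
  "eta_hat \<delta>' N n y u =
     minv (reg_mat \<delta>' (arx_R N n (trunc N y) (trunc N u))) *\<^sub>v arx_r N n (trunc N y) (trunc N u)"

definition polyA :: "nat \<Rightarrow> real vec \<Rightarrow> real poly" where
  "polyA n \<eta> = Poly (1 # map (\<lambda>k. \<eta> $ k) [0..<n])"

definition polyB :: "nat \<Rightarrow> real vec \<Rightarrow> real poly" where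
  "polyB n \<eta> = Poly (0 # map (\<lambda>k. \<eta> $ (n + k)) [0..<n])"

definition polyF :: "nat \<Rightarrow> real vec \<Rightarrow> real poly" where
  "polyF m \<theta> = Poly (1 # map (\<lambda>k. \<theta> $ k) [0..<m])"

definition polyL :: "nat \<Rightarrow> real vec \<Rightarrow> real poly" where
  "polyL m \<theta> = Poly (0 # map (\<lambda>k. \<theta> $ (m + k)) [0..<m])"

text \<open>Filtered signals y_t(eta,theta) = B/F u_t and u_t(eta,theta) = A/F u_t, computed
  from the data record ud (zero outside 1..N, i.e. zero initial conditions).\<close>
definition yfilt :: "nat \<Rightarrow> nat \<Rightarrow> real vec \<Rightarrow> real vec \<Rightarrow> (int \<Rightarrow> real) \<Rightarrow> int \<Rightarrow> real" where
  "yfilt n m \<eta> \<theta> ud = conv (imp (polyB n \<eta>) (polyF m \<theta>)) ud"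

definition ufilt :: "nat \<Rightarrow> nat \<Rightarrow> real vec \<Rightarrow> real vec \<Rightarrow> (int \<Rightarrow> real) \<Rightarrow> int \<Rightarrow> real" where
  "ufilt n m \<eta> \<theta> ud = conv (imp (polyA n \<eta>) (polyF m \<theta>)) ud"

definition sm_phi :: "nat \<Rightarrow> nat \<Rightarrow> real vec \<Rightarrow> real vec \<Rightarrow> (int \<Rightarrow> real) \<Rightarrow> int \<Rightarrow> nat \<Rightarrow> real" where
  "sm_phi n m \<eta> \<theta> ud t i =
     (if i < m then - yfilt n m \<eta> \<theta> ud (t - int (i + 1))
      else ufilt n m \<eta> \<theta> ud (t - int (i - m + 1)))"

definition sm_R :: "nat \<Rightarrow> nat \<Rightarrow> nat \<Rightarrow> real vec \<Rightarrow> real vec \<Rightarrow> (int \<Rightarrow> real) \<Rightarrow> real mat" where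
  "sm_R N n m \<eta> \<theta> ud = mat (2*m) (2*m)
     (\<lambda>(i,j). (1 / real N) * (\<Sum>t\<in>{int m + 1..int N}. sm_phi n m \<eta> \<theta> ud t i * sm_phi n m \<eta> \<theta> ud t j))"

definition sm_r :: "nat \<Rightarrow> nat \<Rightarrow> nat \<Rightarrow> real vec \<Rightarrow> real vec \<Rightarrow> (int \<Rightarrow> real) \<Rightarrow> real vec" where
  "sm_r N n m \<eta> \<theta> ud = vec (2*m)
     (\<lambda>i. (1 / real N) * (\<Sum>t\<in>{int m + 1..int N}. sm_phi n m \<eta> \<theta> ud t i * yfilt n m \<eta> \<theta> ud t))"

definition sm_step :: "nat \<Rightarrow> nat \<Rightarrow> nat \<Rightarrow> real vec \<Rightarrow> (int \<Rightarrow> real) \<Rightarrow> real vec \<Rightarrow> real vec" where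
  "sm_step N n m \<eta> ud \<theta> = minv (sm_R N n m \<eta> \<theta> ud) *\<^sub>v sm_r N n m \<eta> \<theta> ud"

text \<open>MORSM iterates: theta^0 is the unfiltered estimate (F = 1, i.e. theta = 0), and
  theta^(k+1) = step(theta^k).  Arguments: delta', N, ARX order n, model order m, data y, u.\<close>
fun morsm :: "real \<Rightarrow> nat \<Rightarrow> nat \<Rightarrow> nat \<Rightarrow> (int \<Rightarrow> real) \<Rightarrow> (int \<Rightarrow> real) \<Rightarrow> nat \<Rightarrow> real vec" where
  "morsm \<delta>' N n m y u 0 = sm_step N n m (eta_hat \<delta>' N n y u) (trunc N u) (0\<^sub>v (2*m))"
| "morsm \<delta>' N n m y u (Suc k) =
     sm_step N n m (eta_hat \<delta>' N n y u) (trunc N u) (morsm \<delta>' N n m y u k)"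

definition past_sigma :: "'a measure \<Rightarrow> (int \<Rightarrow> 'a \<Rightarrow> real) \<Rightarrow> (int \<Rightarrow> 'a \<Rightarrow> real) \<Rightarrow> int \<Rightarrow> 'a measure" where
  "past_sigma M e w t = sigma (space M)
     (\<Union>s\<in>{..<t}. {e s -` A \<inter> space M | A. A \<in> sets borel} \<union> {w s -` A \<inter> space M | A. A \<in> sets borel})"

end

theory Submission
  imports Defs "HOL-Computational_Algebra.Field_as_Ring" "Jordan_Normal_Form.Determinant"
    "HOL-Real_Asymp.Real_Asymp"
begin

text \<open>
  All signals are bounded, so filter errors are controlled by the $\ell^1$ norms of impulse
  responses, and randomness enters only through the sample covariances of the innovations
  \<open>w\<close>, \<open>e\<close> at lags up to \<open>2 n(N)\<close>. An Azuma bound and Borel--Cantelli show that almost surely these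
  are eventually all within \<open>N powr (-1/3)\<close> of their limits, which is \<open>o(1 / n(N))\<close>. On this event
  the argument is deterministic. The ARX covariance matrix is bounded below uniformly in the order,
  because the filters from the innovations to the data are invertible in $\ell^1$; the truncation
  tails are \<open>o(1 / n)\<close>, because a reduced stable fraction has a denominator invertible in $\ell^1$,
  so that its derivative is again in $\ell^1$. Hence the ARX estimate converges in $\ell^1$.
  Finally \<open>Fo B\<^sup>\<circ> = Lo A\<^sup>\<circ>\<close> makes the residual of the Steiglitz--McBride
  regression at the true parameter vanish in the limit, and coprimality of \<open>Lo\<close> and \<open>Fo\<close> bounds its
  normal matrix below; induction over the iterations concludes.
\<close>

section \<open>Impulse responses as absolutely summable power series\<close>

text \<open>The ARX regression has growing dimension, and this dictates the quantitative demands.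
  Normal matrices are bounded below in the Euclidean norm while filters compose in the l1 norm;
  passing from one to the other costs a factor \<open>2 * nN N\<close>, so covariance errors,
  truncation tails and edge effects must all be o(1/n). The Steiglitz-McBride regression has the
  fixed dimension 2m, and o(1) is enough there. The exponent 1/3 lies between two constraints. It
  exceeds 1/4 because the rate of n(N) gives n <= N^(1/4) eventually, so that n N^(-1/3) tends to 0.
  It is below 1/2 so that the Azuma bound exp(-a N^(1 - 2/3)) stays summable against the O(N^2)
  pairs of lags. Samples before the start of the record cost n^2/N. The bound \<delta>0 of the
  conclusion is the constant that bounds the ARX normal matrix below: for \<delta>' smaller than it
  the regularisation is eventually inactive. It depends on \<sigma> and the filters alone, hence is
  the same for all sample paths.\<close>

definition l1 :: "real fps \<Rightarrow> bool" where
  "l1 f \<longleftrightarrow> summable (\<lambda>k. \<bar>fps_nth f k\<bar>)"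

definition norm1 :: "real fps \<Rightarrow> real" where
  "norm1 f = (\<Sum>k. \<bar>fps_nth f k\<bar>)"

definition tail1 :: "real fps \<Rightarrow> nat \<Rightarrow> real" where
  "tail1 f n = norm1 (fps_shift n f)"

text \<open>\<open>fps_deriv f\<close> has the coefficients (k+1) f_(k+1), so this is summability of
  k |f_k|. The weight upgrades tails from o(1) to o(1/n).\<close>

definition wl1 :: "real fps \<Rightarrow> bool" where
  "wl1 f \<longleftrightarrow> l1 f \<and> l1 (fps_deriv f)"

lemma sum_triangle_le:
  fixes a b :: "nat \<Rightarrow> real"
  assumes "\<And>k. a k \<ge> 0" "\<And>k. b k \<ge> 0"
  shows "(\<Sum>k\<le>K. \<Sum>i\<le>k. a i * b (k - i)) \<le> (\<Sum>k\<le>K. a k) * (\<Sum>k\<le>K. b k)"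
proof -
  have "(\<Sum>k\<le>K. \<Sum>i\<le>k. a i * b (k - i)) = sum (\<lambda>(i,j). a i * b j) {(i,j). i + j \<le> K}"
    by (rule sum.triangle_reindex_eq[symmetric])
  also have "\<dots> \<le> sum (\<lambda>(i,j). a i * b j) ({..K} \<times> {..K})"
    by (rule sum_mono2) (use assms in auto)
  also have "\<dots> = (\<Sum>k\<le>K. a k) * (\<Sum>k\<le>K. b k)"
    by (simp add: sum_product sum.cartesian_product)
  finally show ?thesis .
qed

lemma norm1_nonneg: "l1 f \<Longrightarrow> norm1 f \<ge> 0"
  unfolding norm1_def l1_def by (rule suminf_nonneg) auto

lemma sum_abs_le_norm1: "l1 f \<Longrightarrow> finite A \<Longrightarrow> (\<Sum>k\<in>A. \<bar>fps_nth f k\<bar>) \<le> norm1 f"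
  unfolding norm1_def l1_def by (rule sum_le_suminf) auto

text \<open>Most estimates are proved on partial sums, where convergence is no issue; a bound
  uniform in K then yields summability and the norm bound at once.\<close>

lemma l1_norm1_boundI:
  assumes "\<And>K. (\<Sum>k\<le>K. \<bar>fps_nth f k\<bar>) \<le> B"
  shows "l1 f" "norm1 f \<le> B"
proof -
  have *: "(\<Sum>k<K. \<bar>fps_nth f k\<bar>) \<le> B" for K
    using assms[of K] sum_mono2[of "{..K}" "{..<K}" "\<lambda>k. \<bar>fps_nth f k\<bar>"] by fastforce
  show "l1 f" unfolding l1_def by (rule summableI_nonneg_bounded[OF _ *]) auto
  then show "norm1 f \<le> B" unfolding norm1_def l1_def using * by (intro suminf_le_const)
qed

text \<open>Stated on initial segments so that it covers arbitrary series:
  \<open>inverse_perturb\<close> applies it to an inverse whose summability is still to be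
  shown.\<close>

lemma sum_abs_fps_mult_le:
  "(\<Sum>k\<le>K. \<bar>fps_nth (f * g) k\<bar>) \<le> (\<Sum>k\<le>K. \<bar>fps_nth f k\<bar>) * (\<Sum>k\<le>K. \<bar>fps_nth (g::real fps) k\<bar>)"
proof -
  have "(\<Sum>k\<le>K. \<bar>fps_nth (f * g) k\<bar>) \<le> (\<Sum>k\<le>K. \<Sum>i\<le>k. \<bar>fps_nth f i\<bar> * \<bar>fps_nth g (k - i)\<bar>)"
    by (intro sum_mono)
      (auto simp: fps_mult_nth atLeast0AtMost abs_mult intro: order_trans[OF sum_abs])
  also have "\<dots> \<le> (\<Sum>k\<le>K. \<bar>fps_nth f k\<bar>) * (\<Sum>k\<le>K. \<bar>fps_nth g k\<bar>)"
    by (rule sum_triangle_le) auto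
  finally show ?thesis .
qed

lemma
  assumes "l1 f" "l1 g"
  shows l1_mult: "l1 (f * g)" and norm1_mult: "norm1 (f * g) \<le> norm1 f * norm1 g"
proof -
  have *: "(\<Sum>k\<le>K. \<bar>fps_nth (f * g) k\<bar>) \<le> norm1 f * norm1 g" for K
    by (rule order_trans[OF sum_abs_fps_mult_le])
      (intro mult_mono sum_abs_le_norm1 assms norm1_nonneg sum_nonneg; simp)
  show "l1 (f * g)" "norm1 (f * g) \<le> norm1 f * norm1 g" using l1_norm1_boundI[OF *] by auto
qed

lemma
  assumes "l1 f" "l1 g"
  shows l1_add: "l1 (f + g)" and norm1_add: "norm1 (f + g) \<le> norm1 f + norm1 g"
proof -
  have *: "(\<Sum>k\<le>K. \<bar>fps_nth (f + g) k\<bar>) \<le> norm1 f + norm1 g" for K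
  proof -
    have "(\<Sum>k\<le>K. \<bar>fps_nth (f + g) k\<bar>) \<le> (\<Sum>k\<le>K. \<bar>fps_nth f k\<bar>) + (\<Sum>k\<le>K. \<bar>fps_nth g k\<bar>)"
      unfolding sum.distrib[symmetric] by (intro sum_mono) auto
    also have "\<dots> \<le> norm1 f + norm1 g" by (intro add_mono sum_abs_le_norm1 assms) auto
    finally show ?thesis .
  qed
  show "l1 (f + g)" "norm1 (f + g) \<le> norm1 f + norm1 g" using l1_norm1_boundI[OF *] by auto
qed

lemma l1_uminus [simp]: "l1 (- f) \<longleftrightarrow> l1 f" and norm1_uminus [simp]: "norm1 (- f) = norm1 f"
  by (auto simp: l1_def norm1_def)

lemma l1_diff: "l1 f \<Longrightarrow> l1 g \<Longrightarrow> l1 (f - g)"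
  using l1_add[of f "- g"] by simp

lemma norm1_diff: "l1 f \<Longrightarrow> l1 g \<Longrightarrow> norm1 (f - g) \<le> norm1 f + norm1 g"
  using norm1_add[of f "- g"] by simp

lemma norm1_zero [simp]: "norm1 0 = 0" and l1_zero [simp]: "l1 0"
  by (auto simp: norm1_def l1_def)

lemma l1_fps_of_poly [simp]: "l1 (fps_of_poly p)"
  unfolding l1_def by (rule summable_finite[of "{..degree p}"]) (auto simp: coeff_eq_0)

lemma norm1_fps_of_poly:
  assumes "degree p \<le> d"
  shows "norm1 (fps_of_poly p) = (\<Sum>k\<le>d. \<bar>coeff p k\<bar>)"
  unfolding norm1_def
  by (subst suminf_finite[of "{..d}"]) (use assms in \<open>auto simp: coeff_eq_0\<close>)

lemma l1_one [simp]: "l1 1"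
  using l1_fps_of_poly[of 1] by simp

lemma l1_shift: "l1 f \<Longrightarrow> l1 (fps_shift n f)"
  unfolding l1_def by (auto simp: summable_iff_shift[of "\<lambda>k. \<bar>fps_nth f k\<bar>"])

lemma norm1_shift_le: "l1 f \<Longrightarrow> norm1 (fps_shift n f) \<le> norm1 f"
proof -
  assume f: "l1 f"
  have "(\<Sum>k\<le>K. \<bar>fps_nth (fps_shift n f) k\<bar>) \<le> norm1 f" for K
  proof -
    have "(\<Sum>k\<le>K. \<bar>fps_nth (fps_shift n f) k\<bar>) = (\<Sum>k\<in>(\<lambda>k. k + n) ` {..K}. \<bar>fps_nth f k\<bar>)"
      by (subst sum.reindex) (auto simp: inj_on_def)
    also have "\<dots> \<le> norm1 f" by (intro sum_abs_le_norm1 f) auto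
    finally show ?thesis .
  qed
  then show ?thesis by (rule l1_norm1_boundI)
qed

lemma l1_cutoff: "l1 (fps_cutoff n f)"
  unfolding l1_def by (rule summable_finite[of "{..n}"]) auto

lemma l1_X_power_mult: "l1 f \<Longrightarrow> l1 (fps_X ^ n * f)"
  using l1_mult[OF l1_fps_of_poly[of "monom 1 n"]] by (simp add: fps_of_poly_monom)

lemma norm1_X_power_mult: "l1 f \<Longrightarrow> norm1 (fps_X ^ n * f) \<le> norm1 f"
proof -
  assume f: "l1 f"
  have "norm1 (fps_of_poly (monom 1 n)) = (\<Sum>k\<le>n. if n = k then 1 else 0)"
    by (subst norm1_fps_of_poly[OF degree_monom_le]) (auto intro!: sum.cong)
  then have "norm1 (fps_X ^ n) = 1" by (simp add: fps_of_poly_monom)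
  then show ?thesis using norm1_mult[OF l1_fps_of_poly[of "monom 1 n"] f] by (simp add: fps_of_poly_monom)
qed

lemma cutoff_decomp: "f = fps_cutoff n f + fps_X ^ n * fps_shift n (f :: real fps)"
  by (rule fps_ext) (auto simp: fps_X_power_mult_nth)

lemma tail1_nonneg: "l1 f \<Longrightarrow> tail1 f n \<ge> 0"
  unfolding tail1_def by (intro norm1_nonneg l1_shift)

lemma norm1_minus_cutoff: "l1 f \<Longrightarrow> norm1 (f - fps_cutoff n f) \<le> tail1 f n"
proof -
  assume f: "l1 f"
  have "f - fps_cutoff n f = fps_X ^ n * fps_shift n f"
    using cutoff_decomp[of f n] by (simp add: algebra_simps)
  then show ?thesis unfolding tail1_def using norm1_X_power_mult[OF l1_shift[OF f]] by metis
qed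

lemma tail1_eq: "l1 f \<Longrightarrow> tail1 f n = norm1 f - (\<Sum>k<n. \<bar>fps_nth f k\<bar>)"
  unfolding tail1_def norm1_def l1_def
  using suminf_split_initial_segment[of "\<lambda>k. \<bar>fps_nth f k\<bar>" n] by simp

lemma tail1_LIMSEQ: "l1 f \<Longrightarrow> tail1 f \<longlonglongrightarrow> 0"
proof -
  assume f: "l1 f"
  have "(\<lambda>n. norm1 f - (\<Sum>k<n. \<bar>fps_nth f k\<bar>)) \<longlonglongrightarrow> norm1 f - norm1 f"
    using f unfolding l1_def by (intro tendsto_diff tendsto_const) (auto simp: norm1_def intro: summable_LIMSEQ)
  moreover have "tail1 f = (\<lambda>n. norm1 f - (\<Sum>k<n. \<bar>fps_nth f k\<bar>))" using tail1_eq[OF f] by auto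
  ultimately show ?thesis by simp
qed

lemma norm1_mono:
  assumes "\<And>k. \<bar>fps_nth f k\<bar> \<le> \<bar>fps_nth g k\<bar>" "l1 g"
  shows "norm1 f \<le> norm1 g"
  by (rule l1_norm1_boundI(2), rule order_trans[OF sum_mono[OF assms(1)] sum_abs_le_norm1[OF assms(2)]]) auto

text \<open>Every coefficient of f from index n+1 on enters the derivative with a weight of at least
  n+1.\<close>

lemma Suc_mult_tail1_le:
  assumes "l1 (fps_deriv f)"
  shows "real (Suc n) * tail1 f (Suc n) \<le> tail1 (fps_deriv f) n"
proof -
  have "real (Suc n) * tail1 f (Suc n) = norm1 (fps_const (real (Suc n)) * fps_shift (Suc n) f)"
  \<comment> \<open>Only the derivative is assumed summable. Its weights are at least 1, so the tail
    of f is summable as well and the second case is contradictory.\<close>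
  proof (cases "summable (\<lambda>k. \<bar>fps_nth f (k + Suc n)\<bar>)")
    case True
    then show ?thesis unfolding tail1_def norm1_def by (simp add: suminf_mult abs_mult del: of_nat_Suc add_Suc_right)
  next
    case False
    have "summable (\<lambda>k. \<bar>fps_nth f (k + Suc n)\<bar>)"
    proof (rule summable_comparison_test')
      show "summable (\<lambda>k. \<bar>fps_nth (fps_deriv f) (k + n)\<bar>)"
        using l1_shift[OF assms, of n] unfolding l1_def by simp
      show "norm \<bar>fps_nth f (k + Suc n)\<bar> \<le> \<bar>fps_nth (fps_deriv f) (k + n)\<bar>" if "k \<ge> 0" for k
        using mult_right_mono[of 1 "1 + (real k + real n)" "\<bar>fps_nth f (Suc (k + n))\<bar>"]
        by (simp add: abs_mult add_ac)
    qed
    with False show ?thesis by simp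
  qed
  also have "\<dots> \<le> norm1 (fps_shift n (fps_deriv f))"
    by (rule norm1_mono) (auto simp: abs_mult intro!: mult_right_mono l1_shift assms)
  finally show ?thesis unfolding tail1_def .
qed

lemma mult_tail1_LIMSEQ:
  assumes "wl1 f"
  shows "(\<lambda>n. real n * tail1 f (Suc n)) \<longlonglongrightarrow> 0"
proof (rule tendsto_sandwich[OF _ _ tendsto_const tail1_LIMSEQ])
  have f: "l1 f" "l1 (fps_deriv f)" using assms by (auto simp: wl1_def)
  show "\<forall>\<^sub>F n in sequentially. 0 \<le> real n * tail1 f (Suc n)"
    using tail1_nonneg[OF f(1)] by simp
  show "\<forall>\<^sub>F n in sequentially. real n * tail1 f (Suc n) \<le> tail1 (fps_deriv f) n"
  proof (intro always_eventually allI)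
    fix n
    have "real n * tail1 f (Suc n) \<le> real (Suc n) * tail1 f (Suc n)"
      using tail1_nonneg[OF f(1)] by (intro mult_right_mono) auto
    then show "real n * tail1 f (Suc n) \<le> tail1 (fps_deriv f) n"
      using Suc_mult_tail1_le[OF f(2)] by (rule order_trans)
  qed
  show "l1 (fps_deriv f)" by fact
qed

text \<open>V is a polynomial of degree at most d, so coefficients of g below n contribute to
  \<open>V * g\<close> only below d + n; from there on only the tail of g is seen.\<close>

lemma tail1_mult_le:
  assumes g: "l1 g" and V: "\<And>k. k > d \<Longrightarrow> fps_nth V k = 0" "l1 V"
  shows "tail1 (V * g) (d + n) \<le> norm1 V * tail1 g n"
proof -
  let ?c = "fps_cutoff n g" and ?s = "fps_shift n g"
  have dec: "V * g = V * ?c + fps_X ^ n * (V * ?s)"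
    by (subst cutoff_decomp[of g n]) (simp add: algebra_simps)
  have "fps_nth (V * ?c) (k + (d + n)) = 0" for k
  proof -
    have "fps_nth V i * fps_nth ?c (k + (d + n) - i) = 0" for i
      using V(1)[of i] by (cases "i > d") auto
    then show ?thesis unfolding fps_mult_nth by (intro sum.neutral) blast
  qed
  then have "fps_shift (d + n) (V * g) = fps_shift d (V * ?s)"
    by (subst dec) (auto intro!: fps_ext simp: fps_X_power_mult_nth)
  then have "tail1 (V * g) (d + n) \<le> norm1 (V * ?s)"
    unfolding tail1_def using norm1_shift_le[OF l1_mult[OF V(2) l1_shift[OF g]]] by simp
  also have "\<dots> \<le> norm1 V * tail1 g n"
    unfolding tail1_def by (intro norm1_mult V l1_shift g)
  finally show ?thesis .
qed

lemma tail1_add: "l1 f \<Longrightarrow> l1 g \<Longrightarrow> tail1 (f + g) n \<le> tail1 f n + tail1 g n"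
  unfolding tail1_def using norm1_add[OF l1_shift l1_shift, of f g n n] by (simp add: fps_shift_add)

lemma tail1_uminus [simp]: "tail1 (- f) n = tail1 f n"
  by (simp add: tail1_def norm1_def)

text \<open>Young's inequality for l1 against l2. Coefficient k of a product involves only
  coefficients up to k, so it holds on every initial segment. With f an l1 left inverse of a filter
  it becomes a lower bound for the sum of squares of that filter's output; both excitation bounds
  rest on this.\<close>

lemma young_causal:
  assumes "l1 f"
  shows "(\<Sum>k\<le>L. (fps_nth (f * g) k)\<^sup>2) \<le> (norm1 f)\<^sup>2 * (\<Sum>k\<le>L. (fps_nth g k)\<^sup>2)"
proof -
  have "(fps_nth (f * g) k)\<^sup>2 \<le> norm1 f * (\<Sum>i\<le>k. \<bar>fps_nth f i\<bar> * (fps_nth g (k - i))\<^sup>2)" for k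
  proof -
    have "(fps_nth (f * g) k)\<^sup>2 = \<bar>\<Sum>i\<le>k. fps_nth f i * fps_nth g (k - i)\<bar>\<^sup>2"
      by (simp add: fps_mult_nth atLeast0AtMost)
    \<comment> \<open>Splitting |f_i| into two square roots lets Cauchy-Schwarz keep one factor
      |f_i| as a weight on the squares of g.\<close>
    also have "\<dots> \<le> (\<Sum>i\<le>k. sqrt \<bar>fps_nth f i\<bar> * (sqrt \<bar>fps_nth f i\<bar> * \<bar>fps_nth g (k - i)\<bar>))\<^sup>2"
      by (intro power_mono order_trans[OF sum_abs]) (auto simp: abs_mult mult.assoc[symmetric] intro!: sum_mono)
    also have "\<dots> \<le> (\<Sum>i\<le>k. (sqrt \<bar>fps_nth f i\<bar>)\<^sup>2) * (\<Sum>i\<le>k. (sqrt \<bar>fps_nth f i\<bar> * \<bar>fps_nth g (k - i)\<bar>)\<^sup>2)"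
      by (rule Cauchy_Schwarz_ineq_sum)
    also have "\<dots> = (\<Sum>i\<le>k. \<bar>fps_nth f i\<bar>) * (\<Sum>i\<le>k. \<bar>fps_nth f i\<bar> * (fps_nth g (k - i))\<^sup>2)"
      by (simp add: power_mult_distrib)
    also have "\<dots> \<le> norm1 f * (\<Sum>i\<le>k. \<bar>fps_nth f i\<bar> * (fps_nth g (k - i))\<^sup>2)"
      by (intro mult_right_mono sum_abs_le_norm1 assms sum_nonneg) auto
    finally show ?thesis .
  qed
  then have "(\<Sum>k\<le>L. (fps_nth (f * g) k)\<^sup>2) \<le> norm1 f * (\<Sum>k\<le>L. \<Sum>i\<le>k. \<bar>fps_nth f i\<bar> * (fps_nth g (k - i))\<^sup>2)"
    by (simp add: sum_distrib_left sum_mono)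
  also have "\<dots> \<le> norm1 f * ((\<Sum>k\<le>L. \<bar>fps_nth f k\<bar>) * (\<Sum>k\<le>L. (fps_nth g k)\<^sup>2))"
    by (intro mult_left_mono norm1_nonneg assms sum_triangle_le) auto
  also have "\<dots> \<le> norm1 f * (norm1 f * (\<Sum>k\<le>L. (fps_nth g k)\<^sup>2))"
    by (intro mult_left_mono mult_right_mono sum_abs_le_norm1 assms norm1_nonneg sum_nonneg) auto
  finally show ?thesis by (simp add: power2_eq_square mult.assoc)
qed

text \<open>Resolvent identity 1/F - 1/F0 = -(1/F0)(F - F0)(1/F). The formal inverse of F exists
  because F(0) = 1; what has to be shown is that it lies in l1.\<close>

lemma inverse_perturb:
  assumes F: "fps_nth F 0 = 1" and F0: "fps_nth F0 0 = 1"
    and l1: "l1 (inverse F0)" "l1 (F - F0)"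
    and small: "norm1 (inverse F0) * norm1 (F - F0) \<le> 1 / 2"
  shows "l1 (inverse F)" "norm1 (inverse F - inverse F0) \<le> 2 * (norm1 (inverse F0))\<^sup>2 * norm1 (F - F0)"
proof -
  let ?g = "inverse F0" and ?h = "inverse F" and ?D = "F - F0"
  have 1: "F * ?h = 1" "F0 * ?g = 1"
    using inverse_mult_eq_1'[of F] inverse_mult_eq_1'[of F0] F F0 by auto
  have "?g - ?h = ?g * (F * ?h) - ?h * (F0 * ?g)" using 1 by simp
  also have "\<dots> = (?g * ?D) * ?h" by (simp add: algebra_simps)
  finally have diff: "?h - ?g = - ((?g * ?D) * ?h)" by (simp add: algebra_simps)
  have gD: "l1 (?g * ?D)" "norm1 (?g * ?D) \<le> 1 / 2"
    using l1_mult[OF l1] norm1_mult[OF l1] small by auto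
  \<comment> \<open>The partial sum S of the absolute coefficients of 1/F obeys S <=
    \<open>norm1 (inverse F0)\<close> + S/2, which can be solved for S because S is a finite
    sum.\<close>
  have bound: "(\<Sum>k\<le>K. \<bar>fps_nth ?h k\<bar>) \<le> 2 * norm1 ?g" for K
  proof -
    let ?S = "\<Sum>k\<le>K. \<bar>fps_nth ?h k\<bar>"
    have "?h = ?g - (?g * ?D) * ?h" using diff by (simp add: algebra_simps)
    then have "\<bar>fps_nth ?h k\<bar> \<le> \<bar>fps_nth ?g k\<bar> + \<bar>fps_nth ((?g * ?D) * ?h) k\<bar>" for k
      by (metis abs_triangle_ineq4 fps_sub_nth)
    then have "?S \<le> (\<Sum>k\<le>K. \<bar>fps_nth ?g k\<bar>) + (\<Sum>k\<le>K. \<bar>fps_nth ((?g * ?D) * ?h) k\<bar>)"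
      unfolding sum.distrib[symmetric] by (intro sum_mono)
    also have "\<dots> \<le> norm1 ?g + (\<Sum>k\<le>K. \<bar>fps_nth (?g * ?D) k\<bar>) * ?S"
      by (intro add_mono sum_abs_le_norm1 l1 sum_abs_fps_mult_le) auto
    also have "\<dots> \<le> norm1 ?g + 1 / 2 * ?S"
      by (intro add_left_mono mult_right_mono sum_nonneg order_trans[OF sum_abs_le_norm1[OF gD(1)] gD(2)]) auto
    finally show ?thesis by simp
  qed
  show h: "l1 ?h" by (rule l1_norm1_boundI(1)[OF bound])
  have h2: "norm1 ?h \<le> 2 * norm1 ?g" by (rule l1_norm1_boundI(2)[OF bound])
  have "norm1 (?h - ?g) = norm1 ((?g * ?D) * ?h)" unfolding diff by simp
  also have "\<dots> \<le> (norm1 ?g * norm1 ?D) * (2 * norm1 ?g)"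
    by (rule order_trans[OF norm1_mult[OF gD(1) h]])
      (intro mult_mono norm1_mult l1 h2 mult_nonneg_nonneg norm1_nonneg h)
  finally show "norm1 (?h - ?g) \<le> 2 * (norm1 ?g)\<^sup>2 * norm1 ?D" by (simp add: power2_eq_square mult_ac)
qed

lemma wl1_mult: "wl1 f \<Longrightarrow> wl1 g \<Longrightarrow> wl1 (f * g)"
  by (auto simp: wl1_def intro!: l1_mult l1_add)

lemma wl1_poly [simp]: "wl1 (fps_of_poly p)"
  by (simp add: wl1_def fps_of_poly_pderiv[symmetric])

lemma wl1_imp_l1: "wl1 f \<Longrightarrow> l1 f" by (simp add: wl1_def)

lemma fps_of_poly_divide: "coeff Q 0 \<noteq> 0 \<Longrightarrow> fps_of_poly P / fps_of_poly Q = fps_of_poly P * inverse (fps_of_poly Q :: real fps)"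
  by (rule fps_divide_unit) simp

text \<open>(1/Q)' = -Q' (1/Q)^2 is again a product of l1 series.\<close>

lemma wl1_inverse_poly:
  assumes "l1 (inverse (fps_of_poly Q))" "coeff Q 0 \<noteq> 0"
  shows "wl1 (inverse (fps_of_poly Q))"
  using assms by (auto simp: wl1_def fps_inverse_deriv power2_eq_square fps_of_poly_pderiv[symmetric] intro!: l1_mult)

lemma stable_filter_iff: "stable_filter P Q \<longleftrightarrow> l1 (fps_of_poly P / fps_of_poly Q)"
  by (simp add: stable_filter_def l1_def imp_def)

text \<open>Bezout: if $aP + bQ = 1$ then $1/Q = a(P/Q) + b$, so a stable reduced fraction has a stable
  denominator.\<close>
lemma wl1_inverse_coprime:
  fixes P Q :: "real poly"
  assumes "coprime P Q" "coeff Q 0 \<noteq> 0" "stable_filter P Q"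
  shows "wl1 (inverse (fps_of_poly Q))"
proof -
  obtain a b where "a * P + b * Q = 1"
    using bezout_coefficients_fst_snd[of P Q] assms(1) coprime_iff_gcd_eq_1 by metis
  then have ab: "fps_of_poly a * fps_of_poly P + fps_of_poly b * fps_of_poly Q = 1"
    by (metis fps_of_poly_1 fps_of_poly_add fps_of_poly_mult)
  have "inverse (fps_of_poly Q) = (fps_of_poly a * fps_of_poly P + fps_of_poly b * fps_of_poly Q) * inverse (fps_of_poly Q)"
    using ab by simp
  also have "\<dots> = fps_of_poly a * (fps_of_poly P / fps_of_poly Q) + fps_of_poly b * (fps_of_poly Q * inverse (fps_of_poly Q))"
    using assms(2) by (simp add: fps_of_poly_divide algebra_simps)
  also have "fps_of_poly Q * inverse (fps_of_poly Q) = 1"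
    using assms(2) by (intro inverse_mult_eq_1') simp
  finally have "l1 (inverse (fps_of_poly Q))"
    using assms(3) by (auto simp: stable_filter_iff intro!: l1_mult l1_add)
  then show ?thesis using assms(2) by (rule wl1_inverse_poly)
qed

text \<open>Common factors are cancelled first, since Bezout yields an l1 inverse of the denominator
  for a reduced fraction. As Q(0) is nonzero, so are the constant terms of both factors of Q, and
  the power series is unchanged by the cancellation.\<close>

lemma wl1_stable:
  fixes P Q :: "real poly"
  assumes "coeff Q 0 \<noteq> 0" "stable_filter P Q"
  shows "wl1 (fps_of_poly P / fps_of_poly Q)"
proof -
  have "gcd P Q \<noteq> 0" using assms(1) by auto
  then obtain P' Q' where PQ: "P = P' * gcd P Q" "Q = Q' * gcd P Q" "coprime P' Q'"
    using gcd_coprime_exists by blast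
  then have 0: "coeff (gcd P Q) 0 \<noteq> 0" "coeff Q' 0 \<noteq> 0"
    using assms(1) by (metis coeff_mult_0 mult_zero_right, metis coeff_mult_0 assms(1) PQ(2) mult_zero_left)
  have "fps_of_poly P / fps_of_poly Q = fps_of_poly P' / fps_of_poly Q'"
  proof -
    have "fps_of_poly P = fps_of_poly P' * fps_of_poly (gcd P Q)" "fps_of_poly Q = fps_of_poly Q' * fps_of_poly (gcd P Q)"
      using PQ(1,2) by (metis fps_of_poly_mult)+
    then have "fps_of_poly P / fps_of_poly Q = fps_of_poly P' * inverse (fps_of_poly Q') * (fps_of_poly (gcd P Q) * inverse (fps_of_poly (gcd P Q)))"
      unfolding fps_of_poly_divide[OF assms(1)] by (simp only: fps_inverse_mult mult_ac)
    also have "fps_of_poly (gcd P Q) * inverse (fps_of_poly (gcd P Q)) = 1"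
      using 0(1) by (intro inverse_mult_eq_1') simp
    finally show ?thesis using 0(2) by (simp add: fps_of_poly_divide)
  qed
  moreover from this have "stable_filter P' Q'" using assms(2) by (simp add: stable_filter_iff)
  ultimately show ?thesis
    using wl1_inverse_coprime[OF PQ(3) 0(2)] 0(2) by (auto simp: fps_of_poly_divide intro!: wl1_mult)
qed

section \<open>Filtering of bounded signals indexed by the integers\<close>

definition bnd :: "(int \<Rightarrow> real) \<Rightarrow> real \<Rightarrow> bool" where
  "bnd x B \<longleftrightarrow> (\<forall>t. \<bar>x t\<bar> \<le> B)"

lemma bndI: "(\<And>t. \<bar>x t\<bar> \<le> B) \<Longrightarrow> bnd x B"
  and bndD: "bnd x B \<Longrightarrow> \<bar>x t\<bar> \<le> B"
  and bnd_nonneg: "bnd x B \<Longrightarrow> 0 \<le> B"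
  unfolding bnd_def by (auto intro: order_trans[OF abs_ge_zero])

lemma conv_abs_summable:
  assumes "l1 f" "bnd x B"
  shows "summable (\<lambda>k. \<bar>fps_nth f k * x (t - int k)\<bar>)"
proof (rule summable_comparison_test')
  show "summable (\<lambda>k. \<bar>fps_nth f k\<bar> * B)" using assms(1) unfolding l1_def by (rule summable_mult2)
  show "norm \<bar>fps_nth f k * x (t - int k)\<bar> \<le> \<bar>fps_nth f k\<bar> * B" if "k \<ge> 0" for k
    using bndD[OF assms(2)] by (auto simp: abs_mult intro: mult_left_mono)
qed

lemma conv_summable:
  "l1 f \<Longrightarrow> bnd x B \<Longrightarrow> summable (\<lambda>k. fps_nth f k * x (t - int k))"
  by (rule summable_rabs_cancel[OF conv_abs_summable])

lemma conv_bound: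
  assumes "l1 f" "bnd x B"
  shows "\<bar>conv (fps_nth f) x t\<bar> \<le> norm1 f * B"
proof -
  have "\<bar>conv (fps_nth f) x t\<bar> \<le> (\<Sum>k. \<bar>fps_nth f k * x (t - int k)\<bar>)"
    unfolding conv_def by (rule summable_rabs[OF conv_abs_summable[OF assms]])
  also have "\<dots> \<le> (\<Sum>k. \<bar>fps_nth f k\<bar> * B)"
    by (intro suminf_le conv_abs_summable[OF assms] summable_mult2)
      (use assms(1) bndD[OF assms(2)] in \<open>auto simp: abs_mult l1_def intro: mult_left_mono\<close>)
  also have "\<dots> = norm1 f * B"
    using assms(1) unfolding l1_def norm1_def by (rule suminf_mult2[symmetric])
  finally show ?thesis .
qed

lemma conv_bnd: "l1 f \<Longrightarrow> bnd x B \<Longrightarrow> bnd (conv (fps_nth f) x) (norm1 f * B)"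
  by (rule bndI) (rule conv_bound)

lemma conv_add:
  assumes "l1 f" "l1 g" "bnd x B"
  shows "conv (fps_nth (f + g)) x t = conv (fps_nth f) x t + conv (fps_nth g) x t"
  unfolding conv_def using suminf_add[OF conv_summable[OF assms(1,3), of t] conv_summable[OF assms(2,3), of t]]
  by (simp add: algebra_simps)

lemma conv_uminus: "conv (fps_nth (- f)) x t = - conv (fps_nth f) x t" if "l1 f" "bnd x B"
  unfolding conv_def using suminf_minus[OF conv_summable[OF that], of t] by simp

lemma conv_diff:
  assumes "l1 f" "l1 g" "bnd x B"
  shows "conv (fps_nth (f - g)) x t = conv (fps_nth f) x t - conv (fps_nth g) x t"
  using conv_add[OF assms(1) _ assms(3), of "- g"] conv_uminus[OF assms(2,3)] assms(2) by simp

lemma conv_add_right: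
  assumes "l1 f" "bnd x B" "bnd y B'"
  shows "conv (fps_nth f) (\<lambda>t. x t + y t) t = conv (fps_nth f) x t + conv (fps_nth f) y t"
  unfolding conv_def using suminf_add[OF conv_summable[OF assms(1,2), of t] conv_summable[OF assms(1,3), of t]]
  by (simp add: algebra_simps)

lemma conv_const: "conv (fps_nth (fps_const c)) x t = c * x t"
  unfolding conv_def by (subst suminf_finite[of "{0}"]) auto

lemma conv_one: "conv (fps_nth 1) x = x"
  by (rule ext) (use conv_const[of 1] in simp)

lemma conv_step:
  assumes "l1 f" "bnd x B"
  shows "conv (fps_nth f) x t = fps_nth f 0 * x t + conv (fps_nth (fps_shift 1 f)) x (t - 1)"
  unfolding conv_def using suminf_split_head[OF conv_summable[OF assms], of t]
  by (simp add: algebra_simps)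

lemma conv_X_power:
  assumes "l1 f" "bnd x B"
  shows "conv (fps_nth (fps_X ^ n * f)) x t = conv (fps_nth f) x (t - int n)"
proof (induction n arbitrary: t)
  case (Suc n)
  have "conv (fps_nth (fps_X ^ Suc n * f)) x t = conv (fps_nth (fps_shift 1 (fps_X ^ Suc n * f))) x (t - 1)"
    by (subst conv_step[OF l1_X_power_mult[OF assms(1)] assms(2)]) simp
  also have "fps_shift 1 (fps_X ^ Suc n * f) = fps_X ^ n * f"
    by (rule fps_ext) (simp add: mult.assoc)
  finally show ?case using Suc.IH by (simp add: algebra_simps)
qed (simp add: conv_def)

text \<open>Peeling off $f_0$ leaves the discrepancy of the two sides unchanged up to the shift
  $f \mapsto (f - f_0)/q^{-1}$, $t \mapsto t - 1$; after $n$ steps it is bounded by twice the tail of $f$.\<close>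
lemma conv_mult:
  assumes f: "l1 f" and g: "l1 g" and x: "bnd x B"
  shows "conv (fps_nth (f * g)) x = conv (fps_nth f) (conv (fps_nth g) x)"
proof
  fix t
  define D where "D f t = conv (fps_nth (f * g)) x t - conv (fps_nth f) (conv (fps_nth g) x) t" for f t
  have gx: "bnd (conv (fps_nth g) x) (norm1 g * B)" by (rule conv_bnd[OF g x])
  have step: "D f t = D (fps_shift 1 f) (t - 1)" if f: "l1 f" for f t
  proof -
    have "f = fps_const (fps_nth f 0) + fps_X ^ 1 * fps_shift 1 f"
      by (subst cutoff_decomp[of f 1]) (auto intro!: fps_ext arg_cong2[of _ _ _ _ "(+)"])
    then have "f * g = fps_const (fps_nth f 0) * g + fps_X ^ 1 * (fps_shift 1 f * g)"
      by (metis distrib_right mult.assoc)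
    moreover have c: "l1 (fps_const (fps_nth f 0))" using l1_fps_of_poly[of "[:fps_nth f 0:]"] by (simp add: fps_of_poly_const)
    ultimately have "conv (fps_nth (f * g)) x t =
        conv (fps_nth (fps_const (fps_nth f 0) * g)) x t + conv (fps_nth (fps_shift 1 f * g)) x (t - 1)"
      by (simp only: conv_add[OF l1_mult[OF c g] l1_X_power_mult[OF l1_mult[OF l1_shift[OF f] g]] x]
          conv_X_power[OF l1_mult[OF l1_shift[OF f] g] x] of_nat_1)
    moreover have "conv (fps_nth (fps_const (fps_nth f 0) * g)) x t = fps_nth f 0 * conv (fps_nth g) x t"
      unfolding conv_def using suminf_mult[OF conv_summable[OF g x], of "fps_nth f 0" t] by (simp add: mult.assoc)
    ultimately show ?thesis unfolding D_def using conv_step[OF f gx, of t] by simp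
  qed
  have "D f t = D (fps_shift n f) (t - int n)" for n
  proof (induction n)
    case (Suc n)
    then show ?case using step[OF l1_shift[OF f, of n], of "t - int n"] by (simp add: algebra_simps fps_shift_fps_shift[symmetric])
  qed simp
  moreover have "\<bar>D (fps_shift n f) s\<bar> \<le> 2 * norm1 g * B * tail1 f n" for n s
  proof -
    have "norm1 (fps_shift n f * g) * B \<le> tail1 f n * norm1 g * B"
      unfolding tail1_def by (intro mult_right_mono norm1_mult l1_shift f g bnd_nonneg[OF x])
    then show ?thesis
      using conv_bound[OF l1_mult[OF l1_shift[OF f] g] x, of n s] conv_bound[OF l1_shift[OF f] gx, of n s]
      unfolding D_def tail1_def by (simp add: algebra_simps abs_le_iff)
  qed
  ultimately have le: "\<bar>D f t\<bar> \<le> 2 * norm1 g * B * tail1 f n" for n by metis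
  have "(\<lambda>n. 2 * norm1 g * B * tail1 f n) \<longlonglongrightarrow> 2 * norm1 g * B * 0"
    by (intro tendsto_mult_left tail1_LIMSEQ f)
  then have "\<bar>D f t\<bar> \<le> 0"
    using le by (intro LIMSEQ_le_const[of _ 0 "\<bar>D f t\<bar>"]) auto
  then show "conv (fps_nth (f * g)) x t = conv (fps_nth f) (conv (fps_nth g) x) t" unfolding D_def by simp
qed

lemma conv_cutoff: "conv (fps_nth (fps_cutoff n f)) x t = (\<Sum>k<n. fps_nth f k * x (t - int k))"
  unfolding conv_def by (subst suminf_finite[of "{..<n}"]) auto

lemma conv_finite:
  "(\<And>k. k > n \<Longrightarrow> fps_nth f k = 0) \<Longrightarrow> conv (fps_nth f) x t = (\<Sum>k\<le>n. fps_nth f k * x (t - int k))"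
  unfolding conv_def by (subst suminf_finite[of "{..n}"]) auto

lemma conv_cutoff_error:
  assumes "l1 f" "bnd x B"
  shows "\<bar>conv (fps_nth f) x t - (\<Sum>k<n. fps_nth f k * x (t - int k))\<bar> \<le> tail1 f n * B"
proof -
  have "conv (fps_nth f) x t - conv (fps_nth (fps_cutoff n f)) x t = conv (fps_nth (f - fps_cutoff n f)) x t"
    by (rule conv_diff[OF assms(1) l1_cutoff assms(2), symmetric])
  also have "\<bar>\<dots>\<bar> \<le> norm1 (f - fps_cutoff n f) * B"
    by (rule conv_bound[OF l1_diff[OF assms(1) l1_cutoff] assms(2)])
  also have "\<dots> \<le> tail1 f n * B"
    by (intro mult_right_mono norm1_minus_cutoff assms(1) bnd_nonneg[OF assms(2)])
  finally show ?thesis by (simp add: conv_cutoff)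
qed

section \<open>Least squares with a coercive normal matrix\<close>

lemma mat_inverse_exists:
  fixes R :: "real mat"
  assumes R: "R \<in> carrier_mat d d"
    and inj: "\<And>v. v \<in> carrier_vec d \<Longrightarrow> R *\<^sub>v v = 0\<^sub>v d \<Longrightarrow> v = 0\<^sub>v d"
  shows "mat_inverse R \<noteq> None" "minv R \<in> carrier_mat d d" "R * minv R = 1\<^sub>m d" "minv R * R = 1\<^sub>m d"
proof -
  have "Determinant.det R \<noteq> 0" using det_0_iff_vec_prod_zero_field[OF R] inj by blast
  then have "R \<in> Units (ring_mat TYPE(real) d ())" by (rule det_non_zero_imp_unit[OF R])
  then obtain B where B: "mat_inverse R = Some B" using mat_inverse(1)[OF R, of "()"] by auto
  then show "mat_inverse R \<noteq> None" by simp
  from mat_inverse(2)[OF R B] B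
  show "minv R \<in> carrier_mat d d" "R * minv R = 1\<^sub>m d" "minv R * R = 1\<^sub>m d"
    by (auto simp: minv_def)
qed

text \<open>The common shape of the two normal matrices of the algorithm: T is the time window and a
  is the factor 1/N.\<close>

definition gram :: "nat \<Rightarrow> 't set \<Rightarrow> real \<Rightarrow> ('t \<Rightarrow> nat \<Rightarrow> real) \<Rightarrow> real mat" where
  "gram d T a \<phi> = mat d d (\<lambda>(i,j). a * (\<Sum>t\<in>T. \<phi> t i * \<phi> t j))"

lemma gram_carrier [simp]: "gram d T a \<phi> \<in> carrier_mat d d"
  by (simp add: gram_def)

lemma gram_mult_vec:
  assumes "v \<in> carrier_vec d" "i < d"
  shows "vec_index (gram d T a \<phi> *\<^sub>v v) i = a * (\<Sum>t\<in>T. \<phi> t i * (\<Sum>j<d. \<phi> t j * vec_index v j))"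
proof -
  have "vec_index (gram d T a \<phi> *\<^sub>v v) i = (\<Sum>j<d. a * (\<Sum>t\<in>T. \<phi> t i * \<phi> t j) * vec_index v j)"
    using assms by (auto simp: gram_def scalar_prod_def atLeast0LessThan intro!: sum.cong)
  also have "\<dots> = a * (\<Sum>j<d. \<Sum>t\<in>T. \<phi> t i * (\<phi> t j * vec_index v j))"
    by (simp add: sum_distrib_left sum_distrib_right mult_ac)
  also have "(\<Sum>j<d. \<Sum>t\<in>T. \<phi> t i * (\<phi> t j * vec_index v j)) = (\<Sum>t\<in>T. \<phi> t i * (\<Sum>j<d. \<phi> t j * vec_index v j))"
    by (subst sum.swap) (simp add: sum_distrib_left)
  finally show ?thesis .
qed

lemma gram_quadratic_form:
  assumes "v \<in> carrier_vec d"
  shows "(\<Sum>i<d. vec_index v i * vec_index (gram d T a \<phi> *\<^sub>v v) i) =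
    a * (\<Sum>t\<in>T. (\<Sum>i<d. \<phi> t i * vec_index v i)\<^sup>2)"
proof -
  have "(\<Sum>i<d. vec_index v i * vec_index (gram d T a \<phi> *\<^sub>v v) i) =
      a * (\<Sum>i<d. \<Sum>t\<in>T. (\<phi> t i * vec_index v i) * (\<Sum>j<d. \<phi> t j * vec_index v j))"
    using assms by (simp add: gram_mult_vec sum_distrib_left mult_ac)
  also have "\<dots> = a * (\<Sum>t\<in>T. (\<Sum>i<d. \<phi> t i * vec_index v i)\<^sup>2)"
    by (subst sum.swap) (simp add: sum_distrib_right power2_eq_square)
  finally show ?thesis .
qed

lemma sum_abs_power2_le: "(\<Sum>i<d. \<bar>v i\<bar>)\<^sup>2 \<le> real d * (\<Sum>i<d. (v i :: real)\<^sup>2)"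
  using Cauchy_Schwarz_ineq_sum[of "\<lambda>_. 1" "\<lambda>i. \<bar>v i\<bar>" "{..<d}"] by simp

text \<open>Coercivity forces a trivial kernel and hence an inverse. For R x = v with |v| = 1 it
  gives c |x|^2 <= <x, v> <= |x|, so |x| <= 1/c. The norm bound asks for d > 0 because for d = 0
  there are no unit vectors and the supremum ranges over the empty set.\<close>

lemma gram_inverse:
  assumes c: "c > 0" and pe: "\<And>v. c * (\<Sum>i<d. (v i)\<^sup>2) \<le> a * (\<Sum>t\<in>T. (\<Sum>i<d. \<phi> t i * v i)\<^sup>2)"
  defines "R \<equiv> gram d T a \<phi>"
  shows "mat_inverse R \<noteq> None" "minv R \<in> carrier_mat d d" "R * minv R = 1\<^sub>m d"
    and "d > 0 \<Longrightarrow> mat_norm2 (minv R) \<le> 1 / c"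
proof -
  have R: "R \<in> carrier_mat d d" by (simp add: R_def)
  have coercive: "c * (\<Sum>i<d. (vec_index x i)\<^sup>2) \<le> (\<Sum>i<d. vec_index x i * vec_index (R *\<^sub>v x) i)"
    if "x \<in> carrier_vec d" for x
    using pe[of "vec_index x"] gram_quadratic_form[OF that, of T a \<phi>] by (simp add: R_def)
  have inj: "v = 0\<^sub>v d" if v: "v \<in> carrier_vec d" and "R *\<^sub>v v = 0\<^sub>v d" for v
  proof -
    have "(\<Sum>i<d. vec_index v i * vec_index (R *\<^sub>v v) i) = 0"
      using that by (intro sum.neutral) auto
    then have "c * (\<Sum>i<d. (vec_index v i)\<^sup>2) \<le> 0" using coercive[OF v] by simp
    then have "(\<Sum>i<d. (vec_index v i)\<^sup>2) \<le> 0" using c by (simp add: mult_le_0_iff)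
    then have "(\<Sum>i<d. (vec_index v i)\<^sup>2) = 0" by (intro antisym sum_nonneg) auto
    then have "\<forall>i<d. vec_index v i = 0" by (subst (asm) sum_nonneg_eq_0_iff) auto
    then show ?thesis using v by (intro eq_vecI) auto
  qed
  note inv = mat_inverse_exists[OF R inj]
  show "mat_inverse R \<noteq> None" "minv R \<in> carrier_mat d d" "R * minv R = 1\<^sub>m d"
    using inv by blast+
  have *: "vnorm2 (minv R *\<^sub>v v) \<le> 1 / c" if v: "v \<in> carrier_vec d" and n: "vnorm2 v = 1" for v
  proof -
    define x where "x = minv R *\<^sub>v v"
    have x: "x \<in> carrier_vec d" using inv(2) v unfolding x_def by simp
    have Rx: "R *\<^sub>v x = v" unfolding x_def
      using assoc_mult_mat_vec[OF R inv(2) v] inv(3) v by simp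
    define X where "X = (\<Sum>i<d. (vec_index x i)\<^sup>2)"
    have X0: "X \<ge> 0" unfolding X_def by (intro sum_nonneg) auto
    have v1: "(\<Sum>i<d. (vec_index v i)\<^sup>2) = 1"
      using n v by (simp add: vnorm2_def real_sqrt_eq_1_iff)
    have "(c * X)\<^sup>2 \<le> (\<Sum>i<d. vec_index x i * vec_index v i)\<^sup>2"
      using coercive[OF x] c X0 by (intro power_mono) (auto simp: Rx X_def)
    also have "\<dots> \<le> X * 1"
      unfolding X_def v1[symmetric] by (rule Cauchy_Schwarz_ineq_sum)
    finally have "c\<^sup>2 * X * X \<le> 1 * X" by (simp add: power2_eq_square mult_ac)
    then have "X = 0 \<or> c\<^sup>2 * X \<le> 1" using X0 mult_right_le_imp_le[of "c\<^sup>2 * X" X 1] by fastforce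
    then have "X \<le> (1 / c)\<^sup>2" using c by (auto simp: field_simps power2_eq_square)
    then have "sqrt X \<le> 1 / c" using c by (intro real_le_lsqrt) auto
    then show ?thesis using x by (simp add: vnorm2_def X_def x_def[symmetric])
  qed
  show "mat_norm2 (minv R) \<le> 1 / c" if "d > 0"
    unfolding mat_norm2_def
  proof (rule cSup_least)
    have dim: "dim_col (minv R) = d" using inv(2) by simp
    have "(\<Sum>i<d. (vec_index (unit_vec d 0) i :: real)\<^sup>2) = (\<Sum>i<d. if i = 0 then 1 else 0)"
      using that by (intro sum.cong refl) (simp add: unit_vec_def)
    then have "vnorm2 (unit_vec d 0) = 1"
      using that by (simp add: vnorm2_def)
    then have "\<exists>v. v \<in> carrier_vec d \<and> vnorm2 v = 1" using unit_vec_carrier by blast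
    then show "{vnorm2 (minv R *\<^sub>v v) |v. v \<in> carrier_vec (dim_col (minv R)) \<and> vnorm2 v = 1} \<noteq> {}"
      unfolding dim by blast
    show "x \<le> 1 / c" if "x \<in> {vnorm2 (minv R *\<^sub>v v) |v. v \<in> carrier_vec (dim_col (minv R)) \<and> vnorm2 v = 1}" for x
    proof -
      from that obtain v where "x = vnorm2 (minv R *\<^sub>v v)" "v \<in> carrier_vec d" "vnorm2 v = 1"
        unfolding dim by blast
      then show ?thesis using *[of v] by simp
    qed
  qed
qed

text \<open>For x the difference of the estimate and \<theta>, R x is the correlation of the
  regressors with the residual at \<theta>. Hence c |x|_2^2 <= |x|_1 \<rho>, and |x|_1^2 <= d
  |x|_2^2 introduces the factor d, which is 2n in the ARX step.\<close>

lemma least_squares_error: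
  assumes c: "c > 0" and pe: "\<And>v. c * (\<Sum>i<d. (v i)\<^sup>2) \<le> a * (\<Sum>t\<in>T. (\<Sum>i<d. \<phi> t i * v i)\<^sup>2)"
    and res: "\<And>i. i < d \<Longrightarrow> \<bar>a * (\<Sum>t\<in>T. \<phi> t i * (y t - (\<Sum>j<d. \<phi> t j * \<theta> j)))\<bar> \<le> \<rho>"
  shows "(\<Sum>i<d. \<bar>vec_index (minv (gram d T a \<phi>) *\<^sub>v vec d (\<lambda>i. a * (\<Sum>t\<in>T. \<phi> t i * y t))) i - \<theta> i\<bar>) \<le> real d * \<rho> / c"
proof -
  let ?R = "gram d T a \<phi>" and ?r = "vec d (\<lambda>i. a * (\<Sum>t\<in>T. \<phi> t i * y t))"
  define h where "h = minv ?R *\<^sub>v ?r"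
  note inv = gram_inverse[where c=c and d=d and a=a and T=T and \<phi>=\<phi>, OF c pe]
  have h: "h \<in> carrier_vec d" using inv(2) unfolding h_def by simp
  have Rh: "?R *\<^sub>v h = ?r" unfolding h_def
    using assoc_mult_mat_vec[OF gram_carrier[of d T a \<phi>] inv(2) vec_carrier] inv(3) by simp
  define x where "x i = vec_index h i - \<theta> i" for i
  have "c * (\<Sum>i<d. (x i)\<^sup>2) \<le> a * (\<Sum>t\<in>T. (\<Sum>i<d. \<phi> t i * x i)\<^sup>2)" by (rule pe)
  also have "\<dots> = (\<Sum>i<d. x i * vec_index (?R *\<^sub>v vec d x) i)"
    using gram_quadratic_form[of "vec d x" d T a \<phi>] by simp
  also have "\<dots> = (\<Sum>i<d. x i * (a * (\<Sum>t\<in>T. \<phi> t i * (y t - (\<Sum>j<d. \<phi> t j * \<theta> j)))))"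
  proof (intro sum.cong refl arg_cong2[of _ _ _ _ "(*)"])
    fix i assume i: "i \<in> {..<d}"
    have "vec_index (?R *\<^sub>v vec d x) i = a * (\<Sum>t\<in>T. \<phi> t i * (\<Sum>j<d. \<phi> t j * vec_index h j)) - a * (\<Sum>t\<in>T. \<phi> t i * (\<Sum>j<d. \<phi> t j * \<theta> j))"
      using i by (simp add: gram_mult_vec x_def right_diff_distrib sum_subtractf)
    also have "a * (\<Sum>t\<in>T. \<phi> t i * (\<Sum>j<d. \<phi> t j * vec_index h j)) = a * (\<Sum>t\<in>T. \<phi> t i * y t)"
      using gram_mult_vec[OF h, of i T a \<phi>] i by (simp only: Rh index_vec lessThan_iff)
    finally show "vec_index (?R *\<^sub>v vec d x) i = a * (\<Sum>t\<in>T. \<phi> t i * (y t - (\<Sum>j<d. \<phi> t j * \<theta> j)))"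
      by (simp add: right_diff_distrib sum_subtractf)
  qed
  also have "\<dots> \<le> (\<Sum>i<d. \<bar>x i\<bar> * \<rho>)"
  proof (rule sum_mono)
    fix i assume "i \<in> {..<d}"
    then have "\<bar>x i * (a * (\<Sum>t\<in>T. \<phi> t i * (y t - (\<Sum>j<d. \<phi> t j * \<theta> j))))\<bar> \<le> \<bar>x i\<bar> * \<rho>"
      unfolding abs_mult[of "x i"] by (intro mult_left_mono res) auto
    then show "x i * (a * (\<Sum>t\<in>T. \<phi> t i * (y t - (\<Sum>j<d. \<phi> t j * \<theta> j)))) \<le> \<bar>x i\<bar> * \<rho>"
      by linarith
  qed
  finally have 1: "c * (\<Sum>i<d. (x i)\<^sup>2) \<le> (\<Sum>i<d. \<bar>x i\<bar>) * \<rho>" by (simp add: sum_distrib_right)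
  define S where "S = (\<Sum>i<d. \<bar>x i\<bar>)"
  have S0: "S \<ge> 0" unfolding S_def by (intro sum_nonneg) auto
  have "c * S\<^sup>2 \<le> c * (real d * (\<Sum>i<d. (x i)\<^sup>2))"
    unfolding S_def using c by (intro mult_left_mono sum_abs_power2_le) auto
  also have "\<dots> \<le> real d * (S * \<rho>)"
    using mult_left_mono[OF 1, of "real d"] by (simp add: S_def mult_ac)
  finally have "(c * S) * S \<le> (real d * \<rho>) * S" by (simp add: power2_eq_square mult_ac)
  then have "S = 0 \<or> c * S \<le> real d * \<rho>" using S0 mult_right_le_imp_le[of "c * S" S "real d * \<rho>"] by fastforce
  \<comment> \<open>Settles the case S = 0; for d = 0 the assumption \<open>res\<close> says nothing
    about the sign of \<rho>.\<close>
  moreover have "real d * \<rho> \<ge> 0"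
    using order_trans[OF abs_ge_zero res[of 0]] by (cases "d = 0") auto
  ultimately have "S \<le> real d * \<rho> / c" using c by (auto simp: field_simps)
  then show ?thesis by (simp add: S_def x_def h_def)
qed

text \<open>The left inverse $(A^{T}A)^{-1}A^{T}$ supplies the constant.\<close>
lemma injective_lower_bound:
  fixes A :: "'t \<Rightarrow> nat \<Rightarrow> real"
  assumes fin: "finite K" and inj: "\<And>v i. (\<And>k. k \<in> K \<Longrightarrow> (\<Sum>i<d. A k i * v i) = 0) \<Longrightarrow> i < d \<Longrightarrow> v i = 0"
  obtains c where "c > 0" "\<And>v. c * (\<Sum>i<d. (v i)\<^sup>2) \<le> (\<Sum>k\<in>K. (\<Sum>i<d. A k i * v i)\<^sup>2)"
proof -
  let ?R = "gram d K 1 A"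
  have inj': "x = 0\<^sub>v d" if x: "x \<in> carrier_vec d" and "?R *\<^sub>v x = 0\<^sub>v d" for x
  proof -
    have "(\<Sum>i<d. vec_index x i * vec_index (?R *\<^sub>v x) i) = 0"
      using that by (intro sum.neutral) auto
    then have "(\<Sum>k\<in>K. (\<Sum>i<d. A k i * vec_index x i)\<^sup>2) = 0"
      using gram_quadratic_form[OF x, of K 1 A] by simp
    then have "\<And>k. k \<in> K \<Longrightarrow> (\<Sum>i<d. A k i * vec_index x i) = 0"
      using fin by (subst (asm) sum_nonneg_eq_0_iff) auto
    then have "i < d \<Longrightarrow> vec_index x i = 0" for i by (rule inj)
    then show ?thesis using x by (intro eq_vecI) auto
  qed
  note inv = mat_inverse_exists[OF gram_carrier[of d K 1 A] inj']
  define M where "M i k = (\<Sum>j<d. (minv ?R) $$ (i,j) * A k j)" for i k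
  have left_inv: "v i = (\<Sum>k\<in>K. M i k * (\<Sum>i<d. A k i * v i))" if i: "i < d" for v i
  proof -
    have "v i = vec_index (minv ?R *\<^sub>v (?R *\<^sub>v vec d v)) i"
      using assoc_mult_mat_vec[OF inv(2) gram_carrier[of d K 1 A] vec_carrier[of d v]] inv(4) i by simp
    also have "\<dots> = (\<Sum>j<d. (minv ?R) $$ (i,j) * vec_index (?R *\<^sub>v vec d v) j)"
      using inv(2) i by (auto simp: scalar_prod_def atLeast0LessThan gram_def intro!: sum.cong)
    also have "\<dots> = (\<Sum>j<d. (minv ?R) $$ (i,j) * (\<Sum>k\<in>K. A k j * (\<Sum>i<d. A k i * v i)))"
      by (intro sum.cong refl) (simp add: gram_mult_vec)
    also have "\<dots> = (\<Sum>j<d. \<Sum>k\<in>K. (minv ?R) $$ (i,j) * A k j * (\<Sum>i<d. A k i * v i))"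
      by (subst sum_distrib_left) (simp only: mult.assoc)
    also have "\<dots> = (\<Sum>k\<in>K. M i k * (\<Sum>i<d. A k i * v i))"
      by (subst sum.swap) (simp add: M_def sum_distrib_right)
    finally show ?thesis .
  qed
  \<comment> \<open>The squared Frobenius norm of the left inverse; the summand 1 keeps it positive
    in degenerate cases.\<close>
  define B where "B = 1 + (\<Sum>i<d. \<Sum>k\<in>K. (M i k)\<^sup>2)"
  have B: "B > 0" unfolding B_def by (intro add_pos_nonneg sum_nonneg) auto
  show ?thesis
  proof (rule that[of "1 / B"])
    show "1 / B > 0" using B by simp
    fix v
    let ?Q = "\<Sum>k\<in>K. (\<Sum>i<d. A k i * v i)\<^sup>2"
    have Q: "?Q \<ge> 0" by (intro sum_nonneg) auto
    have "(\<Sum>i<d. (v i)\<^sup>2) \<le> (\<Sum>i<d. (\<Sum>k\<in>K. (M i k)\<^sup>2) * ?Q)"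
    proof (rule sum_mono)
      fix i assume "i \<in> {..<d}"
      then have "(v i)\<^sup>2 = (\<Sum>k\<in>K. M i k * (\<Sum>i<d. A k i * v i))\<^sup>2" by (subst left_inv) auto
      then show "(v i)\<^sup>2 \<le> (\<Sum>k\<in>K. (M i k)\<^sup>2) * ?Q" using Cauchy_Schwarz_ineq_sum by metis
    qed
    also have "\<dots> \<le> B * ?Q" unfolding sum_distrib_right[symmetric] B_def using Q by (intro mult_right_mono) auto
    finally show "1 / B * (\<Sum>i<d. (v i)\<^sup>2) \<le> ?Q" using B by (simp add: field_simps)
  qed
qed

section \<open>Regressors of filtered white noise\<close>

text \<open>\<open>z True\<close> and \<open>z False\<close> stand for the paths of w and e, read as
  one white process with covariance \<sigma>^2 times the identity. Lags run along the whole path, so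
  times before the record occur.\<close>

definition cov_close :: "(bool \<Rightarrow> int \<Rightarrow> real) \<Rightarrow> real \<Rightarrow> nat \<Rightarrow> nat \<Rightarrow> real \<Rightarrow> bool" where
  "cov_close z \<sigma> N L \<epsilon> \<longleftrightarrow> (\<forall>a b i j. i \<le> L \<longrightarrow> j \<le> L \<longrightarrow>
    \<bar>1 / real N * (\<Sum>t\<in>{1..int N}. z a (t - int i) * z b (t - int j)) - (if a = b \<and> i = j then \<sigma>\<^sup>2 else 0)\<bar> \<le> \<epsilon>)"

lemma cov_closeD:
  "cov_close z \<sigma> N L \<epsilon> \<Longrightarrow> i \<le> L \<Longrightarrow> j \<le> L \<Longrightarrow>
    \<bar>1 / real N * (\<Sum>t\<in>{1..int N}. z a (t - int i) * z b (t - int j)) - (if a = b \<and> i = j then \<sigma>\<^sup>2 else 0)\<bar> \<le> \<epsilon>"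
  unfolding cov_close_def by blast

lemma cov_close_nonneg: "cov_close z \<sigma> N L \<epsilon> \<Longrightarrow> 0 \<le> \<epsilon>"
  using cov_closeD[of z \<sigma> N L \<epsilon> 0 0] by (meson abs_ge_zero order_trans le0)

text \<open>Expanding the square gives the quadratic form of the sample covariance matrix. Replacing
  each entry by its limit costs \<epsilon> times the square of the l1 norm of p, with no further
  dependence on the number of lags.\<close>

lemma sum_power2_ge_of_cov_close:
  fixes p :: "bool \<Rightarrow> nat \<Rightarrow> real"
  assumes cov: "cov_close z \<sigma> N L \<epsilon>"
  shows "\<sigma>\<^sup>2 * (\<Sum>(b,k)\<in>UNIV\<times>{..L}. (p b k)\<^sup>2) - \<epsilon> * (\<Sum>(b,k)\<in>UNIV\<times>{..L}. \<bar>p b k\<bar>)\<^sup>2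
    \<le> 1 / real N * (\<Sum>t\<in>{1..int N}. (\<Sum>(b,k)\<in>UNIV\<times>{..L}. p b k * z b (t - int k))\<^sup>2)"
proof -
  let ?I = "(UNIV :: bool set) \<times> {..L}"
  define q where "q \<alpha> = p (fst \<alpha>) (snd \<alpha>)" for \<alpha>
  define x where "x \<alpha> t = z (fst \<alpha>) (t - int (snd \<alpha>))" for \<alpha> t
  define c where "c \<alpha> \<beta> = 1 / real N * (\<Sum>t\<in>{1..int N}. x \<alpha> t * x \<beta> t)" for \<alpha> \<beta>
  have c: "\<bar>c \<alpha> \<beta> - (if \<alpha> = \<beta> then \<sigma>\<^sup>2 else 0)\<bar> \<le> \<epsilon>" if "\<alpha> \<in> ?I" "\<beta> \<in> ?I" for \<alpha> \<beta>
    using cov_closeD[OF cov, of "snd \<alpha>" "snd \<beta>" "fst \<alpha>" "fst \<beta>"] that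
    unfolding c_def x_def by (auto simp: prod_eq_iff)
  have "1 / real N * (\<Sum>t\<in>{1..int N}. (\<Sum>\<alpha>\<in>?I. q \<alpha> * x \<alpha> t)\<^sup>2) =
      (\<Sum>t\<in>{1..int N}. \<Sum>\<alpha>\<in>?I. \<Sum>\<beta>\<in>?I. q \<alpha> * q \<beta> * (1 / real N * (x \<alpha> t * x \<beta> t)))"
    by (simp add: power2_eq_square sum_product sum_distrib_left mult_ac)
  also have "\<dots> = (\<Sum>\<alpha>\<in>?I. \<Sum>\<beta>\<in>?I. q \<alpha> * q \<beta> * c \<alpha> \<beta>)"
    unfolding c_def sum_distrib_left by (subst sum.swap, intro sum.cong refl, subst sum.swap) simp
  finally have eq: "1 / real N * (\<Sum>t\<in>{1..int N}. (\<Sum>\<alpha>\<in>?I. q \<alpha> * x \<alpha> t)\<^sup>2) = \<dots>" .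
  have "\<sigma>\<^sup>2 * (\<Sum>\<alpha>\<in>?I. (q \<alpha>)\<^sup>2) = (\<Sum>\<alpha>\<in>?I. \<Sum>\<beta>\<in>?I. q \<alpha> * q \<beta> * (if \<alpha> = \<beta> then \<sigma>\<^sup>2 else 0))"
    by (simp add: sum_distrib_left power2_eq_square if_distrib[of "\<lambda>y. _ * y"] mult_ac cong: if_cong)
  also have "\<dots> \<le> (\<Sum>\<alpha>\<in>?I. \<Sum>\<beta>\<in>?I. q \<alpha> * q \<beta> * c \<alpha> \<beta> + \<bar>q \<alpha>\<bar> * \<bar>q \<beta>\<bar> * \<epsilon>)"
  proof (intro sum_mono)
    fix \<alpha> \<beta> assume *: "\<alpha> \<in> ?I" "\<beta> \<in> ?I"
    have "\<bar>q \<alpha> * q \<beta> * (c \<alpha> \<beta> - (if \<alpha> = \<beta> then \<sigma>\<^sup>2 else 0))\<bar> \<le> \<bar>q \<alpha>\<bar> * \<bar>q \<beta>\<bar> * \<epsilon>"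
      unfolding abs_mult by (intro mult_left_mono c *) auto
    then show "q \<alpha> * q \<beta> * (if \<alpha> = \<beta> then \<sigma>\<^sup>2 else 0) \<le> q \<alpha> * q \<beta> * c \<alpha> \<beta> + \<bar>q \<alpha>\<bar> * \<bar>q \<beta>\<bar> * \<epsilon>"
      unfolding right_diff_distrib by linarith
  qed
  also have "\<dots> = (\<Sum>\<alpha>\<in>?I. \<Sum>\<beta>\<in>?I. q \<alpha> * q \<beta> * c \<alpha> \<beta>) + \<epsilon> * (\<Sum>\<alpha>\<in>?I. \<bar>q \<alpha>\<bar>)\<^sup>2"
    by (simp add: sum.distrib power2_eq_square sum_product sum_distrib_left mult_ac)
  finally show ?thesis unfolding eq[symmetric] by (simp add: q_def x_def case_prod_unfold)
qed

lemma sum_bool_prod: "(\<Sum>(b,k)\<in>UNIV\<times>{..L}. f b k) = (\<Sum>k\<le>L. f True k) + (\<Sum>k\<le>(L::nat). f False k)"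
  for f :: "bool \<Rightarrow> nat \<Rightarrow> real"
  by (simp add: sum.cartesian_product[symmetric] UNIV_bool add.commute)

text \<open>Cutting both filters after lag L leaves a moving average a that is governed by
  \<open>cov\<close>. For x = a + r, x^2 >= a^2 + 2 a r with |a| <= C S and |r| <= C T; the square
  of r is nonnegative and is dropped.\<close>

lemma conv_power2_mean_ge:
  assumes l1: "l1 P" "l1 Q" and z: "\<And>b. bnd (z b) C" and cov: "cov_close z \<sigma> N L \<epsilon>"
  defines "S \<equiv> norm1 P + norm1 Q" and "T \<equiv> tail1 P (Suc L) + tail1 Q (Suc L)"
  shows "\<sigma>\<^sup>2 * (\<Sum>k\<le>L. (fps_nth P k)\<^sup>2 + (fps_nth Q k)\<^sup>2) - (\<epsilon> * S\<^sup>2 + 2 * C\<^sup>2 * S * T)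
    \<le> 1 / real N * (\<Sum>t\<in>{1..int N}. (conv (fps_nth P) (z True) t + conv (fps_nth Q) (z False) t)\<^sup>2)"
proof -
  define p where "p b = fps_nth (if b then P else Q)" for b
  define a where "a t = (\<Sum>(b,k)\<in>UNIV\<times>{..L}. p b k * z b (t - int k))" for t
  define x where "x t = conv (fps_nth P) (z True) t + conv (fps_nth Q) (z False) t" for t
  have C: "C \<ge> 0" by (rule bnd_nonneg[OF z[of True]])
  have S: "S \<ge> 0" unfolding S_def using l1 norm1_nonneg by auto
  have T: "T \<ge> 0" unfolding T_def using l1 tail1_nonneg by auto
  have sum_p: "(\<Sum>(b,k)\<in>UNIV\<times>{..L}. \<bar>p b k\<bar>) \<le> S"
    using sum_abs_le_norm1[OF l1(1), of "{..L}"] sum_abs_le_norm1[OF l1(2), of "{..L}"]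
    unfolding sum_bool_prod[of "\<lambda>b k. \<bar>p b k\<bar>"] S_def by (simp add: p_def)
  have p0: "(\<Sum>(b,k)\<in>UNIV\<times>{..L}. \<bar>p b k\<bar>) \<ge> 0" by (intro sum_nonneg) auto
  have a: "\<bar>a t\<bar> \<le> C * S" for t
  proof -
    have "\<bar>a t\<bar> \<le> (\<Sum>(b,k)\<in>UNIV\<times>{..L}. C * \<bar>p b k\<bar>)"
      unfolding a_def case_prod_unfold
      by (rule order_trans[OF sum_abs])
        (auto simp: abs_mult mult.commute[of C] intro!: sum_mono mult_left_mono bndD[OF z])
    also have "\<dots> = C * (\<Sum>(b,k)\<in>UNIV\<times>{..L}. \<bar>p b k\<bar>)" by (simp add: sum_distrib_left case_prod_unfold)
    also have "\<dots> \<le> C * S" using sum_p C by (intro mult_left_mono)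
    finally show ?thesis .
  qed
  have xa: "\<bar>x t - a t\<bar> \<le> T * C" for t
  proof -
    have "a t = (\<Sum>k<Suc L. fps_nth P k * z True (t - int k)) + (\<Sum>k<Suc L. fps_nth Q k * z False (t - int k))"
      unfolding a_def sum_bool_prod[of "\<lambda>b k. p b k * z b (t - int k)"] by (simp add: p_def lessThan_Suc_atMost)
    then show ?thesis
      using conv_cutoff_error[OF l1(1) z, of True t "Suc L"] conv_cutoff_error[OF l1(2) z, of False t "Suc L"]
      unfolding x_def T_def by (simp add: distrib_right)
  qed
  have "(a t)\<^sup>2 - 2 * C\<^sup>2 * S * T \<le> (x t)\<^sup>2" for t
  proof -
    have "\<bar>a t * (x t - a t)\<bar> \<le> (C * S) * (T * C)"
      unfolding abs_mult using a xa C S by (intro mult_mono) auto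
    moreover have "(x t)\<^sup>2 = (a t)\<^sup>2 + 2 * (a t * (x t - a t)) + (x t - a t)\<^sup>2"
      by (simp add: power2_eq_square algebra_simps)
    moreover have "(C * S) * (T * C) = C\<^sup>2 * S * T" by (simp add: power2_eq_square mult_ac)
    ultimately show ?thesis using zero_le_power2[of "x t - a t"] by linarith
  qed
  then have "1 / real N * (\<Sum>t\<in>{1..int N}. (a t)\<^sup>2 - 2 * C\<^sup>2 * S * T) \<le> 1 / real N * (\<Sum>t\<in>{1..int N}. (x t)\<^sup>2)"
    by (intro mult_left_mono sum_mono) auto
  then have "1 / real N * (\<Sum>t\<in>{1..int N}. (a t)\<^sup>2) - 2 * C\<^sup>2 * S * T \<le> 1 / real N * (\<Sum>t\<in>{1..int N}. (x t)\<^sup>2)"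
    using S T C by (cases "N = 0") (auto simp: sum_subtractf field_simps)
  moreover have "\<sigma>\<^sup>2 * (\<Sum>(b,k)\<in>UNIV\<times>{..L}. (p b k)\<^sup>2) - \<epsilon> * (\<Sum>(b,k)\<in>UNIV\<times>{..L}. \<bar>p b k\<bar>)\<^sup>2
      \<le> 1 / real N * (\<Sum>t\<in>{1..int N}. (a t)\<^sup>2)"
    unfolding a_def by (rule sum_power2_ge_of_cov_close[OF cov])
  moreover have "\<epsilon> * (\<Sum>(b,k)\<in>UNIV\<times>{..L}. \<bar>p b k\<bar>)\<^sup>2 \<le> \<epsilon> * S\<^sup>2"
    using sum_p p0 cov_close_nonneg[OF cov] by (intro mult_left_mono power_mono)
  moreover have "(\<Sum>(b,k)\<in>UNIV\<times>{..L}. (p b k)\<^sup>2) = (\<Sum>k\<le>L. (fps_nth P k)\<^sup>2 + (fps_nth Q k)\<^sup>2)"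
    unfolding sum_bool_prod[of "\<lambda>b k. (p b k)\<^sup>2"] by (simp add: p_def sum.distrib)
  ultimately show ?thesis unfolding x_def by simp
qed

section \<open>Linear combinations of regressors as filter outputs\<close>

definition delay :: "nat \<Rightarrow> (nat \<Rightarrow> real) \<Rightarrow> real fps" where
  "delay d v = Abs_fps (\<lambda>k. if 1 \<le> k \<and> k \<le> d then v (k - 1) else 0)"

lemma delay_nth: "fps_nth (delay d v) k = (if 1 \<le> k \<and> k \<le> d then v (k - 1) else 0)"
  by (simp add: delay_def)

lemma sum_delay_shift:
  fixes g :: "nat \<Rightarrow> real"
  assumes "\<And>k. \<not> (1 \<le> k \<and> k \<le> d) \<Longrightarrow> g k = 0"
  shows "(\<Sum>k\<le>d. g k) = (\<Sum>i<d. g (Suc i))"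
proof -
  have "(\<Sum>k\<le>d. g k) = g 0 + (\<Sum>i<d. g (Suc i))"
    by (metis sum.atMost_shift)
  then show ?thesis using assms[of 0] by simp
qed

lemma l1_delay [simp]: "l1 (delay d v)" and norm1_delay: "norm1 (delay d v) = (\<Sum>i<d. \<bar>v i\<bar>)"
proof -
  have fin: "finite {..d}" "\<And>k. k \<notin> {..d} \<Longrightarrow> \<bar>fps_nth (delay d v) k\<bar> = 0"
    by (auto simp: delay_nth)
  show "l1 (delay d v)" unfolding l1_def by (rule summable_finite[OF fin])
  show "norm1 (delay d v) = (\<Sum>i<d. \<bar>v i\<bar>)" unfolding norm1_def
    by (subst suminf_finite[OF fin], simp, subst sum_delay_shift) (auto simp: delay_nth)
qed

lemma conv_delay: "conv (fps_nth (delay d v)) x t = (\<Sum>i<d. v i * x (t - int (i + 1)))"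
  by (subst conv_finite[of d], simp add: delay_nth, subst sum_delay_shift) (auto simp: delay_nth)

lemma sum_power2_delay:
  assumes "d \<le> L"
  shows "(\<Sum>k\<le>L. (fps_nth (delay d v) k)\<^sup>2) = (\<Sum>i<d. (v i)\<^sup>2)"
proof -
  have "(\<Sum>k\<le>L. (fps_nth (delay d v) k)\<^sup>2) = (\<Sum>k\<le>d. (fps_nth (delay d v) k)\<^sup>2)"
    by (rule sum.mono_neutral_right) (use assms in \<open>auto simp: delay_nth\<close>)
  also have "\<dots> = (\<Sum>i<d. (v i)\<^sup>2)" by (subst sum_delay_shift) (auto simp: delay_nth)
  finally show ?thesis .
qed

lemma sum_split_halves: "(\<Sum>i<2*d. f i) = (\<Sum>i<d. f i) + (\<Sum>i<d. f (d + i))"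
  for f :: "nat \<Rightarrow> real"
proof -
  have "{..<2*d} = {..<d} \<union> {d..<d+d}" by auto
  then have "(\<Sum>i<2*d. f i) = (\<Sum>i<d. f i) + (\<Sum>i=d..<d+d. f i)"
    by (simp add: sum.union_disjoint ivl_disj_int)
  also have "(\<Sum>i=d..<d+d. f i) = (\<Sum>i<d. f (d + i))"
    using sum.shift_bounds_nat_ivl[of f 0 d d] by (simp add: atLeast0LessThan add.commute)
  finally show ?thesis .
qed

text \<open>A combination of regressors is itself a filter applied to the data, which turns
  excitation into a question on power series. \<open>delay\<close> puts entry i at power i+1 because
  regressors start at lag 1.\<close>

lemma arx_phi_sum:
  "(\<Sum>i<2*d. arx_phi d y u t i * v i) =
    - conv (fps_nth (delay d v)) y t + conv (fps_nth (delay d (\<lambda>i. v (d + i)))) u t"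
  unfolding sum_split_halves[of "\<lambda>i. arx_phi d y u t i * v i"]
  by (simp add: arx_phi_def conv_delay sum_negf mult.commute)

lemma arx_phi_sum_abs_le:
  assumes "\<And>s. t - int d \<le> s \<Longrightarrow> s < t \<Longrightarrow> \<bar>y s\<bar> \<le> Y" "\<And>s. t - int d \<le> s \<Longrightarrow> s < t \<Longrightarrow> \<bar>u s\<bar> \<le> Y"
  shows "\<bar>\<Sum>i<2*d. arx_phi d y u t i * v i\<bar> \<le> (\<Sum>i<2*d. \<bar>v i\<bar>) * Y"
proof -
  have "\<bar>arx_phi d y u t i\<bar> \<le> Y" if "i < 2 * d" for i
    using that assms by (auto simp: arx_phi_def)
  then have "\<bar>\<Sum>i<2*d. arx_phi d y u t i * v i\<bar> \<le> (\<Sum>i<2*d. \<bar>v i\<bar> * Y)"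
    by (intro order_trans[OF sum_abs] sum_mono)
      (auto simp: abs_mult mult.commute[of _ "\<bar>v _\<bar>"] intro!: mult_left_mono)
  then show ?thesis by (simp add: sum_distrib_right)
qed

lemma arx_phi_diff: "arx_phi d y u t i - arx_phi d y' u' t i = arx_phi d (\<lambda>s. y s - y' s) (\<lambda>s. u s - u' s) t i"
  by (simp add: arx_phi_def)

text \<open>The weights form polynomials of degree at most n, so beyond lag 2n their products with
  the data filters see only filter coefficients beyond lag n. Covariances up to lag 2n therefore
  suffice, up to tails from n+1 on, and all errors scale with |v|_1^2.\<close>

lemma regressor_power2_mean_ge:
  assumes l1: "l1 P1" "l1 Q1" "l1 P2" "l1 Q2" and z: "\<And>b. bnd (z b) C"
    and cov: "cov_close z \<sigma> N (2 * n) \<epsilon>" and d: "d \<le> n"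
    and y: "\<And>t. y t = conv (fps_nth P1) (z True) t + conv (fps_nth Q1) (z False) t"
    and u: "\<And>t. u t = conv (fps_nth P2) (z True) t + conv (fps_nth Q2) (z False) t"
    and lower: "\<kappa> * (\<Sum>i<2*d. (v i)\<^sup>2) \<le> (\<Sum>k\<le>2*n.
      (fps_nth (- delay d v * P1 + delay d (\<lambda>i. v (d + i)) * P2) k)\<^sup>2 +
      (fps_nth (- delay d v * Q1 + delay d (\<lambda>i. v (d + i)) * Q2) k)\<^sup>2)"
  defines "S \<equiv> norm1 P1 + norm1 Q1 + norm1 P2 + norm1 Q2"
    and "T \<equiv> tail1 P1 (Suc n) + tail1 Q1 (Suc n) + tail1 P2 (Suc n) + tail1 Q2 (Suc n)"
  shows "\<sigma>\<^sup>2 * \<kappa> * (\<Sum>i<2*d. (v i)\<^sup>2) - (\<Sum>i<2*d. \<bar>v i\<bar>)\<^sup>2 * (\<epsilon> * S\<^sup>2 + 2 * C\<^sup>2 * S * T)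
    \<le> 1 / real N * (\<Sum>t\<in>{1..int N}. (\<Sum>i<2*d. arx_phi d y u t i * v i)\<^sup>2)"
proof -
  let ?V1 = "delay d v" and ?V2 = "delay d (\<lambda>i. v (d + i))"
  let ?P = "- ?V1 * P1 + ?V2 * P2" and ?Q = "- ?V1 * Q1 + ?V2 * Q2"
  define V where "V = (\<Sum>i<2*d. \<bar>v i\<bar>)"
  have VV: "V = norm1 ?V1 + norm1 ?V2" by (simp add: V_def norm1_delay sum_split_halves)
  have V1: "norm1 ?V1 \<le> V" "norm1 ?V2 \<le> V" "V \<ge> 0"
    unfolding VV using norm1_nonneg[OF l1_delay, of d v] norm1_nonneg[OF l1_delay, of d "\<lambda>i. v (d + i)"] by auto
  have lPQ: "l1 ?P" "l1 ?Q" by (intro l1_add l1_mult l1; simp)+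
  have S: "S \<ge> 0" unfolding S_def using l1 norm1_nonneg by simp
  have T: "T \<ge> 0" unfolding T_def using l1 tail1_nonneg by simp
  have e: "\<epsilon> \<ge> 0" by (rule cov_close_nonneg[OF cov])
  have norm_le: "norm1 (- ?V1 * f + ?V2 * g) \<le> V * (norm1 f + norm1 g)" if "l1 f" "l1 g" for f g
  proof -
    have "norm1 (- ?V1 * f + ?V2 * g) \<le> norm1 (?V1 * f) + norm1 (?V2 * g)"
      using norm1_add[of "- ?V1 * f" "?V2 * g"] l1_mult that by simp
    also have "\<dots> \<le> V * norm1 f + V * norm1 g"
      using V1 that by (intro add_mono order_trans[OF norm1_mult] mult_right_mono norm1_nonneg) auto
    finally show ?thesis by (simp add: distrib_left)
  qed
  have tail_le: "tail1 (- ?V1 * f + ?V2 * g) (Suc (2 * n)) \<le> V * (tail1 f (Suc n) + tail1 g (Suc n))"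
    if fg: "l1 f" "l1 g" for f g
  proof -
    have tl: "tail1 (delay d v' * h) (Suc (2 * n)) \<le> V * tail1 h (Suc n)" if h: "l1 h" and v': "norm1 (delay d v') \<le> V" for v' h
    proof -
      have "tail1 (delay d v' * h) (n + Suc n) \<le> norm1 (delay d v') * tail1 h (Suc n)"
        using d by (intro tail1_mult_le h) (auto simp: delay_nth)
      also have "\<dots> \<le> V * tail1 h (Suc n)" by (intro mult_right_mono v' tail1_nonneg h)
      finally show ?thesis by (simp add: mult_2)
    qed
    have "tail1 (- ?V1 * f + ?V2 * g) (Suc (2 * n)) \<le> tail1 (?V1 * f) (Suc (2 * n)) + tail1 (?V2 * g) (Suc (2 * n))"
      using tail1_add[of "- ?V1 * f" "?V2 * g"] l1_mult fg by simp
    then show ?thesis using tl[OF fg(1) V1(1)] tl[OF fg(2) V1(2)] by (simp add: distrib_left)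
  qed
  have norm_PQ: "norm1 ?P + norm1 ?Q \<le> V * S"
    using norm_le[OF l1(1,3)] norm_le[OF l1(2,4)] unfolding S_def by (simp add: algebra_simps)
  have tail_PQ: "tail1 ?P (Suc (2 * n)) + tail1 ?Q (Suc (2 * n)) \<le> V * T"
    using tail_le[OF l1(1,3)] tail_le[OF l1(2,4)] unfolding T_def by (simp add: algebra_simps)
  have y_eq: "(\<Sum>i<2*d. arx_phi d y u t i * v i) = conv (fps_nth ?P) (z True) t + conv (fps_nth ?Q) (z False) t" for t
  proof -
    have by_: "bnd (conv (fps_nth f) (z b)) (norm1 f * C)" if "l1 f" for f b by (rule conv_bnd[OF that z])
    have c2: "conv (fps_nth (delay d v')) (\<lambda>t. conv (fps_nth f) (z True) t + conv (fps_nth g) (z False) t) t =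
        conv (fps_nth (delay d v' * f)) (z True) t + conv (fps_nth (delay d v' * g)) (z False) t"
      if "l1 f" "l1 g" for f g v'
      by (subst conv_add_right[OF l1_delay by_ by_]) (simp_all add: conv_mult[OF l1_delay _ z] that)
    have "y = (\<lambda>t. conv (fps_nth P1) (z True) t + conv (fps_nth Q1) (z False) t)"
      "u = (\<lambda>t. conv (fps_nth P2) (z True) t + conv (fps_nth Q2) (z False) t)" using y u by auto
    then have "(\<Sum>i<2*d. arx_phi d y u t i * v i) =
      - (conv (fps_nth (?V1 * P1)) (z True) t + conv (fps_nth (?V1 * Q1)) (z False) t)
      + (conv (fps_nth (?V2 * P2)) (z True) t + conv (fps_nth (?V2 * Q2)) (z False) t)"
      unfolding arx_phi_sum by (simp only: c2 l1)
    moreover have "conv (fps_nth (- ?V1 * f + ?V2 * g)) (z b) t = - conv (fps_nth (?V1 * f)) (z b) t + conv (fps_nth (?V2 * g)) (z b) t"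
      if "l1 f" "l1 g" for f g b
      using conv_add[of "- (?V1 * f)" "?V2 * g", OF _ _ z, of b t] conv_uminus[of "?V1 * f", OF _ z, of b t] l1_mult that by simp
    ultimately show ?thesis using l1 by simp
  qed
  have "\<epsilon> * (norm1 ?P + norm1 ?Q)\<^sup>2 + 2 * C\<^sup>2 * (norm1 ?P + norm1 ?Q) * (tail1 ?P (Suc (2 * n)) + tail1 ?Q (Suc (2 * n)))
      \<le> \<epsilon> * (V * S)\<^sup>2 + 2 * C\<^sup>2 * (V * S) * (V * T)"
    using norm_PQ tail_PQ e V1 S lPQ norm1_nonneg tail1_nonneg
    by (intro add_mono mult_mono mult_left_mono power_mono) auto
  also have "\<dots> = V\<^sup>2 * (\<epsilon> * S\<^sup>2 + 2 * C\<^sup>2 * S * T)" by (simp add: power2_eq_square algebra_simps)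
  finally have err: "\<epsilon> * (norm1 ?P + norm1 ?Q)\<^sup>2 + 2 * C\<^sup>2 * (norm1 ?P + norm1 ?Q) * (tail1 ?P (Suc (2 * n)) + tail1 ?Q (Suc (2 * n)))
      \<le> V\<^sup>2 * (\<epsilon> * S\<^sup>2 + 2 * C\<^sup>2 * S * T)" .
  have "\<sigma>\<^sup>2 * \<kappa> * (\<Sum>i<2*d. (v i)\<^sup>2) \<le> \<sigma>\<^sup>2 * (\<Sum>k\<le>2*n. (fps_nth ?P k)\<^sup>2 + (fps_nth ?Q k)\<^sup>2)"
    using lower by (simp add: mult.assoc mult_left_mono)
  then show ?thesis
    using conv_power2_mean_ge[OF lPQ z cov] err unfolding y_eq V_def[symmetric] by linarith
qed

text \<open>Compares ideal with actual regressors, for both estimators. A regressor at t > n0 + d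
  sees only times after n0, where the signals are within \<kappa>; each of the first n0 + d times is
  given up at cost |v|_1^2 Y^2. The parameter a covers the different first summands, 1 and m + 1, of
  the two sums.\<close>

lemma perturbed_quadratic_form:
  assumes y: "bnd y Y" and u: "bnd u Y"
    and close: "\<And>s. int n0 < s \<Longrightarrow> s \<le> int N \<Longrightarrow> \<bar>yh s - y s\<bar> \<le> \<kappa> \<and> \<bar>uh s - u s\<bar> \<le> \<kappa>"
    and \<kappa>: "\<kappa> \<ge> 0" and a: "1 \<le> a" "a \<le> int (n0 + d) + 1"
  shows "1 / real N * (\<Sum>t\<in>{1..int N}. (\<Sum>i<2*d. arx_phi d y u t i * v i)\<^sup>2)
      - (\<Sum>i<2*d. \<bar>v i\<bar>)\<^sup>2 * (2 * Y * \<kappa> + real (n0 + d) * Y\<^sup>2 / real N)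
    \<le> 1 / real N * (\<Sum>t\<in>{a..int N}. (\<Sum>i<2*d. arx_phi d yh uh t i * v i)\<^sup>2)"
proof (cases "N = 0")
  case True
  then show ?thesis using bnd_nonneg[OF y] \<kappa> by simp
next
  case False
  define V where "V = (\<Sum>i<2*d. \<bar>v i\<bar>)"
  define q where "q t = (\<Sum>i<2*d. arx_phi d y u t i * v i)" for t
  define qh where "qh t = (\<Sum>i<2*d. arx_phi d yh uh t i * v i)" for t
  have V: "V \<ge> 0" unfolding V_def by (intro sum_nonneg) auto
  have Y: "Y \<ge> 0" by (rule bnd_nonneg[OF y])
  have q: "\<bar>q t\<bar> \<le> V * Y" for t
    unfolding q_def V_def by (rule arx_phi_sum_abs_le) (auto intro: bndD y u)
  have qh: "\<bar>qh t - q t\<bar> \<le> V * \<kappa>" if "t > int (n0 + d)" "t \<le> int N" for t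
  proof -
    have "qh t - q t = (\<Sum>i<2*d. arx_phi d (\<lambda>s. yh s - y s) (\<lambda>s. uh s - u s) t i * v i)"
      unfolding qh_def q_def by (simp add: sum_subtractf[symmetric] left_diff_distrib[symmetric] arx_phi_diff)
    also have "\<bar>\<dots>\<bar> \<le> V * \<kappa>" unfolding V_def
      by (rule arx_phi_sum_abs_le) (use close that in auto)
    finally show ?thesis .
  qed
  let ?I = "{1..int N}" and ?J = "{int (n0 + d) + 1..int N}"
  have pt: "(q t)\<^sup>2 \<le> (if t \<in> ?J then (qh t)\<^sup>2 else 0) + V\<^sup>2 * (2 * Y * \<kappa>) + (if t \<le> int (n0 + d) then V\<^sup>2 * Y\<^sup>2 else 0)"
    if t: "t \<in> ?I" for t
  proof (cases "t \<in> ?J")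
    case True
    then have d: "\<bar>qh t - q t\<bar> \<le> V * \<kappa>" by (intro qh) auto
    have "\<bar>q t * (qh t - q t)\<bar> \<le> (V * Y) * (V * \<kappa>)"
      unfolding abs_mult using q[of t] d V Y by (intro mult_mono) auto
    moreover have "(qh t)\<^sup>2 = (q t)\<^sup>2 + 2 * (q t * (qh t - q t)) + (qh t - q t)\<^sup>2"
      by (simp add: power2_eq_square algebra_simps)
    ultimately have "(q t)\<^sup>2 \<le> (qh t)\<^sup>2 + 2 * ((V * Y) * (V * \<kappa>))" using zero_le_power2[of "qh t - q t"] by linarith
    then show ?thesis using True by (simp add: power2_eq_square mult_ac)
  next
    case False
    have "(q t)\<^sup>2 \<le> (V * Y)\<^sup>2" using power_mono[OF q[of t], of 2] by simp
    then show ?thesis using False t V Y \<kappa> by (simp add: power_mult_distrib add_increasing)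
  qed
  have "(\<Sum>t\<in>?I. (q t)\<^sup>2) \<le> (\<Sum>t\<in>?I. (if t \<in> ?J then (qh t)\<^sup>2 else 0)) + (\<Sum>t\<in>?I. V\<^sup>2 * (2 * Y * \<kappa>))
      + (\<Sum>t\<in>?I. if t \<le> int (n0 + d) then V\<^sup>2 * Y\<^sup>2 else 0)"
    unfolding sum.distrib[symmetric] by (rule sum_mono[OF pt])
  also have "(\<Sum>t\<in>?I. (if t \<in> ?J then (qh t)\<^sup>2 else 0)) = (\<Sum>t\<in>?I \<inter> ?J. (qh t)\<^sup>2)"
    by (rule sum.inter_restrict[symmetric]) simp
  also have "\<dots> \<le> (\<Sum>t\<in>{a..int N}. (qh t)\<^sup>2)"
    using a by (intro sum_mono2) auto
  also have "(\<Sum>t\<in>?I. if t \<le> int (n0 + d) then V\<^sup>2 * Y\<^sup>2 else 0) \<le> (\<Sum>t\<in>{1..int (n0 + d)}. V\<^sup>2 * Y\<^sup>2)"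
    unfolding sum.inter_filter[symmetric, OF finite_atLeastAtMost_int] using V Y by (intro sum_mono2) auto
  finally have le: "(\<Sum>t\<in>?I. (q t)\<^sup>2) \<le> (\<Sum>t\<in>{a..int N}. (qh t)\<^sup>2) + real N * (V\<^sup>2 * (2 * Y * \<kappa>)) + real (n0 + d) * (V\<^sup>2 * Y\<^sup>2)"
    by simp
  have "1 / real N * (\<Sum>t\<in>?I. (q t)\<^sup>2) - V\<^sup>2 * (2 * Y * \<kappa> + real (n0 + d) * Y\<^sup>2 / real N) \<le> 1 / real N * (\<Sum>t\<in>{a..int N}. (qh t)\<^sup>2)"
    using divide_right_mono[OF le, of "real N"] False by (simp add: field_simps)
  then show ?thesis unfolding q_def qh_def V_def .
qed

section \<open>Polynomials with prescribed coefficients and the Sylvester matrix of a coprime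
  pair\<close>

lemma fps_of_poly_coeff_list:
  "fps_of_poly (Poly (c # map g [0..<n])) = fps_const c + delay n g"
proof (rule fps_ext)
  fix k
  show "fps_nth (fps_of_poly (Poly (c # map g [0..<n]))) k = fps_nth (fps_const c + delay n g) k"
    by (cases k) (auto simp: delay_nth nth_default_def)
qed

lemma delay_eq_cutoff: "fps_const (fps_nth f 0) + delay n (\<lambda>i. fps_nth f (Suc i)) = fps_cutoff (Suc n) f"
proof (rule fps_ext)
  fix k
  show "fps_nth (fps_const (fps_nth f 0) + delay n (\<lambda>i. fps_nth f (Suc i))) k = fps_nth (fps_cutoff (Suc n) f) k"
    by (cases k) (auto simp: delay_nth)
qed

lemma delay_diff: "delay n f - delay n g = delay n (\<lambda>i. f i - g i)"
  by (rule fps_ext) (auto simp: delay_nth)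

lemma delay_poly:
  assumes "coeff P 0 = c" "degree P \<le> n"
  shows "fps_const c + delay n (\<lambda>i. coeff P (Suc i)) = fps_of_poly P"
  by (rule fps_ext) (use assms in \<open>auto simp: delay_nth coeff_eq_0\<close>)

lemma delay_mult_nth:
  "fps_nth (delay d v * f) k = (\<Sum>i<d. v i * (if Suc i \<le> k then fps_nth f (k - Suc i) else 0))"
proof -
  have "delay d v = (\<Sum>i<d. fps_const (v i) * fps_X ^ Suc i)"
  proof (rule fps_ext)
    fix j
    have "(\<Sum>i<d. v i * (if j = Suc i then 1 else 0)) = (\<Sum>i<d. if i = j - 1 then (if j \<ge> 1 then v i else 0) else 0)"
      by (intro sum.cong) auto
    then show "fps_nth (delay d v) j = fps_nth (\<Sum>i<d. fps_const (v i) * fps_X ^ Suc i) j"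
      by (auto simp: delay_nth fps_sum_nth simp del: power_Suc)
  qed
  then have "delay d v * f = (\<Sum>i<d. fps_const (v i) * (fps_X ^ Suc i * f))"
    by (simp add: sum_distrib_right mult.assoc)
  then show ?thesis by (auto simp: fps_sum_nth fps_X_power_mult_nth simp del: power_Suc intro!: sum.cong)
qed

lemma delay_eq_poly: "delay m v = fps_X * fps_of_poly (Poly (map v [0..<m]))"
proof (rule fps_ext)
  fix k
  show "fps_nth (delay m v) k = fps_nth (fps_X * fps_of_poly (Poly (map v [0..<m]))) k"
    by (cases k) (auto simp: delay_nth nth_default_def)
qed

lemma degree_Poly_map_less: "m > 0 \<Longrightarrow> degree (Poly (map v [0..<m])) < m"
  by (rule degree_lessI) (auto simp: nth_default_def)

text \<open>The resultant argument. With V1 = X p and V2 = X q for degrees below m, the combination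
  is X (q Fo - p Lo), of degree at most 2m, so the coefficients up to 2m decide and q Fo = p Lo.
  Coprimality gives Fo dvd p and Lo dvd q. One of Fo, Lo has degree exactly m, so its multiple of
  smaller degree is 0, and then so is the other one.\<close>

lemma coprime_comb_injective:
  fixes Lo Fo :: "real poly"
  assumes cop: "coprime Lo Fo" and deg: "degree Lo \<le> m" "degree Fo \<le> m" and order: "max (degree Lo) (degree Fo) = m"
    and Fo: "Fo \<noteq> 0"
    and zero: "\<And>k. k \<le> 2 * m \<Longrightarrow> fps_nth (- delay m v * fps_of_poly Lo + delay m v' * fps_of_poly Fo) k = 0"
  shows "i < m \<Longrightarrow> v i = 0 \<and> v' i = 0"
proof -
  assume i: "i < m"
  define p q where "p = Poly (map v [0..<m])" and "q = Poly (map v' [0..<m])"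
  have dp: "degree p < m" "degree q < m" using i by (auto simp: p_def q_def intro!: degree_Poly_map_less)
  have "- delay m v * fps_of_poly Lo + delay m v' * fps_of_poly Fo = fps_X * fps_of_poly (q * Fo - p * Lo)"
    by (simp add: delay_eq_poly p_def q_def fps_of_poly_diff fps_of_poly_mult algebra_simps)
  then have z: "coeff (q * Fo - p * Lo) k = 0" if "k < 2 * m" for k
    using zero[of "Suc k"] that by simp
  have "degree (q * Fo) < 2 * m" "degree (p * Lo) < 2 * m"
    using degree_mult_le[of q Fo] degree_mult_le[of p Lo] dp deg by auto
  then have "degree (q * Fo - p * Lo) < 2 * m" by (rule degree_diff_less)
  then have "coeff (q * Fo - p * Lo) k = 0" for k
    using z[of k] coeff_eq_0[of "q * Fo - p * Lo" k] by (cases "k < 2 * m") auto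
  then have eq: "q * Fo = p * Lo" by (simp add: poly_eq_iff)
  have "Fo dvd p" using cop eq by (metis coprime_commute coprime_dvd_mult_left_iff dvd_triv_right)
  moreover have "Lo dvd q" using cop eq by (metis coprime_dvd_mult_left_iff dvd_triv_right)
  ultimately have pq: "p = 0 \<or> degree Fo < m" "q = 0 \<or> degree Lo < m"
    using dp dvd_imp_degree_le by (metis le_less_trans)+
  have "p = 0 \<and> q = 0"
  proof (cases "degree Fo = m")
    case True
    then show ?thesis using pq eq Fo by auto
  next
    case False
    then have "degree Lo = m" using order by (auto simp: max_def split: if_splits)
    then have "q = 0" "Lo \<noteq> 0" using pq i by auto
    then show ?thesis using eq by auto
  qed
  then have "coeff p i = 0" "coeff q i = 0" by auto
  then show "v i = 0 \<and> v' i = 0" using i by (simp add: p_def q_def nth_default_def)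
qed

lemma coprime_comb_lower_bound:
  fixes Lo Fo :: "real poly"
  assumes cop: "coprime Lo Fo" and deg: "degree Lo \<le> m" "degree Fo \<le> m" and order: "max (degree Lo) (degree Fo) = m"
    and Fo: "Fo \<noteq> 0"
  obtains c where "c > 0" "\<And>v. c * (\<Sum>i<2*m. (v i)\<^sup>2) \<le>
    (\<Sum>k\<le>2*m. (fps_nth (- delay m v * fps_of_poly Lo + delay m (\<lambda>i. v (m + i)) * fps_of_poly Fo) k)\<^sup>2)"
proof -
  \<comment> \<open>Up to signs and the shift by one power, the Sylvester matrix of Lo and
    Fo.\<close>
  define A where "A k i = (if i < m then - (if Suc i \<le> k then coeff Lo (k - Suc i) else 0)
    else (if Suc (i - m) \<le> k then coeff Fo (k - Suc (i - m)) else 0))" for k i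
  have A: "(\<Sum>i<2*m. A k i * v i) =
      fps_nth (- delay m v * fps_of_poly Lo + delay m (\<lambda>i. v (m + i)) * fps_of_poly Fo) k" for k v
  proof -
    have "(\<Sum>i<m. A k i * v i) = - fps_nth (delay m v * fps_of_poly Lo) k"
      unfolding delay_mult_nth sum_negf[symmetric] by (intro sum.cong) (auto simp: A_def)
    moreover have "(\<Sum>i<m. A k (m + i) * v (m + i)) = fps_nth (delay m (\<lambda>i. v (m + i)) * fps_of_poly Fo) k"
      unfolding delay_mult_nth by (intro sum.cong) (auto simp: A_def)
    ultimately show ?thesis by (simp add: sum_split_halves)
  qed
  have inj: "v i = 0" if "\<And>k. k \<in> {..2*m} \<Longrightarrow> (\<Sum>i<2*m. A k i * v i) = 0" and i: "i < 2 * m" for v i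
  proof -
    have *: "v j = 0 \<and> v (m + j) = 0" if "j < m" for j
      by (rule coprime_comb_injective[OF cop deg order Fo _ that]) (use \<open>\<And>k. k \<in> _ \<Longrightarrow> _\<close> A in auto)
    show ?thesis using *[of i] *[of "i - m"] i by (cases "i < m") auto
  qed
  obtain c where "c > 0" "\<And>v. c * (\<Sum>i<2*m. (v i)\<^sup>2) \<le> (\<Sum>k\<in>{..2*m}. (\<Sum>i<2*m. A k i * v i)\<^sup>2)"
    using injective_lower_bound[where K="{..2*m}" and d="2*m" and A=A] inj by blast
  then show thesis using that unfolding A by blast
qed

text \<open>Summability of the sequences is required eventually, since the inverse of an estimated
  denominator is shown to be in l1 once it is close to its limit.\<close>

lemma norm1_mult_LIMSEQ:
  assumes l1: "l1 a" "l1 b" "\<forall>\<^sub>F N in sequentially. l1 (aN N) \<and> l1 (bN N)"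
    and a: "(\<lambda>N. norm1 (aN N - a)) \<longlonglongrightarrow> 0" and b: "(\<lambda>N. norm1 (bN N - b)) \<longlonglongrightarrow> 0"
  shows "(\<lambda>N. norm1 (aN N * bN N - a * b)) \<longlonglongrightarrow> 0"
proof (rule Lim_null_comparison)
  show "\<forall>\<^sub>F N in sequentially. norm (norm1 (aN N * bN N - a * b)) \<le>
      norm1 (aN N - a) * norm1 (bN N - b) + norm1 (aN N - a) * norm1 b + norm1 a * norm1 (bN N - b)"
    using l1(3)
  proof eventually_elim
    case (elim N)
    have d: "l1 (aN N - a)" "l1 (bN N - b)" using elim l1 by (auto intro: l1_diff)
    have "aN N * bN N - a * b = (aN N - a) * (bN N - b) + (aN N - a) * b + a * (bN N - b)"
      by (simp add: algebra_simps)
    then have "norm1 (aN N * bN N - a * b) \<le> norm1 ((aN N - a) * (bN N - b)) + norm1 ((aN N - a) * b) + norm1 (a * (bN N - b))"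
      using norm1_add[of "(aN N - a) * (bN N - b) + (aN N - a) * b" "a * (bN N - b)"]
        norm1_add[of "(aN N - a) * (bN N - b)" "(aN N - a) * b"] d l1 by (simp add: l1_mult l1_add)
    also have "\<dots> \<le> norm1 (aN N - a) * norm1 (bN N - b) + norm1 (aN N - a) * norm1 b + norm1 a * norm1 (bN N - b)"
      by (intro add_mono norm1_mult d l1)
    moreover have "l1 (aN N * bN N - a * b)" using elim l1 by (auto intro: l1_mult l1_diff)
    ultimately show ?case using norm1_nonneg by simp
  qed
  show "(\<lambda>N. norm1 (aN N - a) * norm1 (bN N - b) + norm1 (aN N - a) * norm1 b + norm1 a * norm1 (bN N - b)) \<longlonglongrightarrow> 0"
    by (rule tendsto_eq_intros refl a b | simp)+
qed

text \<open>s (t - j) is built from innovations up to time t - j. As j >= 1, lag 0 is never reached,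
  so every sample covariance involved has limit 0. After cutting the filters at n the lags j + k are
  at most 2n.\<close>

lemma lagged_covariance:
  assumes l1: "l1 P" "l1 Q" and z: "\<And>b. bnd (z b) C" and cov: "cov_close z \<sigma> N (2 * n) \<epsilon>"
    and j: "1 \<le> j" "j \<le> n"
    and s: "\<And>t. s t = conv (fps_nth P) (z True) t + conv (fps_nth Q) (z False) t"
  shows "\<bar>1 / real N * (\<Sum>t\<in>{1..int N}. s (t - int j) * z False t)\<bar>
    \<le> \<epsilon> * (norm1 P + norm1 Q) + C\<^sup>2 * (tail1 P (Suc n) + tail1 Q (Suc n))"
proof -
  define c where "c b k = 1 / real N * (\<Sum>t\<in>{1..int N}. z b (t - int (j + k)) * z False (t - int 0))" for b k
  have c: "\<bar>c b k\<bar> \<le> \<epsilon>" if "k < Suc n" for b k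
    using cov_closeD[OF cov, of "j + k" 0 b False] j that by (simp add: c_def)
  have C: "C \<ge> 0" by (rule bnd_nonneg[OF z[of True]])
  have e: "\<epsilon> \<ge> 0" by (rule cov_close_nonneg[OF cov])
  have one: "\<bar>1 / real N * (\<Sum>t\<in>{1..int N}. conv (fps_nth f) (z b) (t - int j) * z False t)\<bar>
      \<le> \<epsilon> * norm1 f + C\<^sup>2 * tail1 f (Suc n)" if f: "l1 f" for f b
  proof -
    define x where "x t = (\<Sum>k<Suc n. fps_nth f k * z b (t - int k))" for t
    have xc: "1 / real N * (\<Sum>t\<in>{1..int N}. x (t - int j) * z False t) = (\<Sum>k<Suc n. fps_nth f k * c b k)"
    proof -
      have "(\<Sum>t\<in>{1..int N}. x (t - int j) * z False t) =
          (\<Sum>t\<in>{1..int N}. \<Sum>k<Suc n. fps_nth f k * (z b (t - int (j + k)) * z False (t - int 0)))"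
        unfolding x_def sum_distrib_right by (intro sum.cong refl) (simp add: algebra_simps)
      also have "\<dots> = (\<Sum>k<Suc n. fps_nth f k * (\<Sum>t\<in>{1..int N}. z b (t - int (j + k)) * z False (t - int 0)))"
        by (subst sum.swap) (simp only: sum_distrib_left)
      finally show ?thesis unfolding c_def by (simp only: sum_distrib_left mult.left_commute)
    qed
    have "\<bar>\<Sum>k<Suc n. fps_nth f k * c b k\<bar> \<le> (\<Sum>k<Suc n. \<bar>fps_nth f k\<bar> * \<epsilon>)"
      by (rule order_trans[OF sum_abs], intro sum_mono) (auto simp: abs_mult intro!: mult_left_mono c)
    also have "\<dots> \<le> norm1 f * \<epsilon>"
      unfolding sum_distrib_right[symmetric] using e by (intro mult_right_mono sum_abs_le_norm1 f) auto
    finally have main: "\<bar>1 / real N * (\<Sum>t\<in>{1..int N}. x (t - int j) * z False t)\<bar> \<le> \<epsilon> * norm1 f"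
      unfolding xc by (simp add: mult.commute)
    have "\<bar>\<Sum>t\<in>{1..int N}. (conv (fps_nth f) (z b) (t - int j) - x (t - int j)) * z False t\<bar> \<le> (\<Sum>t\<in>{1..int N}. tail1 f (Suc n) * C * C)"
      by (rule order_trans[OF sum_abs], intro sum_mono, unfold abs_mult, intro mult_mono)
        (auto simp: x_def intro!: conv_cutoff_error f z bndD[OF z] mult_nonneg_nonneg tail1_nonneg C simp del: sum.lessThan_Suc)
    then have "1 / real N * \<bar>\<Sum>t\<in>{1..int N}. (conv (fps_nth f) (z b) (t - int j) - x (t - int j)) * z False t\<bar>
        \<le> 1 / real N * (real N * (C\<^sup>2 * tail1 f (Suc n)))"
      by (intro mult_left_mono) (auto simp: power2_eq_square mult_ac)
    also have "\<dots> \<le> C\<^sup>2 * tail1 f (Suc n)" using tail1_nonneg[OF f] by (cases "N = 0") auto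
    finally have err: "\<bar>1 / real N * (\<Sum>t\<in>{1..int N}. (conv (fps_nth f) (z b) (t - int j) - x (t - int j)) * z False t)\<bar> \<le> C\<^sup>2 * tail1 f (Suc n)"
      by (simp add: abs_mult)
    have "1 / real N * (\<Sum>t\<in>{1..int N}. conv (fps_nth f) (z b) (t - int j) * z False t) =
      1 / real N * (\<Sum>t\<in>{1..int N}. x (t - int j) * z False t) +
      1 / real N * (\<Sum>t\<in>{1..int N}. (conv (fps_nth f) (z b) (t - int j) - x (t - int j)) * z False t)"
      by (simp add: left_diff_distrib sum_subtractf right_diff_distrib)
    then show ?thesis using main err by linarith
  qed
  have "1 / real N * (\<Sum>t\<in>{1..int N}. s (t - int j) * z False t) =
      1 / real N * (\<Sum>t\<in>{1..int N}. conv (fps_nth P) (z True) (t - int j) * z False t) +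
      1 / real N * (\<Sum>t\<in>{1..int N}. conv (fps_nth Q) (z False) (t - int j) * z False t)"
    unfolding s by (simp add: distrib_right sum.distrib distrib_left)
  then show ?thesis using one[OF l1(1), of True] one[OF l1(2), of False]
    unfolding distrib_left by linarith
qed

section \<open>The estimators on a typical sample path\<close>

text \<open>One fixed sample path. Randomness survives only in \<open>cov\<close>;
  \<open>n_eps\<close> makes the covariance errors o(1/n), and \<open>n_sq\<close> does the same for
  the share n/N of times whose regressors leave the record.\<close>

locale arx_data =
  fixes z :: "bool \<Rightarrow> int \<Rightarrow> real" and C \<sigma> :: real
    and Lo Fo Co Do Nu Du :: "real poly" and m :: nat and nN :: "nat \<Rightarrow> nat" and \<epsilon> :: "nat \<Rightarrow> real"
  assumes z: "\<And>b. bnd (z b) C"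
    and Lo0: "coeff Lo 0 = 0" and dLo: "degree Lo \<le> m"
    and Fo0: "coeff Fo 0 = 1" and dFo: "degree Fo \<le> m"
    and order: "max (degree Lo) (degree Fo) = m"
    and LF: "coprime Lo Fo" and CD: "coprime Co Do"
    and Co0: "coeff Co 0 = 1" and Do0: "coeff Do 0 = 1"
    and G_stable: "stable_filter Lo Fo" and H_stable: "stable_filter Co Do" and Hi_stable: "stable_filter Do Co"
    and Du0: "coeff Du 0 = 1" and Nu0: "coeff Nu 0 \<noteq> 0"
    and U_stable: "stable_filter Nu Du" and Ui_stable: "stable_filter Du Nu"
    and \<sigma>: "\<sigma> > 0"
    and n_inf: "filterlim nN at_top sequentially"
    and cov: "\<forall>\<^sub>F N in sequentially. cov_close z \<sigma> N (2 * nN N) (\<epsilon> N)"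
    and n_eps: "(\<lambda>N. real (nN N) * \<epsilon> N) \<longlonglongrightarrow> 0"
    and n_sq: "(\<lambda>N. (real (nN N))\<^sup>2 / real N) \<longlonglongrightarrow> 0"
begin

definition G where "G = fps_of_poly Lo / fps_of_poly Fo"
definition H where "H = fps_of_poly Co / fps_of_poly Do"
definition A0 where "A0 = fps_of_poly Do / fps_of_poly Co"
definition U where "U = fps_of_poly Nu / fps_of_poly Du"
definition Ui where "Ui = fps_of_poly Du / fps_of_poly Nu"
definition B0 where "B0 = G * A0"
definition u where "u = conv (fps_nth U) (z True)"
definition y where "y t = conv (fps_nth G) u t + conv (fps_nth H) (z False) t"

lemma wl1: "wl1 G" "wl1 H" "wl1 A0" "wl1 U" "wl1 B0" "wl1 (G * U)"
proof -
  show *: "wl1 G" "wl1 H" "wl1 A0" "wl1 U" unfolding G_def H_def A0_def U_def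
    by (rule wl1_stable; use Fo0 Do0 Co0 Du0 G_stable H_stable Hi_stable U_stable in simp)+
  show "wl1 B0" "wl1 (G * U)" unfolding B0_def by (intro wl1_mult *)+
qed

lemmas l1 = wl1[THEN wl1_imp_l1]

lemma l1_Ui: "l1 Ui" using Ui_stable by (simp add: stable_filter_iff Ui_def)

lemma wl1_iF: "wl1 (inverse (fps_of_poly Fo))"
  by (rule wl1_inverse_coprime[OF LF _ G_stable]) (simp add: Fo0)

lemma inv_mult: "P \<noteq> 0 \<Longrightarrow> Q \<noteq> 0 \<Longrightarrow> coeff P 0 \<noteq> 0 \<Longrightarrow> coeff Q 0 \<noteq> 0 \<Longrightarrow>
    (fps_of_poly P / fps_of_poly Q) * (fps_of_poly Q / fps_of_poly P :: real fps) = 1"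
  using inverse_mult_eq_1[of "fps_of_poly P"] inverse_mult_eq_1[of "fps_of_poly Q"]
  by (simp add: fps_of_poly_divide) (metis (no_types, lifting) mult.assoc mult.commute mult.left_neutral)

lemma HA: "A0 * H = 1" and UU: "U * Ui = 1"
proof -
  have "Do \<noteq> 0" "Co \<noteq> 0" "Nu \<noteq> 0" "Du \<noteq> 0" using Do0 Co0 Nu0 Du0 by auto
  then show "A0 * H = 1" "U * Ui = 1" unfolding A0_def H_def U_def Ui_def
    using Do0 Co0 Nu0 Du0 by (auto intro!: inv_mult)
qed

lemma FG: "fps_of_poly Fo * G = fps_of_poly Lo"
  using inverse_mult_eq_1'[of "fps_of_poly Fo"] Fo0
  by (simp add: G_def fps_of_poly_divide mult.left_commute)

lemma FB: "fps_of_poly Fo * B0 = fps_of_poly Lo * A0"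
  unfolding B0_def mult.assoc[symmetric] FG ..

lemma A0_0: "fps_nth A0 0 = 1" and B0_0: "fps_nth B0 0 = 0"
proof -
  show "fps_nth A0 0 = 1" unfolding A0_def using Co0 Do0 by (simp add: fps_of_poly_divide)
  show "fps_nth B0 0 = 0" unfolding B0_def G_def using Fo0 Lo0 by (simp add: fps_of_poly_divide)
qed

lemma bnd_conv_z: "l1 f \<Longrightarrow> bnd (conv (fps_nth f) (z b)) (norm1 f * C)"
  by (rule conv_bnd[OF _ z])

lemma bnd_u: "bnd u (norm1 U * C)" unfolding u_def by (rule bnd_conv_z[OF l1(4)])

lemma y_eq: "y t = conv (fps_nth (G * U)) (z True) t + conv (fps_nth H) (z False) t"
  unfolding y_def u_def using conv_mult[OF l1(1,4) z] by simp

lemma y_fun: "y = (\<lambda>t. conv (fps_nth G) u t + conv (fps_nth H) (z False) t)"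
  by (rule ext) (rule y_def)

lemma bnd_y: "bnd y (norm1 (G * U) * C + norm1 H * C)"
  unfolding y_eq[abs_def] using bndD[OF bnd_conv_z[OF l1(6), of True]] bndD[OF bnd_conv_z[OF l1(2), of False]]
  by (intro bndI order_trans[OF abs_triangle_ineq] add_mono) auto

definition Y where "Y = norm1 U * C + (norm1 (G * U) * C + norm1 H * C) + C"

lemma C0: "C \<ge> 0" by (rule bnd_nonneg[OF z[of True]])

lemma bnd_Y: "bnd u Y" "bnd y Y" "bnd (z b) Y" and Y0: "Y \<ge> 0"
proof -
  have "norm1 U * C \<ge> 0" "norm1 (G * U) * C + norm1 H * C \<ge> 0"
    using bnd_nonneg[OF bnd_u] bnd_nonneg[OF bnd_y] by auto
  then have "norm1 U * C \<le> Y" "norm1 (G * U) * C + norm1 H * C \<le> Y" "C \<le> Y" "Y \<ge> 0"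
    unfolding Y_def using C0 by auto
  then show "bnd u Y" "bnd y Y" "bnd (z b) Y" "Y \<ge> 0"
    using bnd_u bnd_y z unfolding bnd_def by (meson order_trans)+
qed

lemma bnd_trunc: "bnd x B \<Longrightarrow> bnd (trunc N x) B"
  unfolding bnd_def trunc_def using order_trans[OF abs_ge_zero] by auto

text \<open>Since A0 G = B0 and A0 H = 1, the data obey an ARX model of infinite order whose
  equation error is e itself.\<close>

lemma arx_identity: "conv (fps_nth A0) y t = conv (fps_nth B0) u t + z False t"
proof -
  have "conv (fps_nth A0) y t = conv (fps_nth A0) (conv (fps_nth G) u) t + conv (fps_nth A0) (conv (fps_nth H) (z False)) t"
    unfolding y_fun by (rule conv_add_right[OF l1(3) conv_bnd[OF l1(1) bnd_u] bnd_conv_z[OF l1(2)]])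
  also have "conv (fps_nth A0) (conv (fps_nth G) u) = conv (fps_nth B0) u"
    unfolding B0_def mult.commute[of G] by (rule conv_mult[OF l1(3,1) bnd_u, symmetric])
  also have "conv (fps_nth A0) (conv (fps_nth H) (z False)) = z False"
    using conv_mult[OF l1(3,2) z, of False] by (simp add: HA conv_one)
  finally show ?thesis .
qed

text \<open>Collects the l1 norms of the filters that recover the weights v in
  \<open>arx_lower\<close>: |V1|^2 <= |A0|^2 |Q|^2 and |V2|^2 <= 2 |Ui|^2 |P|^2 + 2 |G|^2 |V1|^2.
  The leading 1 only secures a positive denominator.\<close>

definition lower_const where
  "lower_const = 1 / (1 + (1 + 2 * (norm1 G)\<^sup>2) * (norm1 A0)\<^sup>2 + 2 * (norm1 Ui)\<^sup>2)"

text \<open>The limiting excitation level is at least \<sigma>^2 times \<open>lower_const\<close>;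
  half of it is reserved for absorbing the errors that vanish with N.\<close>

definition pe_const where "pe_const = \<sigma>\<^sup>2 * lower_const / 2"

lemma pe_const_pos: "pe_const > 0"
proof -
  have "lower_const > 0" unfolding lower_const_def
    by (intro divide_pos_pos add_pos_nonneg mult_nonneg_nonneg add_nonneg_nonneg) auto
  then show ?thesis using \<sigma> by (simp add: pe_const_def)
qed

text \<open>The two series are the filters P and Q from w and e to the combination of regressors
  with weights v. They determine v through filters in l1 that do not depend on n, which makes the
  constant uniform in the order.\<close>

lemma arx_lower:
  "lower_const * (\<Sum>i<2*n. (v i)\<^sup>2) \<le> (\<Sum>k\<le>2*n.
      (fps_nth (- delay n v * (G * U) + delay n (\<lambda>i. v (n + i)) * U) k)\<^sup>2 +
      (fps_nth (- delay n v * H + delay n (\<lambda>i. v (n + i)) * 0) k)\<^sup>2)"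
proof -
  define h g a where "h = (norm1 A0)\<^sup>2" and "g = (norm1 G)\<^sup>2" and "a = (norm1 Ui)\<^sup>2"
  have pos: "h \<ge> 0" "g \<ge> 0" "a \<ge> 0" by (auto simp: h_def g_def a_def)
  define K where "K = 1 + (1 + 2 * g) * h + 2 * a"
  have K: "K > 0" unfolding K_def using pos by (intro add_pos_nonneg) auto
  have le: "(\<Sum>i<2*n. (v i)\<^sup>2) \<le> K * (\<Sum>k\<le>2*n.
      (fps_nth (- delay n v * (G * U) + delay n (\<lambda>i. v (n + i)) * U) k)\<^sup>2 +
      (fps_nth (- delay n v * H + delay n (\<lambda>i. v (n + i)) * 0) k)\<^sup>2)"
  proof -
    let ?V1 = "delay n v" and ?V2 = "delay n (\<lambda>i. v (n + i))"
    let ?P = "- ?V1 * (G * U) + ?V2 * U" and ?Q = "- ?V1 * H + ?V2 * 0"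
    let ?s = "\<lambda>f. (\<Sum>k\<le>2*n. (fps_nth f k)\<^sup>2)"
    have s0: "?s f \<ge> 0" for f :: "real fps" by (intro sum_nonneg) auto
    \<comment> \<open>Q = -V1 H is undone by A0. Once V1 is known, P = (V2 - G V1) U is undone by
      the inverse input filter.\<close>
    have V1: "- A0 * ?Q = ?V1" using HA by (simp add: mult.left_commute)
    have "?s (- A0 * ?Q) \<le> h * ?s ?Q"
      using young_causal[where f="- A0" and L="2 * n" and g="?Q"] l1(3) by (simp only: h_def norm1_uminus l1_uminus)
    then have 1: "?s ?V1 \<le> h * ?s ?Q" by (simp only: V1)
    have "Ui * ?P = (U * Ui) * (?V2 - G * ?V1)" by (simp add: algebra_simps)
    then have V2: "?V2 = Ui * ?P + G * ?V1" by (simp add: UU)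
    have "?s ?V2 \<le> (\<Sum>k\<le>2*n. 2 * (fps_nth (Ui * ?P) k)\<^sup>2 + 2 * (fps_nth (G * ?V1) k)\<^sup>2)"
    proof (rule sum_mono)
      fix k
      have "(p + q)\<^sup>2 \<le> 2 * p\<^sup>2 + 2 * q\<^sup>2" for p q :: real
        using zero_le_power2[of "p - q"] by (simp add: power2_eq_square algebra_simps)
      moreover have "fps_nth ?V2 k = fps_nth (Ui * ?P) k + fps_nth (G * ?V1) k" by (subst V2) simp
      ultimately show "(fps_nth ?V2 k)\<^sup>2 \<le> 2 * (fps_nth (Ui * ?P) k)\<^sup>2 + 2 * (fps_nth (G * ?V1) k)\<^sup>2" by metis
    qed
    also have "\<dots> = 2 * ?s (Ui * ?P) + 2 * ?s (G * ?V1)" by (simp only: sum.distrib sum_distrib_left)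
    also have "\<dots> \<le> 2 * (a * ?s ?P) + 2 * (g * (h * ?s ?Q))"
      using young_causal[OF l1_Ui, where L="2 * n" and g="?P"] young_causal[OF l1(1), where L="2 * n" and g="?V1"] mult_left_mono[OF 1 pos(2)]
      unfolding a_def g_def by (intro add_mono mult_left_mono) auto
    finally have 2: "?s ?V2 \<le> 2 * (a * ?s ?P) + 2 * (g * (h * ?s ?Q))" .
    have "(\<Sum>i<2*n. (v i)\<^sup>2) = ?s ?V1 + ?s ?V2"
      by (simp add: sum_split_halves sum_power2_delay)
    also have "\<dots> \<le> ((1 + 2 * g) * h) * ?s ?Q + (2 * a) * ?s ?P" using 1 2 by (simp add: algebra_simps)
    also have "\<dots> \<le> K * ?s ?Q + K * ?s ?P"
      unfolding K_def using pos by (intro add_mono mult_right_mono s0) auto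
    finally show ?thesis by (simp add: sum.distrib distrib_left)
  qed
  have "lower_const = 1 / K" by (simp add: lower_const_def K_def h_def g_def a_def)
  then show ?thesis using mult_left_mono[OF le, of "1 / K"] K by simp
qed

lemma n_pos: "\<forall>\<^sub>F N in sequentially. nN N \<ge> k"
  using n_inf by (simp add: filterlim_at_top)

lemma cov_eps: "\<forall>\<^sub>F N in sequentially. 0 \<le> \<epsilon> N"
  using cov by eventually_elim (rule cov_close_nonneg)

lemma eps_LIMSEQ: "\<epsilon> \<longlonglongrightarrow> 0"
proof (rule Lim_null_comparison[OF _ n_eps])
  show "\<forall>\<^sub>F N in sequentially. norm (\<epsilon> N) \<le> real (nN N) * \<epsilon> N"
    using cov_eps n_pos[of 1]
    by eventually_elim (use mult_right_mono[of 1 "real (nN N)" "\<epsilon> N" for N] in auto)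
qed

lemma n_tail: "wl1 f \<Longrightarrow> (\<lambda>N. real (nN N) * tail1 f (Suc (nN N))) \<longlonglongrightarrow> 0"
  using filterlim_compose[OF mult_tail1_LIMSEQ n_inf] .

lemma tail_LIMSEQ: "l1 f \<Longrightarrow> (\<lambda>N. tail1 f (Suc (nN N))) \<longlonglongrightarrow> 0"
  by (rule filterlim_compose[OF LIMSEQ_Suc[OF tail1_LIMSEQ] n_inf])

lemma n_div: "(\<lambda>N. real (nN N) / real N) \<longlonglongrightarrow> 0"
proof (rule Lim_null_comparison[OF _ n_sq])
  show "\<forall>\<^sub>F N in sequentially. norm (real (nN N) / real N) \<le> (real (nN N))\<^sup>2 / real N"
    using n_pos[of 1] by eventually_elim (auto simp: power2_eq_square intro!: divide_right_mono)
qed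

lemma arx_pe:
  "\<forall>\<^sub>F N in sequentially. \<forall>v. pe_const * (\<Sum>i<2*nN N. (v i)\<^sup>2) \<le>
    1 / real N * (\<Sum>t\<in>{1..int N}. (\<Sum>i<2*nN N. arx_phi (nN N) (trunc N y) (trunc N u) t i * v i)\<^sup>2)"
proof -
  define \<kappa> where "\<kappa> = lower_const"
  note lower = arx_lower[folded \<kappa>_def]
  define c where "c = pe_const"
  have c: "c > 0" "c = \<sigma>\<^sup>2 * \<kappa> / 2" using pe_const_pos by (simp_all add: c_def \<kappa>_def pe_const_def)
  define S where "S = norm1 (G * U) + norm1 H + norm1 U + norm1 0"
  define T where "T n = tail1 (G * U) (Suc n) + tail1 H (Suc n) + tail1 U (Suc n) + tail1 0 (Suc n)" for n
  \<comment> \<open>The factor 2n is the price of |v|_1^2 <= 2n |v|_2^2; it is here that all errors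
    have to be o(1/n).\<close>
  define err where "err N = 2 * real (nN N) * (\<epsilon> N * S\<^sup>2 + 2 * C\<^sup>2 * S * T (nN N) + real (nN N) * Y\<^sup>2 / real N)" for N
  have T: "(\<lambda>N. real (nN N) * T (nN N)) \<longlonglongrightarrow> 0"
    unfolding T_def distrib_left using wl1 by (auto intro!: tendsto_add_zero n_tail simp: wl1_def)
  have "err \<longlonglongrightarrow> 2 * (0 * S\<^sup>2 + 2 * C\<^sup>2 * S * 0 + 0 * Y\<^sup>2)"
  proof -
    have "err = (\<lambda>N. 2 * ((real (nN N) * \<epsilon> N) * S\<^sup>2 + 2 * C\<^sup>2 * S * (real (nN N) * T (nN N)) + ((real (nN N))\<^sup>2 / real N) * Y\<^sup>2))"
      unfolding err_def by (intro ext) (simp add: power2_eq_square algebra_simps)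
    then show ?thesis by (simp only:) (intro tendsto_intros T n_eps n_sq)
  qed
  then have "err \<longlonglongrightarrow> 0" by simp
  then have ev: "\<forall>\<^sub>F N in sequentially. err N < c" using c(1) by (rule order_tendstoD(2))
  show ?thesis unfolding c_def[symmetric]
    using ev cov
  proof (eventually_elim, intro allI)
    fix N and v :: "nat \<Rightarrow> real" assume e: "err N < c" and cv: "cov_close z \<sigma> N (2 * nN N) (\<epsilon> N)"
    let ?n = "nN N" and ?V2 = "\<Sum>i<2*nN N. (v i)\<^sup>2" and ?V = "\<Sum>i<2*nN N. \<bar>v i\<bar>"
    let ?e1 = "\<epsilon> N * S\<^sup>2 + 2 * C\<^sup>2 * S * T ?n" and ?e2 = "2 * Y * 0 + real (0 + ?n) * Y\<^sup>2 / real N"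
    have 1: "\<sigma>\<^sup>2 * \<kappa> * ?V2 - ?V\<^sup>2 * ?e1 \<le> 1 / real N * (\<Sum>t\<in>{1..int N}. (\<Sum>i<2*?n. arx_phi ?n y u t i * v i)\<^sup>2)"
      unfolding S_def T_def
      by (rule regressor_power2_mean_ge[OF l1(6,2,4) l1_zero z cv order_refl y_eq _ lower])
        (simp add: u_def conv_def)
    \<comment> \<open>The record agrees with the data on 1..N, so n0 = 0 and \<kappa> = 0; only the
      first n regressors, which reach back before time 1, are lost.\<close>
    have 2: "1 / real N * (\<Sum>t\<in>{1..int N}. (\<Sum>i<2*?n. arx_phi ?n y u t i * v i)\<^sup>2) - ?V\<^sup>2 * ?e2
        \<le> 1 / real N * (\<Sum>t\<in>{1..int N}. (\<Sum>i<2*?n. arx_phi ?n (trunc N y) (trunc N u) t i * v i)\<^sup>2)"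
      by (rule perturbed_quadratic_form[OF bnd_Y(2,1)]) (auto simp: trunc_def)
    have e0: "?e1 + ?e2 \<ge> 0"
    proof -
      have "S \<ge> 0" unfolding S_def using l1 norm1_nonneg by simp
      moreover have "T ?n \<ge> 0" unfolding T_def using l1 tail1_nonneg[of _ "Suc ?n"] l1_zero by (simp add: add_nonneg_nonneg)
      ultimately show ?thesis using cov_close_nonneg[OF cv] by simp
    qed
    have "?V\<^sup>2 * (?e1 + ?e2) \<le> (real (2 * ?n) * ?V2) * (?e1 + ?e2)"
      by (intro mult_right_mono sum_abs_power2_le e0)
    also have "\<dots> = err N * ?V2" by (simp add: err_def algebra_simps)
    also have "\<dots> \<le> c * ?V2" using e by (intro mult_right_mono sum_nonneg) auto
    finally have 3: "?V\<^sup>2 * (?e1 + ?e2) \<le> c * ?V2" .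
    have "c * ?V2 = \<sigma>\<^sup>2 * \<kappa> * ?V2 - c * ?V2" by (simp add: c(2))
    also have "\<dots> \<le> \<sigma>\<^sup>2 * \<kappa> * ?V2 - ?V\<^sup>2 * (?e1 + ?e2)" using 3 by simp
    also have "\<dots> \<le> 1 / real N * (\<Sum>t\<in>{1..int N}. (\<Sum>i<2*?n. arx_phi ?n (trunc N y) (trunc N u) t i * v i)\<^sup>2)"
      using 1 2 unfolding distrib_left[of "?V\<^sup>2" ?e1] by linarith
    finally show "c * ?V2 \<le> 1 / real N * (\<Sum>t\<in>{1..int N}. (\<Sum>i<2*?n. arx_phi ?n (trunc N y) (trunc N u) t i * v i)\<^sup>2)" .
  qed
qed

end

lemma arx_R_gram: "arx_R N n y u = gram (2 * n) {1..int N} (1 / real N) (arx_phi n y u)"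
  by (simp add: arx_R_def gram_def)

lemma sm_phi_arx_phi: "sm_phi n m \<eta> \<theta> ud = arx_phi m (yfilt n m \<eta> \<theta> ud) (ufilt n m \<eta> \<theta> ud)"
  by (intro ext) (simp add: sm_phi_def arx_phi_def)

lemma sm_R_gram: "sm_R N n m \<eta> \<theta> ud =
    gram (2 * m) {int m + 1..int N} (1 / real N) (arx_phi m (yfilt n m \<eta> \<theta> ud) (ufilt n m \<eta> \<theta> ud))"
  by (simp add: sm_R_def gram_def sm_phi_arx_phi)

text \<open>Used with A0 and B0, cut at n, on the measured data, and with Fo and Lo on the
  pre-filtered data of the Steiglitz-McBride step.\<close>

lemma minus_arx_phi_sum:
  assumes "bnd y Y"
  shows "y t - (\<Sum>i<2*d. arx_phi d y u t i * (if i < d then a i else b (i - d)))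
    = conv (fps_nth (1 + delay d a)) y t - conv (fps_nth (delay d b)) u t"
proof -
  have "delay d (\<lambda>i. if i < d then a i else b (i - d)) = delay d a"
    "delay d (\<lambda>i. if d + i < d then a (d + i) else b (d + i - d)) = delay d b"
    by (rule fps_ext; auto simp: delay_nth)+
  then show ?thesis
    unfolding arx_phi_sum using conv_add[OF l1_one l1_delay assms, of d a t] by (simp add: conv_one)
qed

lemma conv_cutoff_trunc:
  assumes "int n < t" "t \<le> int N"
  shows "conv (fps_nth (fps_cutoff (Suc n) f)) (trunc N x) t = conv (fps_nth (fps_cutoff (Suc n) f)) x t"
  unfolding conv_cutoff by (intro sum.cong refl) (use assms in \<open>auto simp: trunc_def\<close>)

section \<open>Convergence of the ARX estimate\<close>

context arx_data
begin

text \<open>The index is shifted by one because the coefficients at 0, which are 1 for A0 and 0 for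
  B0, are not parameters.\<close>

definition \<eta>0 where "\<eta>0 n i = (if i < n then fps_nth A0 (Suc i) else fps_nth B0 (Suc (i - n)))" for n i

text \<open>At \<open>\<eta>0\<close> the residual is e_t up to the tails of A0 and B0, and e_t is
  almost uncorrelated with past data. \<open>least_squares_error\<close> multiplies this residual
  correlation \<rho> by 2n, so n \<rho> has to vanish.\<close>

lemma eta_LIMSEQ:
  assumes \<delta>': "0 < \<delta>'" "\<delta>' < pe_const"
  shows "(\<lambda>N. \<Sum>i<2*nN N. \<bar>vec_index (eta_hat \<delta>' N (nN N) y u) i - \<eta>0 (nN N) i\<bar>) \<longlonglongrightarrow> 0"
proof -
  define c where "c = pe_const"
  have c: "c > 0" using pe_const_pos by (simp add: c_def)
  note pe = arx_pe[folded c_def] and \<delta>' = \<delta>'[folded c_def]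
  define Y2 where "Y2 = (norm1 A0 + norm1 B0) * Y"
  define \<tau> where "\<tau> n = tail1 A0 (Suc n) + tail1 B0 (Suc n)" for n
  define S where "S = norm1 (G * U) + norm1 H + norm1 U"
  define T where "T n = tail1 (G * U) (Suc n) + tail1 H (Suc n) + tail1 U (Suc n)" for n
  \<comment> \<open>The four sources: covariance errors between past innovations and e, tails of the
    filters producing the data, coefficients of A0 and B0 beyond n, and the first n times with
    incomplete regressors.\<close>
  define \<rho> where "\<rho> N = \<epsilon> N * S + C\<^sup>2 * T (nN N) + Y\<^sup>2 * \<tau> (nN N) + real (nN N) * (Y * Y2 + Y\<^sup>2) / real N" for N
  have norms: "norm1 A0 \<ge> 0" "norm1 B0 \<ge> 0" using l1 norm1_nonneg by auto
  have Y2: "Y2 \<ge> 0" unfolding Y2_def using Y0 norms by auto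
  have \<tau>0: "\<tau> n \<ge> 0" for n unfolding \<tau>_def using l1 tail1_nonneg by (simp add: add_nonneg_nonneg)
  have \<rho>_lim: "(\<lambda>N. real (2 * nN N) * \<rho> N / c) \<longlonglongrightarrow> 0"
  proof -
    have t: "(\<lambda>N. real (nN N) * T (nN N)) \<longlonglongrightarrow> 0" "(\<lambda>N. real (nN N) * \<tau> (nN N)) \<longlonglongrightarrow> 0"
      unfolding T_def \<tau>_def distrib_left using wl1 by (auto intro!: tendsto_add_zero n_tail)
    have "(\<lambda>N. 2 / c * ((real (nN N) * \<epsilon> N) * S + C\<^sup>2 * (real (nN N) * T (nN N)) + Y\<^sup>2 * (real (nN N) * \<tau> (nN N))
        + ((real (nN N))\<^sup>2 / real N) * (Y * Y2 + Y\<^sup>2))) \<longlonglongrightarrow> 2 / c * (0 * S + C\<^sup>2 * 0 + Y\<^sup>2 * 0 + 0 * (Y * Y2 + Y\<^sup>2))"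
      by (intro tendsto_intros t n_eps n_sq)
    moreover have eq: "(\<lambda>N. real (2 * nN N) * \<rho> N / c) = (\<lambda>N. 2 / c * ((real (nN N) * \<epsilon> N) * S + C\<^sup>2 * (real (nN N) * T (nN N)) + Y\<^sup>2 * (real (nN N) * \<tau> (nN N))
        + ((real (nN N))\<^sup>2 / real N) * (Y * Y2 + Y\<^sup>2)))"
      using c by (intro ext) (simp add: \<rho>_def power2_eq_square field_simps)
    ultimately show ?thesis unfolding eq by (simp only: mult_zero_left mult_zero_right add_0_left)
  qed
  show ?thesis
  proof (rule Lim_null_comparison[OF _ \<rho>_lim])
    show "\<forall>\<^sub>F N in sequentially. norm (\<Sum>i<2*nN N. \<bar>vec_index (eta_hat \<delta>' N (nN N) y u) i - \<eta>0 (nN N) i\<bar>)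
        \<le> real (2 * nN N) * \<rho> N / c"
      using pe cov n_pos[of 1] eventually_ge_at_top[of 1]
    proof eventually_elim
      fix N
      assume pe: "\<forall>v. c * (\<Sum>i<2*nN N. (v i)\<^sup>2) \<le>
          1 / real N * (\<Sum>t\<in>{1..int N}. (\<Sum>i<2*nN N. arx_phi (nN N) (trunc N y) (trunc N u) t i * v i)\<^sup>2)"
        and cv: "cov_close z \<sigma> N (2 * nN N) (\<epsilon> N)" and n1: "1 \<le> nN N" and N1: "1 \<le> N"
      define n where "n = nN N"
      let ?y = "trunc N y" and ?u = "trunc N u"
      let ?\<phi> = "arx_phi n ?y ?u"
      let ?R = "gram (2 * n) {1..int N} (1 / real N) ?\<phi>"
      have pe': "c * (\<Sum>i<2*n. (v i)\<^sup>2) \<le> 1 / real N * (\<Sum>t\<in>{1..int N}. (\<Sum>i<2*n. ?\<phi> t i * v i)\<^sup>2)" for v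
        using pe by (simp add: n_def)
      note inv = gram_inverse[where c=c and d="2*n" and a="1 / real N" and T="{1..int N}" and \<phi>="?\<phi>", OF c pe']
      \<comment> \<open>The only use of \<delta>' < c: the norm test of \<open>reg_mat\<close> is
        passed, so the normal matrix is left unregularised.\<close>
      have "mat_norm2 (minv ?R) \<le> 1 / c" using inv(4) n1 by (simp add: n_def)
      also have "\<dots> < 2 / \<delta>'" using c \<delta>' by (simp add: field_simps)
      finally have "reg_mat \<delta>' ?R = ?R" using inv(1) by (simp add: reg_mat_def)
      then have eta: "eta_hat \<delta>' N n y u = minv ?R *\<^sub>v vec (2 * n) (\<lambda>i. 1 / real N * (\<Sum>t\<in>{1..int N}. ?\<phi> t i * ?y t))"
        by (simp add: eta_hat_def arx_R_gram arx_r_def)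
      define r where "r t = ?y t - (\<Sum>j<2*n. ?\<phi> t j * \<eta>0 n j)" for t
      have r: "r t = conv (fps_nth (fps_cutoff (Suc n) A0)) ?y t - conv (fps_nth (fps_cutoff (Suc n) B0)) ?u t" for t
        unfolding r_def \<eta>0_def
          minus_arx_phi_sum[OF bnd_trunc[OF bnd_Y(2)], where d=n and a="\<lambda>i. fps_nth A0 (Suc i)" and b="\<lambda>i. fps_nth B0 (Suc i)"]
        using delay_eq_cutoff[of A0 n] delay_eq_cutoff[of B0 n] by (simp add: A0_0 B0_0)
      have cut: "\<bar>conv (fps_nth (fps_cutoff (Suc n) f)) x t\<bar> \<le> norm1 f * Y" if f: "l1 f" and x: "bnd x Y" for f x t
      proof -
        have "norm1 (fps_cutoff (Suc n) f) \<le> norm1 f" by (rule norm1_mono[OF _ f]) auto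
        then show ?thesis
          using conv_bound[OF l1_cutoff x, of "Suc n" f t] Y0 by (meson mult_right_mono order_trans)
      qed
      have rb: "\<bar>r t\<bar> \<le> Y2" for t
        unfolding r Y2_def
        using cut[OF l1(3) bnd_trunc[OF bnd_Y(2)], of N t] cut[OF l1(5) bnd_trunc[OF bnd_Y(1)], of N t]
        by (simp add: distrib_right)
      \<comment> \<open>For t > n all samples used lie inside the record, and
        \<open>arx_identity\<close> leaves only the truncation of A0 and B0.\<close>
      have re: "\<bar>r t - z False t\<bar> \<le> Y * \<tau> n" if t: "int n < t" "t \<le> int N" for t
      proof -
        have "r t - z False t = (conv (fps_nth (fps_cutoff (Suc n) A0)) y t - conv (fps_nth A0) y t)
            - (conv (fps_nth (fps_cutoff (Suc n) B0)) u t - conv (fps_nth B0) u t)"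
          unfolding r conv_cutoff_trunc[OF t] using arx_identity[of t] by simp
        then show ?thesis
          using conv_cutoff_error[OF l1(3) bnd_Y(2), of t "Suc n"] conv_cutoff_error[OF l1(5) bnd_Y(1), of t "Suc n"]
          unfolding conv_cutoff \<tau>_def by (simp add: distrib_left mult.commute[of Y])
      qed
      have res: "\<bar>1 / real N * (\<Sum>t\<in>{1..int N}. ?\<phi> t i * (?y t - (\<Sum>j<2*n. ?\<phi> t j * \<eta>0 n j)))\<bar> \<le> \<rho> N"
        if i: "i < 2 * n" for i
      proof -
        let ?\<psi> = "arx_phi n y u"
        have b1: "\<bar>?\<phi> t i\<bar> \<le> Y" for t
          using bndD[OF bnd_trunc[OF bnd_Y(2)]] bndD[OF bnd_trunc[OF bnd_Y(1)]] by (simp add: arx_phi_def)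
        have b2: "\<bar>?\<psi> t i\<bar> \<le> Y" for t
          using bndD[OF bnd_Y(2)] bndD[OF bnd_Y(1)] by (simp add: arx_phi_def)
        have lagged: "\<bar>1 / real N * (\<Sum>t\<in>{1..int N}. ?\<psi> t i * z False t)\<bar> \<le> \<epsilon> N * S + C\<^sup>2 * T n"
        proof -
          have e: "\<epsilon> N \<ge> 0" by (rule cov_close_nonneg[OF cv])
          have t0: "tail1 f (Suc n) \<ge> 0" if "l1 f" for f by (rule tail1_nonneg[OF that])
          have n0: "norm1 f \<ge> 0" if "l1 f" for f by (rule norm1_nonneg[OF that])
          have cv': "cov_close z \<sigma> N (2 * n) (\<epsilon> N)" using cv by (simp add: n_def)
          show ?thesis
          proof (cases "i < n")
            case True
            have "\<bar>1 / real N * (\<Sum>t\<in>{1..int N}. y (t - int (Suc i)) * z False t)\<bar>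
              \<le> \<epsilon> N * (norm1 (G * U) + norm1 H) + C\<^sup>2 * (tail1 (G * U) (Suc n) + tail1 H (Suc n))"
              by (rule lagged_covariance[OF l1(6,2) z cv' _ _ y_eq]) (use True in auto)
            also have "\<dots> \<le> \<epsilon> N * S + C\<^sup>2 * T n"
              unfolding S_def T_def by (rule add_mono; rule mult_left_mono) (use e n0[OF l1(4)] t0[OF l1(4)] in auto)
            finally show ?thesis using True by (simp add: arx_phi_def sum_negf)
          next
            case False
            have "\<bar>1 / real N * (\<Sum>t\<in>{1..int N}. u (t - int (Suc (i - n))) * z False t)\<bar>
              \<le> \<epsilon> N * (norm1 U + norm1 0) + C\<^sup>2 * (tail1 U (Suc n) + tail1 0 (Suc n))"
              by (rule lagged_covariance[OF l1(4) l1_zero z cv']) (use False i in \<open>auto simp: u_def conv_def\<close>)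
            also have "\<dots> \<le> \<epsilon> N * S + C\<^sup>2 * T n"
              unfolding S_def T_def by (rule add_mono; rule mult_left_mono)
                (use e n0[OF l1(6)] n0[OF l1(2)] t0[OF l1(6)] t0[OF l1(2)] in \<open>auto simp: tail1_def\<close>)
            finally show ?thesis using False by (simp add: arx_phi_def)
          qed
        qed
        \<comment> \<open>Passes from record regressors and residual to ideal regressors and e. For
          t <= n both products are merely bounded; later on the two regressors coincide.\<close>
        have pt: "\<bar>?\<phi> t i * r t - ?\<psi> t i * z False t\<bar> \<le> Y\<^sup>2 * \<tau> n + (if t \<le> int n then Y * Y2 + Y\<^sup>2 else 0)"
          if t: "t \<in> {1..int N}" for t
        proof (cases "t \<le> int n")
          case True
          have "\<bar>?\<phi> t i * r t\<bar> \<le> Y * Y2" "\<bar>?\<psi> t i * z False t\<bar> \<le> Y * Y"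
            unfolding abs_mult using b1[of t] b2[of t] rb[of t] bndD[OF bnd_Y(3), of False t] Y0 Y2
            by (auto intro!: mult_mono)
          then show ?thesis using True \<tau>0[of n] abs_triangle_ineq4[of "?\<phi> t i * r t" "?\<psi> t i * z False t"]
            by (simp add: power2_eq_square add_increasing)
        next
          case False
          have "?\<phi> t i = ?\<psi> t i" using False t i by (auto simp: arx_phi_def trunc_def)
          then have "\<bar>?\<phi> t i * r t - ?\<psi> t i * z False t\<bar> = \<bar>?\<psi> t i\<bar> * \<bar>r t - z False t\<bar>"
            by (simp add: abs_mult[symmetric] right_diff_distrib)
          also have "\<dots> \<le> Y * (Y * \<tau> n)" using b2[of t] re[of t] False t Y0 by (intro mult_mono) auto
          finally show ?thesis using False by (simp add: power2_eq_square mult_ac)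
        qed
        have "\<bar>\<Sum>t\<in>{1..int N}. ?\<phi> t i * r t - ?\<psi> t i * z False t\<bar>
            \<le> (\<Sum>t\<in>{1..int N}. Y\<^sup>2 * \<tau> n + (if t \<le> int n then Y * Y2 + Y\<^sup>2 else 0))"
          by (rule order_trans[OF sum_abs sum_mono[OF pt]])
        also have "\<dots> = real N * (Y\<^sup>2 * \<tau> n) + (\<Sum>t\<in>{t\<in>{1..int N}. t \<le> int n}. Y * Y2 + Y\<^sup>2)"
          by (simp add: sum.distrib sum.inter_filter[symmetric])
        also have "(\<Sum>t\<in>{t\<in>{1..int N}. t \<le> int n}. Y * Y2 + Y\<^sup>2) \<le> (\<Sum>t\<in>{1..int n}. Y * Y2 + Y\<^sup>2)"
          using Y0 Y2 by (intro sum_mono2) auto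
        finally have "\<bar>\<Sum>t\<in>{1..int N}. ?\<phi> t i * r t - ?\<psi> t i * z False t\<bar> \<le> real N * (Y\<^sup>2 * \<tau> n) + real n * (Y * Y2 + Y\<^sup>2)"
          by simp
        then have "1 / real N * \<bar>\<Sum>t\<in>{1..int N}. ?\<phi> t i * r t - ?\<psi> t i * z False t\<bar> \<le> 1 / real N * (real N * (Y\<^sup>2 * \<tau> n) + real n * (Y * Y2 + Y\<^sup>2))"
          by (intro mult_left_mono) auto
        also have "\<dots> = Y\<^sup>2 * \<tau> n + real n * (Y * Y2 + Y\<^sup>2) / real N" using N1 by (simp add: distrib_left add_divide_distrib)
        finally have "\<bar>1 / real N * (\<Sum>t\<in>{1..int N}. ?\<phi> t i * r t) - 1 / real N * (\<Sum>t\<in>{1..int N}. ?\<psi> t i * z False t)\<bar>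
            \<le> Y\<^sup>2 * \<tau> n + real n * (Y * Y2 + Y\<^sup>2) / real N"
          unfolding right_diff_distrib[symmetric] sum_subtractf[symmetric] by (simp add: abs_mult)
        then show ?thesis using lagged unfolding r_def \<rho>_def n_def by linarith
      qed
      show "norm (\<Sum>i<2*nN N. \<bar>vec_index (eta_hat \<delta>' N (nN N) y u) i - \<eta>0 (nN N) i\<bar>) \<le> real (2 * nN N) * \<rho> N / c"
        using least_squares_error[where c=c and d="2*n" and a="1 / real N" and T="{1..int N}" and \<phi>="?\<phi>" and y="?y" and \<theta>="\<eta>0 n" and \<rho>="\<rho> N", OF c pe' res]
        unfolding eta[symmetric] by (simp add: n_def abs_of_nonneg sum_nonneg)
    qed
  qed
qed

lemma polyA_fps: "fps_of_poly (polyA n \<eta>) = 1 + delay n (\<lambda>k. vec_index \<eta> k)"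
  and polyB_fps: "fps_of_poly (polyB n \<eta>) = delay n (\<lambda>k. vec_index \<eta> (n + k))"
  and polyF_fps: "fps_of_poly (polyF n \<eta>) = 1 + delay n (\<lambda>k. vec_index \<eta> k)"
  unfolding polyA_def polyB_def polyF_def fps_of_poly_coeff_list by simp_all

text \<open>The estimated polynomial differs from the true series by the parameter error up to index
  n and by the tail of that series beyond it.\<close>

lemma AB_LIMSEQ:
  fixes \<eta> :: "nat \<Rightarrow> real Matrix.vec"
  assumes "(\<lambda>N. \<Sum>i<2*nN N. \<bar>vec_index (\<eta> N) i - \<eta>0 (nN N) i\<bar>) \<longlonglongrightarrow> 0"
  shows "(\<lambda>N. norm1 (fps_of_poly (polyA (nN N) (\<eta> N)) - A0)) \<longlonglongrightarrow> 0"
    and "(\<lambda>N. norm1 (fps_of_poly (polyB (nN N) (\<eta> N)) - B0)) \<longlonglongrightarrow> 0"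
proof -
  have aux: "norm1 (fps_const (fps_nth f 0) + delay n g - f) \<le> (\<Sum>i<n. \<bar>g i - fps_nth f (Suc i)\<bar>) + tail1 f (Suc n)"
    if f: "l1 f" for f g n
  proof -
    have "fps_const (fps_nth f 0) + delay n g - f = delay n (\<lambda>i. g i - fps_nth f (Suc i)) - (f - fps_cutoff (Suc n) f)"
      using delay_eq_cutoff[of f n] delay_diff[of n g "\<lambda>i. fps_nth f (Suc i)"] by (simp add: algebra_simps)
    then have "norm1 (fps_const (fps_nth f 0) + delay n g - f) \<le> norm1 (delay n (\<lambda>i. g i - fps_nth f (Suc i))) + norm1 (f - fps_cutoff (Suc n) f)"
      using norm1_diff[OF l1_delay l1_diff[OF f l1_cutoff]] by (simp only:)
    then show ?thesis using norm1_minus_cutoff[OF f, of "Suc n"] by (simp add: norm1_delay)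
  qed
  have split: "(\<Sum>i<2*nN N. \<bar>vec_index (\<eta> N) i - \<eta>0 (nN N) i\<bar>) =
      (\<Sum>i<nN N. \<bar>vec_index (\<eta> N) i - fps_nth A0 (Suc i)\<bar>) + (\<Sum>i<nN N. \<bar>vec_index (\<eta> N) (nN N + i) - fps_nth B0 (Suc i)\<bar>)" for N
    by (simp add: sum_split_halves \<eta>0_def)
  have l: "(\<lambda>N. (\<Sum>i<2*nN N. \<bar>vec_index (\<eta> N) i - \<eta>0 (nN N) i\<bar>) + tail1 f (Suc (nN N))) \<longlonglongrightarrow> 0" if "l1 f" for f
    using tendsto_add[OF assms tail_LIMSEQ[OF that]] by simp
  show "(\<lambda>N. norm1 (fps_of_poly (polyA (nN N) (\<eta> N)) - A0)) \<longlonglongrightarrow> 0"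
  proof (rule Lim_null_comparison[OF always_eventually l[OF l1(3)]], rule allI)
    fix N
    have "norm1 (fps_of_poly (polyA (nN N) (\<eta> N)) - A0) \<le> (\<Sum>i<2*nN N. \<bar>vec_index (\<eta> N) i - \<eta>0 (nN N) i\<bar>) + tail1 A0 (Suc (nN N))"
    proof -
      have "norm1 (fps_of_poly (polyA (nN N) (\<eta> N)) - A0) \<le> (\<Sum>i<nN N. \<bar>vec_index (\<eta> N) (i) - fps_nth A0 (Suc i)\<bar>) + tail1 A0 (Suc (nN N))"
        using aux[OF l1(3), of "nN N" "\<lambda>k. vec_index (\<eta> N) k"] by (simp add: polyA_fps A0_0)
      moreover have "0 \<le> (\<Sum>i<nN N. \<bar>vec_index (\<eta> N) (nN N + i) - fps_nth B0 (Suc i)\<bar>)"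
        by (intro sum_nonneg) auto
      ultimately show ?thesis unfolding split by linarith
    qed
    then show "norm (norm1 (fps_of_poly (polyA (nN N) (\<eta> N)) - A0)) \<le> (\<Sum>i<2*nN N. \<bar>vec_index (\<eta> N) i - \<eta>0 (nN N) i\<bar>) + tail1 A0 (Suc (nN N))"
      using norm1_nonneg[OF l1_diff[OF l1_fps_of_poly l1(3)]] by simp
  qed
  show "(\<lambda>N. norm1 (fps_of_poly (polyB (nN N) (\<eta> N)) - B0)) \<longlonglongrightarrow> 0"
  proof (rule Lim_null_comparison[OF always_eventually l[OF l1(5)]], rule allI)
    fix N
    have "norm1 (fps_of_poly (polyB (nN N) (\<eta> N)) - B0) \<le> (\<Sum>i<2*nN N. \<bar>vec_index (\<eta> N) i - \<eta>0 (nN N) i\<bar>) + tail1 B0 (Suc (nN N))"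
    proof -
      have "norm1 (fps_of_poly (polyB (nN N) (\<eta> N)) - B0) \<le> (\<Sum>i<nN N. \<bar>vec_index (\<eta> N) (nN N + i) - fps_nth B0 (Suc i)\<bar>) + tail1 B0 (Suc (nN N))"
        using aux[OF l1(5), of "nN N" "\<lambda>k. vec_index (\<eta> N) (nN N + k)"] by (simp add: polyB_fps B0_0)
      moreover have "0 \<le> (\<Sum>i<nN N. \<bar>vec_index (\<eta> N) (i) - fps_nth A0 (Suc i)\<bar>)"
        by (intro sum_nonneg) auto
      ultimately show ?thesis unfolding split by linarith
    qed
    then show "norm (norm1 (fps_of_poly (polyB (nN N) (\<eta> N)) - B0)) \<le> (\<Sum>i<2*nN N. \<bar>vec_index (\<eta> N) i - \<eta>0 (nN N) i\<bar>) + tail1 B0 (Suc (nN N))"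
      using norm1_nonneg[OF l1_diff[OF l1_fps_of_poly l1(5)]] by simp
  qed
qed

section \<open>Consistency of the Steiglitz-McBride step and of its iterates\<close>

definition \<theta>0 where "\<theta>0 i = (if i < m then coeff Fo (Suc i) else coeff Lo (Suc (i - m)))" for i

lemma Fo_neq_0: "Fo \<noteq> 0" using Fo0 by auto

text \<open>The weighting of the regressors cancels the common factor: \<open>- V\<^sub>1 Lo + V\<^sub>2 Fo\<close> equals
  \<open>Fo H F U\<^sup>-\<^sup>1\<close> times the filter from \<open>w\<close> to the linear combination of regressors.\<close>
lemma sm_lower:
  assumes F: "l1 F" "fps_nth F 0 = 1"
  obtains \<kappa> where "\<kappa> > 0" "\<And>n v. m \<le> n \<Longrightarrow> \<kappa> * (\<Sum>i<2*m. (v i)\<^sup>2) \<le> (\<Sum>k\<le>2*n.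
      (fps_nth (- delay m v * (B0 * inverse F * U) + delay m (\<lambda>i. v (m + i)) * (A0 * inverse F * U)) k)\<^sup>2 +
      (fps_nth (- delay m v * 0 + delay m (\<lambda>i. v (m + i)) * 0) k)\<^sup>2)"
proof -
  obtain c where c: "c > 0" and low: "\<And>v. c * (\<Sum>i<2*m. (v i)\<^sup>2) \<le>
    (\<Sum>k\<le>2*m. (fps_nth (- delay m v * fps_of_poly Lo + delay m (\<lambda>i. v (m + i)) * fps_of_poly Fo) k)\<^sup>2)"
    using coprime_comb_lower_bound[OF LF dLo dFo order Fo_neq_0] by blast
  define X where "X = fps_of_poly Fo * H * F * Ui"
  have X: "l1 X" unfolding X_def by (intro l1_mult l1_fps_of_poly l1(2) F l1_Ui)
  have iF: "F * inverse F = 1" using inverse_mult_eq_1'[of F] F(2) by simp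
  define K where "K = 1 + (norm1 X)\<^sup>2"
  have K: "K > 0" unfolding K_def by (intro add_pos_nonneg) auto
  have le: "c * (\<Sum>i<2*m. (v i)\<^sup>2) \<le> K * (\<Sum>k\<le>2*n.
      (fps_nth (- delay m v * (B0 * inverse F * U) + delay m (\<lambda>i. v (m + i)) * (A0 * inverse F * U)) k)\<^sup>2)"
    if mn: "m \<le> n" for n v
  proof -
    let ?V1 = "delay m v" and ?V2 = "delay m (\<lambda>i. v (m + i))"
    let ?P = "- ?V1 * (B0 * inverse F * U) + ?V2 * (A0 * inverse F * U)"
    let ?W = "- ?V1 * fps_of_poly Lo + ?V2 * fps_of_poly Fo"
    let ?s = "\<lambda>f. (\<Sum>k\<le>2*n. (fps_nth f k)\<^sup>2)"
    have "X * ?P = (- ?V1 * (fps_of_poly Fo * B0) + ?V2 * (fps_of_poly Fo * A0)) * H * (F * inverse F) * (U * Ui)"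
      unfolding X_def by (simp only: algebra_simps)
    also have "\<dots> = (- ?V1 * fps_of_poly Lo + ?V2 * fps_of_poly Fo) * (A0 * H) * (F * inverse F) * (U * Ui)"
      unfolding FB by (simp only: algebra_simps)
    finally have XP: "X * ?P = ?W" unfolding HA iF UU by simp
    have "c * (\<Sum>i<2*m. (v i)\<^sup>2) \<le> (\<Sum>k\<le>2*m. (fps_nth ?W k)\<^sup>2)" by (rule low)
    also have "\<dots> \<le> ?s ?W" by (rule sum_mono2) (use mn in auto)
    also have "\<dots> = ?s (X * ?P)" unfolding XP ..
    also have "\<dots> \<le> (norm1 X)\<^sup>2 * ?s ?P" by (rule young_causal[OF X])
    also have "\<dots> \<le> K * ?s ?P" unfolding K_def by (intro mult_right_mono sum_nonneg) auto
    finally show ?thesis .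
  qed
  show ?thesis
  proof (rule that[of "c / K"])
    show "c / K > 0" using K c by simp
  qed (use le K in \<open>simp add: field_simps\<close>)
qed

text \<open>The identity Fo B0 = Lo A0 survives division by any F, so the limiting residual at
  \<open>\<theta>0\<close> vanishes for every admissible weighting. Leaving F open lets one lemma
  serve the initial estimate, with F = 1, and all later iterates, with F = Fo.\<close>

lemma sm_step_LIMSEQ:
  fixes \<eta> \<theta> :: "nat \<Rightarrow> real Matrix.vec"
  assumes A: "(\<lambda>N. norm1 (fps_of_poly (polyA (nN N) (\<eta> N)) - A0)) \<longlonglongrightarrow> 0"
    and B: "(\<lambda>N. norm1 (fps_of_poly (polyB (nN N) (\<eta> N)) - B0)) \<longlonglongrightarrow> 0"
    and FN: "(\<lambda>N. norm1 (fps_of_poly (polyF m (\<theta> N)) - F)) \<longlonglongrightarrow> 0"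
    and F: "l1 F" "fps_nth F 0 = 1" "l1 (inverse F)"
    and i: "i < 2 * m"
  shows "(\<lambda>N. vec_index (sm_step N (nN N) m (\<eta> N) (trunc N u) (\<theta> N)) i) \<longlonglongrightarrow> \<theta>0 i"
proof -
  define iF where "iF N = inverse (fps_of_poly (polyF m (\<theta> N)) :: real fps)" for N
  define Yh where "Yh N = fps_of_poly (polyB (nN N) (\<eta> N)) * iF N" for N
  define Uh where "Uh N = fps_of_poly (polyA (nN N) (\<eta> N)) * iF N" for N
  define Ys where "Ys = B0 * inverse F"
  define Us where "Us = A0 * inverse F"
  have polyF0: "fps_nth (fps_of_poly (polyF m (\<theta> N))) 0 = 1" for N
    by (simp add: polyF_fps delay_nth)
  have lYs: "l1 Ys" "l1 Us" unfolding Ys_def Us_def by (intro l1_mult l1 F)+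
  have "(\<lambda>N. norm1 (inverse F) * norm1 (fps_of_poly (polyF m (\<theta> N)) - F)) \<longlonglongrightarrow> norm1 (inverse F) * 0"
    by (intro tendsto_mult_left FN)
  \<comment> \<open>The smallness condition of \<open>inverse_perturb\<close>; from then on the
    estimated 1/F is in l1 and close to its limit.\<close>
  then have "\<forall>\<^sub>F N in sequentially. norm1 (inverse F) * norm1 (fps_of_poly (polyF m (\<theta> N)) - F) < 1 / 2"
    by (intro order_tendstoD(2)) auto
  then have iF: "\<forall>\<^sub>F N in sequentially. l1 (iF N) \<and>
      norm1 (iF N - inverse F) \<le> 2 * (norm1 (inverse F))\<^sup>2 * norm1 (fps_of_poly (polyF m (\<theta> N)) - F)"
  proof eventually_elim
    case (elim N)
    show ?case unfolding iF_def
      using inverse_perturb[OF polyF0[of N] F(2) F(3) l1_diff[OF l1_fps_of_poly F(1)]] elim by simp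
  qed
  have l_iF: "\<forall>\<^sub>F N in sequentially. l1 (iF N)" using iF by eventually_elim simp
  have iF_lim: "(\<lambda>N. norm1 (iF N - inverse F)) \<longlonglongrightarrow> 0"
  proof (rule Lim_null_comparison)
    show "\<forall>\<^sub>F N in sequentially. norm (norm1 (iF N - inverse F)) \<le> 2 * (norm1 (inverse F))\<^sup>2 * norm1 (fps_of_poly (polyF m (\<theta> N)) - F)"
      using iF by eventually_elim (simp add: norm1_nonneg l1_diff F(3))
    show "(\<lambda>N. 2 * (norm1 (inverse F))\<^sup>2 * norm1 (fps_of_poly (polyF m (\<theta> N)) - F)) \<longlonglongrightarrow> 0"
      using tendsto_mult_left[OF FN, of "2 * (norm1 (inverse F))\<^sup>2"] by simp
  qed
  have Yh_lim: "(\<lambda>N. norm1 (Yh N - Ys)) \<longlonglongrightarrow> 0" unfolding Yh_def Ys_def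
    using l_iF by (intro norm1_mult_LIMSEQ l1(5) F(3) B iF_lim) simp
  have Uh_lim: "(\<lambda>N. norm1 (Uh N - Us)) \<longlonglongrightarrow> 0" unfolding Uh_def Us_def
    using l_iF by (intro norm1_mult_LIMSEQ l1(3) F(3) A iF_lim) simp
  have lh: "\<forall>\<^sub>F N in sequentially. l1 (Yh N) \<and> l1 (Uh N)"
    using l_iF by eventually_elim (simp add: Yh_def Uh_def l1_mult)
  define ys where "ys = conv (fps_nth Ys) u"
  define us where "us = conv (fps_nth Us) u"
  define Q where "Q = (norm1 Ys + norm1 Us) * Y"
  have nYs: "norm1 Ys \<ge> 0" "norm1 Us \<ge> 0" using lYs norm1_nonneg by auto
  have bnd_s: "bnd ys Q" "bnd us Q"
  proof -
    have "norm1 Ys * Y \<le> Q" "norm1 Us * Y \<le> Q" unfolding Q_def using nYs Y0 by (auto simp: distrib_right)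
    then show "bnd ys Q" "bnd us Q" unfolding ys_def us_def
      using conv_bound[OF lYs(1) bnd_Y(1)] conv_bound[OF lYs(2) bnd_Y(1)] by (meson bndI order_trans)+
  qed
  have Q0: "Q \<ge> 0" by (rule bnd_nonneg[OF bnd_s(1)])
  define P1 where "P1 = Ys * U"
  define P2 where "P2 = Us * U"
  have lP: "l1 P1" "l1 P2" unfolding P1_def P2_def by (intro l1_mult lYs l1)+
  have ys_eq: "ys t = conv (fps_nth P1) (z True) t + conv (fps_nth 0) (z False) t" for t
    unfolding ys_def P1_def u_def using conv_mult[OF lYs(1) l1(4) z] by (simp add: conv_def)
  have us_eq: "us t = conv (fps_nth P2) (z True) t + conv (fps_nth 0) (z False) t" for t
    unfolding us_def P2_def u_def using conv_mult[OF lYs(2) l1(4) z] by (simp add: conv_def)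
  obtain \<kappa> where \<kappa>: "\<kappa> > 0" and low: "\<And>n v. m \<le> n \<Longrightarrow> \<kappa> * (\<Sum>i<2*m. (v i)\<^sup>2) \<le> (\<Sum>k\<le>2*n.
      (fps_nth (- delay m v * P1 + delay m (\<lambda>i. v (m + i)) * P2) k)\<^sup>2 +
      (fps_nth (- delay m v * 0 + delay m (\<lambda>i. v (m + i)) * 0) k)\<^sup>2)"
    using sm_lower[OF F(1,2)] unfolding P1_def P2_def Ys_def Us_def by blast
  define c where "c = \<sigma>\<^sup>2 * \<kappa> / 2"
  have c: "c > 0" using \<sigma> \<kappa> by (simp add: c_def)
  define S where "S = norm1 P1 + norm1 0 + norm1 P2 + norm1 0"
  define T where "T n = tail1 P1 (Suc n) + tail1 0 (Suc n) + tail1 P2 (Suc n) + tail1 0 (Suc n)" for n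
  \<comment> \<open>The first part is the filter error. The tails compare the limiting filters on
    the record with those on the full input after time n: the first n+1 coefficients act alike on
    both, and each signal contributes one tail, whence the 2.\<close>
  define \<gamma> where "\<gamma> N = (norm1 (Yh N - Ys) + norm1 (Uh N - Us)) * Y + 2 * (tail1 Ys (Suc (nN N)) + tail1 Us (Suc (nN N))) * Y" for N
  define err where "err N = 2 * real m * (\<epsilon> N * S\<^sup>2 + 2 * C\<^sup>2 * S * T (nN N) + (2 * Q * \<gamma> N + (real (nN N) / real N + real m / real N) * Q\<^sup>2))" for N
  have \<gamma>: "\<gamma> \<longlonglongrightarrow> (0 + 0) * Y + 2 * (0 + 0) * Y"
    unfolding \<gamma>_def by (intro tendsto_intros Yh_lim Uh_lim tail_LIMSEQ lYs)
  have T: "(\<lambda>N. T (nN N)) \<longlonglongrightarrow> 0 + 0 + 0 + 0"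
    unfolding T_def by (intro tendsto_intros tail_LIMSEQ lP l1_zero)
  have m_div: "(\<lambda>N. real m / real N) \<longlonglongrightarrow> 0" by (rule lim_const_over_n)
  have "err \<longlonglongrightarrow> 2 * real m * (0 * S\<^sup>2 + 2 * C\<^sup>2 * S * (0 + 0 + 0 + 0) + (2 * Q * ((0 + 0) * Y + 2 * (0 + 0) * Y) + (0 + 0) * Q\<^sup>2))"
    unfolding err_def by (intro tendsto_intros eps_LIMSEQ T \<gamma> n_div m_div)
  then have "err \<longlonglongrightarrow> 0" by simp
  then have ev_err: "\<forall>\<^sub>F N in sequentially. err N < c" using c by (rule order_tendstoD(2))
  \<comment> \<open>Bounds the norms of \<open>Yh\<close> and \<open>Uh\<close> by those of their
    limits plus 1, and thus the regressors by Q + Y.\<close>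
  have "(\<lambda>N. norm1 (Yh N - Ys) + norm1 (Uh N - Us)) \<longlonglongrightarrow> 0 + 0" by (intro tendsto_add Yh_lim Uh_lim)
  then have ev_small: "\<forall>\<^sub>F N in sequentially. norm1 (Yh N - Ys) + norm1 (Uh N - Us) < 1"
    by (intro order_tendstoD(2)) auto
  define Fp where "Fp = fps_of_poly Fo"
  define Lp where "Lp = fps_of_poly Lo"
  have lFL: "l1 Fp" "l1 Lp" by (simp_all add: Fp_def Lp_def)
  define res where "res N = (norm1 Fp * norm1 (Yh N - Ys) + norm1 Lp * norm1 (Uh N - Us)) * Y" for N
  \<comment> \<open>Regressors and target are all filtered from the same input record, so neither
    noise nor edge terms enter; the bound is a regressor bound times the residual bound.\<close>
  define \<rho> where "\<rho> N = (Q + Y) * res N" for N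
  have "(\<lambda>N. real (2 * m) * \<rho> N / c) \<longlonglongrightarrow> real (2 * m) * ((Q + Y) * ((norm1 Fp * 0 + norm1 Lp * 0) * Y)) / c"
    unfolding \<rho>_def res_def by (intro tendsto_intros Yh_lim Uh_lim) (use c in auto)
  then have \<rho>_lim: "(\<lambda>N. real (2 * m) * \<rho> N / c) \<longlonglongrightarrow> 0" by simp
  have "(\<lambda>N. vec_index (sm_step N (nN N) m (\<eta> N) (trunc N u) (\<theta> N)) i - \<theta>0 i) \<longlonglongrightarrow> 0"
  proof (rule Lim_null_comparison[OF _ \<rho>_lim])
    show "\<forall>\<^sub>F N in sequentially. norm (vec_index (sm_step N (nN N) m (\<eta> N) (trunc N u) (\<theta> N)) i - \<theta>0 i) \<le> real (2 * m) * \<rho> N / c"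
      using ev_err cov lh ev_small n_pos[of m] eventually_ge_at_top[of 1]
    proof eventually_elim
      fix N
      assume e: "err N < c" and cv: "cov_close z \<sigma> N (2 * nN N) (\<epsilon> N)" and lh: "l1 (Yh N) \<and> l1 (Uh N)"
        and small: "norm1 (Yh N - Ys) + norm1 (Uh N - Us) < 1" and mn: "m \<le> nN N" and N1: "1 \<le> N"
      define n where "n = nN N"
      let ?ud = "trunc N u"
      define yh where "yh = yfilt n m (\<eta> N) (\<theta> N) ?ud"
      define uh where "uh = ufilt n m (\<eta> N) (\<theta> N) ?ud"
      have imp_eq: "imp P (polyF m (\<theta> N)) = fps_nth (fps_of_poly P * iF N)" for P
        unfolding iF_def imp_def[abs_def] using fps_of_poly_divide[of "polyF m (\<theta> N)" P] polyF0[of N] by simp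
      have yh: "yh = conv (fps_nth (Yh N)) ?ud" and uh: "uh = conv (fps_nth (Uh N)) ?ud"
        unfolding yh_def uh_def yfilt_def ufilt_def imp_eq Yh_def Uh_def n_def by simp_all
      have bud: "bnd ?ud Y" by (rule bnd_trunc[OF bnd_Y(1)])
      have lYh: "l1 (Yh N)" "l1 (Uh N)" using lh by auto
      have ld: "l1 (Yh N - Ys)" "l1 (Uh N - Us)" using lYh lYs by (auto intro: l1_diff)
      have nd: "norm1 (Yh N - Ys) \<ge> 0" "norm1 (Uh N - Us) \<ge> 0" using ld norm1_nonneg by auto
      have filt_close: "\<bar>conv (fps_nth h) ?ud s - conv (fps_nth g) u s\<bar> \<le> norm1 (h - g) * Y + 2 * tail1 g (Suc n) * Y"
        if hg: "l1 h" "l1 g" and s: "int n < s" "s \<le> int N" for h g s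
      proof -
        have 1: "\<bar>conv (fps_nth h) ?ud s - conv (fps_nth g) ?ud s\<bar> \<le> norm1 (h - g) * Y"
          using conv_bound[OF l1_diff[OF hg] bud, of s] conv_diff[OF hg bud, of s] by simp
        have "(\<Sum>k<Suc n. fps_nth g k * ?ud (s - int k)) = (\<Sum>k<Suc n. fps_nth g k * u (s - int k))"
          using conv_cutoff_trunc[OF s, of g u] unfolding conv_cutoff .
        then have "\<bar>conv (fps_nth g) ?ud s - conv (fps_nth g) u s\<bar> \<le> 2 * tail1 g (Suc n) * Y"
          using conv_cutoff_error[OF hg(2) bud, of s "Suc n"] conv_cutoff_error[OF hg(2) bnd_Y(1), of s "Suc n"] by linarith
        with 1 show ?thesis by linarith
      qed
      have t0: "tail1 Ys (Suc n) * Y \<ge> 0" "tail1 Us (Suc n) * Y \<ge> 0" using lYs tail1_nonneg Y0 by auto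
      have nd': "norm1 (Yh N - Ys) * Y \<ge> 0" "norm1 (Uh N - Us) * Y \<ge> 0" using nd Y0 by auto
      have \<gamma>_eq: "\<gamma> N = norm1 (Yh N - Ys) * Y + norm1 (Uh N - Us) * Y + 2 * tail1 Ys (Suc n) * Y + 2 * tail1 Us (Suc n) * Y"
        unfolding \<gamma>_def n_def by (simp add: algebra_simps)
      have close: "\<bar>yh s - ys s\<bar> \<le> \<gamma> N \<and> \<bar>uh s - us s\<bar> \<le> \<gamma> N" if s: "int n < s" "s \<le> int N" for s
        using filt_close[OF lYh(1) lYs(1) s] filt_close[OF lYh(2) lYs(2) s] t0 nd'
        unfolding yh uh ys_def us_def \<gamma>_eq by linarith
      have \<gamma>0: "\<gamma> N \<ge> 0" unfolding \<gamma>_eq using t0 nd' by linarith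
      have pe: "c * (\<Sum>i<2*m. (v i)\<^sup>2) \<le> 1 / real N * (\<Sum>t\<in>{int m + 1..int N}. (\<Sum>i<2*m. arx_phi m yh uh t i * v i)\<^sup>2)" for v
      proof -
        let ?V2 = "\<Sum>i<2*m. (v i)\<^sup>2" and ?V = "\<Sum>i<2*m. \<bar>v i\<bar>"
        let ?e1 = "\<epsilon> N * S\<^sup>2 + 2 * C\<^sup>2 * S * T n" and ?e2 = "2 * Q * \<gamma> N + real (n + m) * Q\<^sup>2 / real N"
        have cv': "cov_close z \<sigma> N (2 * n) (\<epsilon> N)" and mn': "m \<le> n" using cv mn by (auto simp: n_def)
        have 1: "\<sigma>\<^sup>2 * \<kappa> * ?V2 - ?V\<^sup>2 * ?e1 \<le> 1 / real N * (\<Sum>t\<in>{1..int N}. (\<Sum>i<2*m. arx_phi m ys us t i * v i)\<^sup>2)"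
          unfolding S_def T_def
          by (rule regressor_power2_mean_ge[OF lP(1) l1_zero lP(2) l1_zero z cv' mn' ys_eq us_eq low[OF mn']])
        have 2: "1 / real N * (\<Sum>t\<in>{1..int N}. (\<Sum>i<2*m. arx_phi m ys us t i * v i)\<^sup>2) - ?V\<^sup>2 * ?e2
            \<le> 1 / real N * (\<Sum>t\<in>{int m + 1..int N}. (\<Sum>i<2*m. arx_phi m yh uh t i * v i)\<^sup>2)"
          by (rule perturbed_quadratic_form[OF bnd_s close \<gamma>0]) auto
        have e0: "?e1 + ?e2 \<ge> 0"
        proof -
          have "S \<ge> 0" unfolding S_def using lP norm1_nonneg by simp
          moreover have "T n \<ge> 0" unfolding T_def using lP tail1_nonneg l1_zero by (simp add: add_nonneg_nonneg)
          ultimately show ?thesis using cov_close_nonneg[OF cv] \<gamma>0 Q0 by simp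
        qed
        have "?V\<^sup>2 * (?e1 + ?e2) \<le> (real (2 * m) * ?V2) * (?e1 + ?e2)"
          by (intro mult_right_mono sum_abs_power2_le e0)
        also have "\<dots> = err N * ?V2" by (simp add: err_def n_def add_divide_distrib algebra_simps)
        also have "\<dots> \<le> c * ?V2" using e by (intro mult_right_mono sum_nonneg) auto
        finally have 3: "?V\<^sup>2 * (?e1 + ?e2) \<le> c * ?V2" .
        have "c * ?V2 = \<sigma>\<^sup>2 * \<kappa> * ?V2 - c * ?V2" by (simp add: c_def)
        also have "\<dots> \<le> \<sigma>\<^sup>2 * \<kappa> * ?V2 - ?V\<^sup>2 * (?e1 + ?e2)" using 3 by simp
        also have "\<dots> \<le> 1 / real N * (\<Sum>t\<in>{int m + 1..int N}. (\<Sum>i<2*m. arx_phi m yh uh t i * v i)\<^sup>2)"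
          using 1 2 unfolding distrib_left[of "?V\<^sup>2" ?e1] by linarith
        finally show ?thesis .
      qed
      \<comment> \<open>An exact identity at every t, as composition of filters holds on the
        truncated record as well.\<close>
      have residual: "yh t - (\<Sum>j<2*m. arx_phi m yh uh t j * \<theta>0 j) = conv (fps_nth (Fp * Yh N - Lp * Uh N)) ?ud t" for t
      proof -
        have F_eq: "1 + delay m (\<lambda>i. coeff Fo (Suc i)) = Fp" using delay_poly[OF Fo0 dFo] by (simp add: Fp_def)
        have L_eq: "delay m (\<lambda>i. coeff Lo (Suc i)) = Lp" using delay_poly[OF Lo0 dLo] by (simp add: Lp_def)
        have "yh t - (\<Sum>j<2*m. arx_phi m yh uh t j * \<theta>0 j) = conv (fps_nth Fp) yh t - conv (fps_nth Lp) uh t"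
          unfolding \<theta>0_def yh uh
          by (subst minus_arx_phi_sum[OF conv_bnd[OF lYh(1) bud],
                where a = "\<lambda>i. coeff Fo (Suc i)" and b = "\<lambda>i. coeff Lo (Suc i)"])
            (simp only: F_eq L_eq)
        also have "\<dots> = conv (fps_nth (Fp * Yh N)) ?ud t - conv (fps_nth (Lp * Uh N)) ?ud t"
          unfolding yh uh by (simp only: conv_mult[OF lFL(1) lYh(1) bud] conv_mult[OF lFL(2) lYh(2) bud])
        also have "\<dots> = conv (fps_nth (Fp * Yh N - Lp * Uh N)) ?ud t"
          by (rule conv_diff[OF l1_mult l1_mult bud, symmetric]) (use lFL lYh in auto)
        finally show ?thesis .
      qed
      have res_bound: "\<bar>conv (fps_nth (Fp * Yh N - Lp * Uh N)) ?ud t\<bar> \<le> res N" for t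
      proof -
        \<comment> \<open>The limits can be subtracted at no cost, so the residual is driven by the
          errors of \<open>Yh\<close> and \<open>Uh\<close> alone.\<close>
        have "Fp * Ys = Lp * Us" unfolding Ys_def Us_def Fp_def Lp_def mult.assoc[symmetric] FB ..
        then have eq: "Fp * Yh N - Lp * Uh N = Fp * (Yh N - Ys) - Lp * (Uh N - Us)" by (simp add: algebra_simps)
        have l: "l1 (Fp * (Yh N - Ys))" "l1 (Lp * (Uh N - Us))" by (intro l1_mult lFL ld)+
        have "\<bar>conv (fps_nth (Fp * Yh N - Lp * Uh N)) ?ud t\<bar> \<le> norm1 (Fp * (Yh N - Ys) - Lp * (Uh N - Us)) * Y"
          unfolding eq by (rule conv_bound[OF l1_diff[OF l] bud])
        also have "\<dots> \<le> (norm1 Fp * norm1 (Yh N - Ys) + norm1 Lp * norm1 (Uh N - Us)) * Y"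
          by (intro mult_right_mono order_trans[OF norm1_diff[OF l]] add_mono norm1_mult lFL ld Y0)
        finally show ?thesis unfolding res_def .
      qed
      have phi_bound: "\<bar>arx_phi m yh uh t j\<bar> \<le> Q + Y" for t j
      proof -
        have "norm1 (Yh N) \<le> norm1 Ys + norm1 (Yh N - Ys)" "norm1 (Uh N) \<le> norm1 Us + norm1 (Uh N - Us)"
          using norm1_add[OF lYs(1) ld(1)] norm1_add[OF lYs(2) ld(2)] by auto
        then have "norm1 (Yh N) \<le> norm1 Ys + norm1 Us + 1" "norm1 (Uh N) \<le> norm1 Ys + norm1 Us + 1"
          using small nd nYs by linarith+
        then have "norm1 (Yh N) * Y \<le> (norm1 Ys + norm1 Us + 1) * Y" "norm1 (Uh N) * Y \<le> (norm1 Ys + norm1 Us + 1) * Y"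
          using Y0 by (auto intro: mult_right_mono)
        then have "norm1 (Yh N) * Y \<le> Q + Y" "norm1 (Uh N) * Y \<le> Q + Y"
          by (simp_all add: Q_def distrib_right)
        then have "\<bar>yh s\<bar> \<le> Q + Y" "\<bar>uh s\<bar> \<le> Q + Y" for s
          unfolding yh uh using conv_bound[OF lYh(1) bud, of s] conv_bound[OF lYh(2) bud, of s] by linarith+
        then show ?thesis by (simp add: arx_phi_def)
      qed
      have r0: "res N \<ge> 0" using order_trans[OF abs_ge_zero res_bound] .
      have rho: "\<bar>1 / real N * (\<Sum>t\<in>{int m + 1..int N}. arx_phi m yh uh t j * (yh t - (\<Sum>j<2*m. arx_phi m yh uh t j * \<theta>0 j)))\<bar> \<le> \<rho> N" for j
      proof -
        have "\<bar>\<Sum>t\<in>{int m + 1..int N}. arx_phi m yh uh t j * (yh t - (\<Sum>j<2*m. arx_phi m yh uh t j * \<theta>0 j))\<bar>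
            \<le> (\<Sum>t\<in>{int m + 1..int N}. \<rho> N)"
          unfolding residual \<rho>_def
          by (rule order_trans[OF sum_abs], intro sum_mono, unfold abs_mult, intro mult_mono)
            (use phi_bound res_bound Q0 Y0 in auto)
        also have "\<dots> \<le> real N * \<rho> N"
          using r0 Q0 Y0 by (auto simp: \<rho>_def intro!: mult_right_mono)
        finally have "1 / real N * \<bar>\<Sum>t\<in>{int m + 1..int N}. arx_phi m yh uh t j * (yh t - (\<Sum>j<2*m. arx_phi m yh uh t j * \<theta>0 j))\<bar>
            \<le> 1 / real N * (real N * \<rho> N)" by (intro mult_left_mono) auto
        then show ?thesis using N1 by (simp add: abs_mult)
      qed
      have step: "sm_step N n m (\<eta> N) ?ud (\<theta> N) = minv (gram (2 * m) {int m + 1..int N} (1 / real N) (arx_phi m yh uh))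
          *\<^sub>v vec (2 * m) (\<lambda>i. 1 / real N * (\<Sum>t\<in>{int m + 1..int N}. arx_phi m yh uh t i * yh t))"
        by (simp add: sm_step_def sm_R_gram sm_r_def sm_phi_arx_phi yh_def uh_def)
      have "\<bar>vec_index (sm_step N n m (\<eta> N) ?ud (\<theta> N)) i - \<theta>0 i\<bar> \<le> (\<Sum>i<2*m. \<bar>vec_index (sm_step N n m (\<eta> N) ?ud (\<theta> N)) i - \<theta>0 i\<bar>)"
        using i by (intro member_le_sum) auto
      also have "\<dots> \<le> real (2 * m) * \<rho> N / c"
        unfolding step
        by (rule least_squares_error[where c=c and d="2*m" and a="1 / real N" and T="{int m + 1..int N}"
              and \<phi>="arx_phi m yh uh" and y=yh and \<theta>=\<theta>0 and \<rho>="\<rho> N", OF c pe rho])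
      finally show "norm (vec_index (sm_step N (nN N) m (\<eta> N) ?ud (\<theta> N)) i - \<theta>0 i) \<le> real (2 * m) * \<rho> N / c"
        by (simp add: n_def)
    qed
  qed
  then show ?thesis by (simp add: LIM_zero_iff)
qed

text \<open>Convergence of the first m coordinates of an iterate is l1 convergence of its
  denominator to Fo, and 1/Fo is in l1 by stability and coprimality; this is what the next step
  requires.\<close>

lemma morsm_LIMSEQ:
  assumes \<delta>': "0 < \<delta>'" "\<delta>' < pe_const" and i: "i < 2 * m"
  shows "(\<lambda>N. vec_index (morsm \<delta>' N (nN N) m y u k) i) \<longlonglongrightarrow> \<theta>0 i"
proof -
  note AB = AB_LIMSEQ[OF eta_LIMSEQ[OF \<delta>']]
  show ?thesis
    using i
  proof (induction k arbitrary: i)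
    case 0
    have "delay m (\<lambda>k. vec_index (0\<^sub>v (2 * m)) k) = (0 :: real fps)"
      by (rule fps_ext) (auto simp: delay_nth)
    \<comment> \<open>The zero parameter vector encodes the unfiltered start.\<close>
    then have F1: "fps_of_poly (polyF m (0\<^sub>v (2 * m))) = 1" by (simp add: polyF_fps)
    show ?case unfolding morsm.simps
      by (rule sm_step_LIMSEQ[OF AB, where F = 1]) (use 0 F1 in auto)
  next
    case (Suc k)
    let ?\<theta> = "\<lambda>N. morsm \<delta>' N (nN N) m y u k"
    have "norm1 (fps_of_poly (polyF m (?\<theta> N)) - fps_of_poly Fo) = (\<Sum>i<m. \<bar>vec_index (?\<theta> N) i - \<theta>0 i\<bar>)" for N
    proof -
      have "fps_of_poly (polyF m (?\<theta> N)) - fps_of_poly Fo = delay m (\<lambda>k. vec_index (?\<theta> N) k) - delay m (\<lambda>i. coeff Fo (Suc i))"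
        unfolding polyF_fps delay_poly[OF Fo0 dFo, symmetric] by simp
      then show ?thesis unfolding delay_diff by (simp add: norm1_delay \<theta>0_def)
    qed
    moreover have "(\<lambda>N. \<Sum>i<m. \<bar>vec_index (?\<theta> N) i - \<theta>0 i\<bar>) \<longlonglongrightarrow> (\<Sum>i<m. 0)"
      by (intro tendsto_sum tendsto_rabs_zero LIM_zero Suc.IH) auto
    ultimately have FN: "(\<lambda>N. norm1 (fps_of_poly (polyF m (?\<theta> N)) - fps_of_poly Fo)) \<longlonglongrightarrow> 0" by simp
    show ?case unfolding morsm.simps
      by (rule sm_step_LIMSEQ[OF AB FN]) (use Suc.prems Fo0 wl1_imp_l1[OF wl1_iF] in auto)
  qed
qed

end

section \<open>Sample covariances of the innovations\<close>

lemma exp_le_quadratic: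
  fixes x :: real
  assumes "\<bar>x\<bar> \<le> 1"
  shows "exp x \<le> 1 + x + x\<^sup>2"
proof (cases "x \<ge> 0")
  case True
  then show ?thesis using assms exp_bound[of x] by simp
next
  case False
  define y where "y = - x"
  have y: "y > 0" using False by (simp add: y_def)
  \<comment> \<open>The product equals 1 + y^3; afterwards 1 + y is replaced by the larger exp
    y.\<close>
  have "1 \<le> (1 - y + y\<^sup>2) * (1 + y)"
    using y by (simp add: power2_eq_square algebra_simps)
  also have "\<dots> \<le> (1 - y + y\<^sup>2) * exp y"
    using exp_ge_add_one_self[of y] sum_power2_ge_zero[of "y - 1" 0] y zero_le_power2[of "y - 1/2"]
    by (intro mult_left_mono) (auto simp: power2_eq_square algebra_simps)
  finally have "1 / exp y \<le> 1 - y + y\<^sup>2" by (simp add: pos_divide_le_eq)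
  then show ?thesis by (simp add: y_def exp_minus inverse_eq_divide)
qed

lemma power_le_exp_mult: "0 \<le> p \<Longrightarrow> p \<le> exp q \<Longrightarrow> p ^ n \<le> exp (real n * q)"
  by (simp add: exp_of_nat_mult power_mono)

section \<open>An Azuma bound for sums of bounded differences\<close>

context prob_space
begin

text \<open>Orthogonality to the exponentials of the past is all that the exponential moment bound
  needs of the martingale difference property.\<close>
lemma azuma_mgf:
  fixes d :: "nat \<Rightarrow> 'a \<Rightarrow> real"
  assumes meas [measurable]: "\<And>t. d t \<in> borel_measurable M"
    and bd: "\<And>t x. x \<in> space M \<Longrightarrow> \<bar>d t x\<bar> \<le> c"
    and orth: "\<And>t. expectation (\<lambda>x. exp (l * (\<Sum>r<t. d r x)) * d t x) = 0"
    and small: "\<bar>l\<bar> * c \<le> 1"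
  shows "expectation (\<lambda>x. exp (l * (\<Sum>r<t. d r x))) \<le> (1 + (l * c)\<^sup>2) ^ t"
    and "integrable M (\<lambda>x. exp (l * (\<Sum>r<t. d r x)))"
proof -
  have c0: "c \<ge> 0" using not_empty bd[of _ 0] by (meson abs_ge_zero ex_in_conv order_trans)
  have S: "\<bar>l * (\<Sum>r<t. d r x)\<bar> \<le> real t" if x: "x \<in> space M" for t x
  proof -
    have "\<bar>l * (\<Sum>r<t. d r x)\<bar> \<le> \<bar>l\<bar> * (\<Sum>r<t. \<bar>d r x\<bar>)"
      unfolding abs_mult by (intro mult_left_mono sum_abs) auto
    also have "\<dots> \<le> \<bar>l\<bar> * (real t * c)"
      using sum_bounded_above[of "{..<t}" "\<lambda>r. \<bar>d r x\<bar>" c] bd[OF x] by (intro mult_left_mono) auto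
    also have "\<dots> \<le> real t" using mult_left_mono[OF small, of "real t"] by (simp add: mult_ac)
    finally show ?thesis .
  qed
  have int: "integrable M (\<lambda>x. exp (l * (\<Sum>r<t. d r x)))" for t
    by (rule integrable_const_bound[where B="exp (real t)"]) (use S in \<open>auto simp: abs_le_iff\<close>)
  have int_d: "integrable M (\<lambda>x. exp (l * (\<Sum>r<t. d r x)) * d t x)" for t
  proof (rule integrable_const_bound[where B="exp (real t) * c"])
    show "AE x in M. norm (exp (l * (\<Sum>r<t. d r x)) * d t x) \<le> exp (real t) * c"
    proof (rule AE_I2)
      fix x assume x: "x \<in> space M"
      show "norm (exp (l * (\<Sum>r<t. d r x)) * d t x) \<le> exp (real t) * c"
        unfolding norm_mult using S[OF x, of t] bd[OF x, of t] by (intro mult_mono) auto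
    qed
  qed simp
  show "integrable M (\<lambda>x. exp (l * (\<Sum>r<t. d r x)))" by (rule int)
  show "expectation (\<lambda>x. exp (l * (\<Sum>r<t. d r x))) \<le> (1 + (l * c)\<^sup>2) ^ t"
  proof (induction t)
    case 0
    then show ?case by (simp add: prob_space)
  next
    case (Suc t)
    let ?E = "\<lambda>x. exp (l * (\<Sum>r<t. d r x))"
    \<comment> \<open>Applies exp s <= 1 + s + s^2 to the newest difference: the linear term
      integrates to 0 by \<open>orth\<close>, so each step contributes a factor of at most 1 + (l
      c)^2.\<close>
    have "expectation (\<lambda>x. exp (l * (\<Sum>r<Suc t. d r x))) \<le>
        expectation (\<lambda>x. (1 + (l * c)\<^sup>2) * ?E x + l * (?E x * d t x))"
    proof (rule integral_mono)
      show "integrable M (\<lambda>x. exp (l * (\<Sum>r<Suc t. d r x)))" by (rule int)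
      show "integrable M (\<lambda>x. (1 + (l * c)\<^sup>2) * ?E x + l * (?E x * d t x))"
        by (intro Bochner_Integration.integrable_add integrable_mult_right int int_d)
      fix x assume x: "x \<in> space M"
      have dt: "\<bar>l * d t x\<bar> \<le> \<bar>l * c\<bar>" using bd[OF x, of t] c0 by (auto simp: abs_mult intro: mult_left_mono)
      also have "\<dots> \<le> 1" using small c0 by (simp add: abs_mult)
      finally have "exp (l * d t x) \<le> 1 + l * d t x + (l * d t x)\<^sup>2" by (rule exp_le_quadratic)
      also have "(l * d t x)\<^sup>2 \<le> (l * c)\<^sup>2" using dt by (simp add: abs_le_square_iff)
      finally have "?E x * exp (l * d t x) \<le> ?E x * (1 + l * d t x + (l * c)\<^sup>2)"
        by (intro mult_left_mono) auto
      then show "exp (l * (\<Sum>r<Suc t. d r x)) \<le> (1 + (l * c)\<^sup>2) * ?E x + l * (?E x * d t x)"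
        by (simp add: distrib_left exp_add algebra_simps)
    qed
    also have "\<dots> = (1 + (l * c)\<^sup>2) * expectation ?E + l * expectation (\<lambda>x. ?E x * d t x)"
      by (subst Bochner_Integration.integral_add) (auto intro: int int_d)
    also have "\<dots> \<le> (1 + (l * c)\<^sup>2) * (1 + (l * c)\<^sup>2) ^ t"
      unfolding orth using Suc by (auto intro: mult_left_mono)
    finally show ?case by simp
  qed
qed

lemma azuma_upper:
  fixes d :: "nat \<Rightarrow> 'a \<Rightarrow> real"
  assumes meas [measurable]: "\<And>t. d t \<in> borel_measurable M"
    and bd: "\<And>t x. x \<in> space M \<Longrightarrow> \<bar>d t x\<bar> \<le> c"
    and orth: "\<And>l t. expectation (\<lambda>x. exp (l * (\<Sum>r<t. d r x)) * d t x) = 0"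
    and c: "c > 0" and eps: "0 < \<epsilon>" "\<epsilon> \<le> 2 * c"
  shows "prob {x\<in>space M. \<epsilon> * real N \<le> (\<Sum>r<N. d r x)} \<le> exp (- real N * \<epsilon>\<^sup>2 / (4 * c\<^sup>2))"
proof -
  \<comment> \<open>Minimises the Chernoff exponent (l c)^2 - l \<epsilon>; the restriction
    \<epsilon> <= 2c is exactly l c <= 1.\<close>
  define l where "l = \<epsilon> / (2 * c\<^sup>2)"
  have l: "l > 0" using eps c by (simp add: l_def)
  have small: "\<bar>l\<bar> * c \<le> 1" using eps c by (simp add: l_def power2_eq_square field_simps)
  note mgf = azuma_mgf[OF meas bd orth small]
  have "prob {x\<in>space M. \<epsilon> * real N \<le> (\<Sum>r<N. d r x)} =
      prob {x\<in>space M. exp (l * (\<epsilon> * real N)) \<le> exp (l * (\<Sum>r<N. d r x))}"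
    using l by simp
  also have "\<dots> \<le> expectation (\<lambda>x. exp (l * (\<Sum>r<N. d r x))) / exp (l * (\<epsilon> * real N))"
    by (rule integral_Markov_inequality_measure[where A = "{}"]) (use mgf in auto)
  also have "\<dots> \<le> (1 + (l * c)\<^sup>2) ^ N / exp (l * (\<epsilon> * real N))"
    using mgf by (intro divide_right_mono) auto
  also have "\<dots> \<le> exp (real N * (l * c)\<^sup>2) / exp (l * (\<epsilon> * real N))"
    by (intro divide_right_mono power_le_exp_mult) auto
  also have "\<dots> = exp (real N * ((l * c)\<^sup>2 - l * \<epsilon>))"
    by (simp add: exp_diff algebra_simps)
  also have "(l * c)\<^sup>2 - l * \<epsilon> = - \<epsilon>\<^sup>2 / (4 * c\<^sup>2)"
    using c by (simp add: l_def power2_eq_square field_simps)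
  finally show ?thesis by simp
qed

lemma azuma:
  fixes d :: "nat \<Rightarrow> 'a \<Rightarrow> real"
  assumes meas [measurable]: "\<And>t. d t \<in> borel_measurable M"
    and bd: "\<And>t x. x \<in> space M \<Longrightarrow> \<bar>d t x\<bar> \<le> c"
    and orth: "\<And>l t. expectation (\<lambda>x. exp (l * (\<Sum>r<t. d r x)) * d t x) = 0"
    and c: "c > 0" and eps: "0 < \<epsilon>" "\<epsilon> \<le> 2 * c"
  shows "prob {x\<in>space M. \<epsilon> * real N \<le> \<bar>\<Sum>r<N. d r x\<bar>} \<le> 2 * exp (- real N * \<epsilon>\<^sup>2 / (4 * c\<^sup>2))"
proof -
  have orth': "expectation (\<lambda>x. exp (l * (\<Sum>r<t. - d r x)) * - d t x) = 0" for l t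
    using orth[of "- l" t] by (simp add: sum_negf)
  have 2: "prob {x\<in>space M. \<epsilon> * real N \<le> (\<Sum>r<N. - d r x)} \<le> exp (- real N * \<epsilon>\<^sup>2 / (4 * c\<^sup>2))"
    by (rule azuma_upper[where d = "\<lambda>t x. - d t x", OF _ _ orth' c eps]) (use bd in auto)
  have "{x\<in>space M. \<epsilon> * real N \<le> \<bar>\<Sum>r<N. d r x\<bar>} =
      {x\<in>space M. \<epsilon> * real N \<le> (\<Sum>r<N. d r x)} \<union> {x\<in>space M. \<epsilon> * real N \<le> (\<Sum>r<N. - d r x)}"
    by (auto simp: sum_negf abs_real_def split: if_splits) 
  also have "prob \<dots> \<le> prob {x\<in>space M. \<epsilon> * real N \<le> (\<Sum>r<N. d r x)} + prob {x\<in>space M. \<epsilon> * real N \<le> (\<Sum>r<N. - d r x)}"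
    by (rule measure_Un_le) measurable
  also have "\<dots> \<le> 2 * exp (- real N * \<epsilon>\<^sup>2 / (4 * c\<^sup>2))"
    using azuma_upper[OF meas bd orth c eps, of N] 2 by simp
  finally show ?thesis .
qed

text \<open>Pulls the bounded past factor f out of the conditional expectation. It serves
  conditional means with k = 0 and conditional variances with k =
  \<open>\<sigma>\<^sup>2\<close>.\<close>

lemma orth_of_cond_exp_const:
  fixes f g :: "'a \<Rightarrow> real"
  assumes sub: "subalgebra M F" and f [measurable]: "f \<in> borel_measurable F" and g [measurable]: "g \<in> borel_measurable M"
    and fb: "\<And>x. x \<in> space M \<Longrightarrow> \<bar>f x\<bar> \<le> K" and gb: "\<And>x. x \<in> space M \<Longrightarrow> \<bar>g x\<bar> \<le> L"
    and ce: "AE x in M. real_cond_exp M F g x = k"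
  shows "expectation (\<lambda>x. f x * g x) = expectation (\<lambda>x. f x * k)"
proof -
  interpret F: finite_measure_subalgebra M F by standard (rule sub)
  have fM [measurable]: "f \<in> borel_measurable M" by (rule measurable_from_subalg[OF sub f])
  have int: "integrable M (\<lambda>x. f x * g x)"
  proof (rule integrable_const_bound[where B="K * L"])
    show "AE x in M. norm (f x * g x) \<le> K * L"
    proof (rule AE_I2)
      fix x assume x: "x \<in> space M"
      show "norm (f x * g x) \<le> K * L"
        unfolding norm_mult using fb[OF x] gb[OF x] by (intro mult_mono) auto
    qed
  qed simp
  have "expectation (\<lambda>x. f x * g x) = expectation (\<lambda>x. f x * real_cond_exp M F g x)"
    by (rule F.real_cond_exp_intg(2)[OF int f g, symmetric])
  also have "\<dots> = expectation (\<lambda>x. f x * k)"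
    using ce by (intro integral_cong_AE) auto
  finally show ?thesis .
qed

end

section \<open>The sigma-algebra of the past\<close>

lemma space_past_sigma [simp]: "space (past_sigma M e w t) = space M"
  by (simp add: past_sigma_def space_measure_of_conv)

lemma sets_past_sigma: "sets (past_sigma M e w t) = sigma_sets (space M)
     (\<Union>s\<in>{..<t}. {e s -` A \<inter> space M | A. A \<in> sets borel} \<union> {w s -` A \<inter> space M | A. A \<in> sets borel})"
  unfolding past_sigma_def by (rule sets_measure_of) auto

lemma subalgebra_past_sigma:
  assumes "\<And>t. e t \<in> borel_measurable M" "\<And>t. w t \<in> borel_measurable M"
  shows "subalgebra M (past_sigma M e w t)"
  unfolding subalgebra_def sets_past_sigma
  using assms by (auto intro!: sets.sigma_sets_subset measurable_sets)

lemma measurable_past_sigma: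
  assumes "s < t"
  shows "e s \<in> borel_measurable (past_sigma M e w t)" "w s \<in> borel_measurable (past_sigma M e w t)"
proof -
  show "e s \<in> borel_measurable (past_sigma M e w t)"
    by (rule measurableI) (use assms in \<open>auto intro!: sigma_sets.Basic simp: sets_past_sigma\<close>)
  show "w s \<in> borel_measurable (past_sigma M e w t)"
    by (rule measurableI) (use assms in \<open>auto intro!: sigma_sets.Basic simp: sets_past_sigma\<close>)
qed

lemma sum_int_interval: "(\<Sum>t\<in>{1..int N}. f t) = (\<Sum>r<N. f (int r + 1))"
proof -
  have "{1..int N} = (\<lambda>r. int r + 1) ` {..<N}"
  proof safe
    fix x assume "x \<in> {1..int N}"
    then show "x \<in> (\<lambda>r. int r + 1) ` {..<N}" by (intro image_eqI[of _ _ "nat (x - 1)"]) auto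
  qed auto
  then show ?thesis by (simp add: sum.reindex inj_on_def)
qed

section \<open>Innovation products as martingale differences, and almost sure convergence of sample
  covariances\<close>

context prob_space
begin

text \<open>Conditionally on the whole path of \<open>e\<close>, the process \<open>w\<close> is still a martingale difference
  sequence, by independence; this handles the products \<open>w s * e s\<close> at equal times.\<close>
lemma cross_orth:
  fixes e w :: "int \<Rightarrow> 'a \<Rightarrow> real"
  assumes indep: "indep_var (Pi\<^sub>M UNIV (\<lambda>_. borel)) (\<lambda>x s. w s x) (Pi\<^sub>M UNIV (\<lambda>_. borel)) (\<lambda>x s. e s x)"
    and meas [measurable]: "\<And>t. e t \<in> borel_measurable M" "\<And>t. w t \<in> borel_measurable M"
    and wb: "\<And>t x. x \<in> space M \<Longrightarrow> \<bar>w t x\<bar> \<le> B"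
    and eb: "\<And>t x. x \<in> space M \<Longrightarrow> \<bar>e t x\<bar> \<le> B"
    and w_mean: "AE x in M. real_cond_exp M (past_sigma M e w s) (w s) x = 0"
    and T: "finite T" "\<And>r. r \<in> T \<Longrightarrow> r < s"
  shows "expectation (\<lambda>x. exp (l * (\<Sum>r\<in>T. w r x * e r x)) * (w s x * e s x)) = 0"
proof -
  let ?P = "Pi\<^sub>M UNIV (\<lambda>_::int. borel :: real measure)"
  let ?X = "\<lambda>x s. w s x" and ?Y = "\<lambda>x s. e s x"
  define f :: "(int \<Rightarrow> real) \<times> (int \<Rightarrow> real) \<Rightarrow> real"
    where "f p = exp (l * (\<Sum>r\<in>T. fst p r * snd p r)) * (fst p s * snd p s)" for p
  have X [measurable]: "?X \<in> measurable M ?P" and Y [measurable]: "?Y \<in> measurable M ?P"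
    and eq: "distr M ?P ?X \<Otimes>\<^sub>M distr M ?P ?Y = distr M (?P \<Otimes>\<^sub>M ?P) (\<lambda>x. (?X x, ?Y x))"
    using indep unfolding indep_var_distribution_eq by auto
  interpret PX: prob_space "distr M ?P ?X" by (rule prob_space_distr) (rule X)
  interpret PY: prob_space "distr M ?P ?Y" by (rule prob_space_distr) (rule Y)
  interpret PXY: pair_prob_space "distr M ?P ?X" "distr M ?P ?Y" ..
  have fm [measurable]: "f \<in> borel_measurable (?P \<Otimes>\<^sub>M ?P)"
    unfolding f_def by measurable
  have int: "integrable M (\<lambda>x. f (?X x, ?Y x))"
  proof (rule integrable_const_bound[where B="exp (\<bar>l\<bar> * (\<Sum>r\<in>T. B * B)) * (B * B)"])
    show "AE x in M. norm (f (?X x, ?Y x)) \<le> exp (\<bar>l\<bar> * (\<Sum>r\<in>T. B * B)) * (B * B)"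
    proof (rule AE_I2)
      fix x assume x: "x \<in> space M"
      have B: "0 \<le> B" using wb[OF x, of 0] by linarith
      have we: "\<bar>w r x * e r x\<bar> \<le> B * B" for r
        unfolding abs_mult using wb[OF x] eb[OF x] B by (intro mult_mono) auto
      have "l * (\<Sum>r\<in>T. w r x * e r x) \<le> \<bar>l\<bar> * (\<Sum>r\<in>T. \<bar>w r x * e r x\<bar>)"
        using abs_ge_self[of "l * (\<Sum>r\<in>T. w r x * e r x)"] sum_abs[of "\<lambda>r. w r x * e r x" T]
        unfolding abs_mult[of l] by (meson abs_ge_zero mult_left_mono order_trans)
      also have "\<dots> \<le> \<bar>l\<bar> * (\<Sum>r\<in>T. B * B)" using we by (intro mult_left_mono sum_mono) auto
      finally show "norm (f (?X x, ?Y x)) \<le> exp (\<bar>l\<bar> * (\<Sum>r\<in>T. B * B)) * (B * B)"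
        unfolding f_def norm_mult[of "exp _"] using we[of s] by (intro mult_mono) auto
    qed
  qed measurable
  have int': "integrable (distr M ?P ?X \<Otimes>\<^sub>M distr M ?P ?Y) f"
    unfolding eq by (subst integrable_distr_eq) (use int in auto)
  \<comment> \<open>For a frozen path of e the exponential weight depends only on w r with r < s, so
    it is measurable with respect to the past and \<open>w_mean\<close> applies.\<close>
  have inner: "(\<integral>\<omega>. f (\<omega>, \<epsilon>) \<partial>distr M ?P ?X) = 0" for \<epsilon>
  proof -
    have "(\<integral>\<omega>. f (\<omega>, \<epsilon>) \<partial>distr M ?P ?X) = expectation (\<lambda>x. exp (l * (\<Sum>r\<in>T. w r x * \<epsilon> r)) * (w s x * \<epsilon> s))"
      by (subst integral_distr) (auto simp: f_def)
    also have "\<dots> = \<epsilon> s * expectation (\<lambda>x. exp (l * (\<Sum>r\<in>T. w r x * \<epsilon> r)) * w s x)"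
      by (subst integral_mult_right_zero[symmetric]) (simp add: mult_ac)
    also have "expectation (\<lambda>x. exp (l * (\<Sum>r\<in>T. w r x * \<epsilon> r)) * w s x) =
        expectation (\<lambda>x. exp (l * (\<Sum>r\<in>T. w r x * \<epsilon> r)) * 0)"
    proof (rule orth_of_cond_exp_const[OF subalgebra_past_sigma[OF meas] _ meas(2) _ wb w_mean])
      have [measurable]: "w r \<in> borel_measurable (past_sigma M e w s)" if "r \<in> T" for r
        using measurable_past_sigma(2)[OF T(2)[OF that]] .
      show "(\<lambda>x. exp (l * (\<Sum>r\<in>T. w r x * \<epsilon> r))) \<in> borel_measurable (past_sigma M e w s)"
        by measurable
      fix x assume x: "x \<in> space M"
      have "l * (\<Sum>r\<in>T. w r x * \<epsilon> r) \<le> \<bar>l\<bar> * (\<Sum>r\<in>T. \<bar>w r x * \<epsilon> r\<bar>)"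
        using abs_ge_self[of "l * (\<Sum>r\<in>T. w r x * \<epsilon> r)"] sum_abs[of "\<lambda>r. w r x * \<epsilon> r" T]
        unfolding abs_mult[of l] by (meson abs_ge_zero mult_left_mono order_trans)
      also have "\<dots> \<le> \<bar>l\<bar> * (\<Sum>r\<in>T. B * \<bar>\<epsilon> r\<bar>)"
        unfolding abs_mult using wb[OF x] by (intro mult_left_mono sum_mono mult_right_mono) auto
      finally show "\<bar>exp (l * (\<Sum>r\<in>T. w r x * \<epsilon> r))\<bar> \<le> exp (\<bar>l\<bar> * (\<Sum>r\<in>T. B * \<bar>\<epsilon> r\<bar>))" by simp
    qed
    finally show ?thesis by simp
  qed
  have "expectation (\<lambda>x. f (?X x, ?Y x)) = integral\<^sup>L (distr M (?P \<Otimes>\<^sub>M ?P) (\<lambda>x. (?X x, ?Y x))) f"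
    by (subst integral_distr) auto
  also have "\<dots> = integral\<^sup>L (distr M ?P ?X \<Otimes>\<^sub>M distr M ?P ?Y) (case_prod (\<lambda>\<omega> \<epsilon>. f (\<omega>, \<epsilon>)))"
    unfolding eq by simp
  \<comment> \<open>Under the product law Fubini allows w to be integrated first, with e held
    fixed.\<close>
  also have "\<dots> = (\<integral>\<epsilon>. (\<integral>\<omega>. f (\<omega>, \<epsilon>) \<partial>distr M ?P ?X) \<partial>distr M ?P ?Y)"
    by (rule PXY.integral_snd[symmetric]) (use int' in simp)
  also have "\<dots> = 0" by (simp add: inner)
  finally show ?thesis by (simp add: f_def)
qed

text \<open>The later factor of a centred product is conditioned on its own past. At distinct lags
  everything else is measurable there and the conditional mean vanishes; for the same process at the
  same time the conditional variance cancels the centring; distinct processes at the same time need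
  independence.\<close>

lemma cov_orth:
  fixes e w :: "int \<Rightarrow> 'a \<Rightarrow> real" and z :: "bool \<Rightarrow> int \<Rightarrow> 'a \<Rightarrow> real"
  assumes indep: "indep_var (Pi\<^sub>M UNIV (\<lambda>_. borel)) (\<lambda>x s. w s x) (Pi\<^sub>M UNIV (\<lambda>_. borel)) (\<lambda>x s. e s x)"
    and meas [measurable]: "\<And>t. e t \<in> borel_measurable M" "\<And>t. w t \<in> borel_measurable M"
    and wb: "\<And>t x. x \<in> space M \<Longrightarrow> \<bar>w t x\<bar> \<le> B"
    and eb: "\<And>t x. x \<in> space M \<Longrightarrow> \<bar>e t x\<bar> \<le> B"
    and mean: "\<And>t. AE x in M. real_cond_exp M (past_sigma M e w t) (w t) x = 0"
      "\<And>t. AE x in M. real_cond_exp M (past_sigma M e w t) (e t) x = 0"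
    and var: "\<And>t. AE x in M. real_cond_exp M (past_sigma M e w t) (\<lambda>x. (w t x)\<^sup>2) x = \<sigma>\<^sup>2"
      "\<And>t. AE x in M. real_cond_exp M (past_sigma M e w t) (\<lambda>x. (e t x)\<^sup>2) x = \<sigma>\<^sup>2"
    and z: "\<And>b. z b = (if b then w else e)"
  defines "d \<equiv> \<lambda>a b i j r x. z a (int r + 1 - int i) x * z b (int r + 1 - int j) x - (if a = b \<and> i = j then \<sigma>\<^sup>2 else 0)"
  shows "expectation (\<lambda>x. exp (l * (\<Sum>r<t. d a b i j r x)) * d a b i j t x) = 0"
proof -
  have zm [measurable]: "z b t \<in> borel_measurable M" for b t using z by simp
  have zp: "z b s \<in> borel_measurable (past_sigma M e w t)" if "s < t" for b s t
    using measurable_past_sigma(1)[OF that, of e M w] measurable_past_sigma(2)[OF that, of w M e] by (simp add: z)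
  have zb: "\<bar>z b t x\<bar> \<le> B" if "x \<in> space M" for b t x using wb[OF that] eb[OF that] by (simp add: z)
  have zmean: "AE x in M. real_cond_exp M (past_sigma M e w t) (z b t) x = 0" for b t
    using mean by (simp add: z)
  have zvar: "AE x in M. real_cond_exp M (past_sigma M e w t) (\<lambda>x. (z b t x)\<^sup>2) x = \<sigma>\<^sup>2" for b t
    using var by (simp add: z)
  note sub = subalgebra_past_sigma[of e M w, OF meas]
  have B: "B \<ge> 0" using not_empty wb[of _ 0] by (meson abs_ge_zero ex_in_conv order_trans)
  have db: "\<bar>d a b i j r x\<bar> \<le> B * B + \<sigma>\<^sup>2" if x: "x \<in> space M" for a b i j r x
  proof -
    have "\<bar>z a s x * z b s' x\<bar> \<le> B * B" for s s'
      unfolding abs_mult using zb[OF x] B by (intro mult_mono) auto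
    moreover have "\<bar>d a b i j r x\<bar> \<le> \<bar>z a (int r + 1 - int i) x * z b (int r + 1 - int j) x\<bar> + \<sigma>\<^sup>2"
      unfolding d_def using abs_triangle_ineq4[of "z a (int r + 1 - int i) x * z b (int r + 1 - int j) x" "if a = b \<and> i = j then \<sigma>\<^sup>2 else 0"]
      by (auto split: if_splits)
    ultimately show ?thesis by (meson add_right_mono order_trans)
  qed
  have Eb: "\<bar>exp (l * (\<Sum>r<t. d a b i j r x))\<bar> \<le> exp (\<bar>l\<bar> * (real t * (B * B + \<sigma>\<^sup>2)))" if x: "x \<in> space M" for a b i j x
  proof -
    have "l * (\<Sum>r<t. d a b i j r x) \<le> \<bar>l\<bar> * (\<Sum>r<t. \<bar>d a b i j r x\<bar>)"
      using abs_ge_self[of "l * (\<Sum>r<t. d a b i j r x)"] sum_abs[of "\<lambda>r. d a b i j r x" "{..<t}"]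
      unfolding abs_mult by (meson abs_ge_zero mult_left_mono order_trans)
    also have "\<dots> \<le> \<bar>l\<bar> * (real t * (B * B + \<sigma>\<^sup>2))"
      using sum_bounded_above[of "{..<t}" "\<lambda>r. \<bar>d a b i j r x\<bar>" "B * B + \<sigma>\<^sup>2"] db[OF x] by (intro mult_left_mono) auto
    finally show ?thesis by simp
  qed
  \<comment> \<open>The case of \<open>z a\<close> being the later factor; swapping the two factors
    reduces the opposite order of lags to it.\<close>
  have lt: "expectation (\<lambda>x. exp (l * (\<Sum>r<t. d a b i j r x)) * d a b i j t x) = 0" if ij: "i < j" for a b i j
  proof -
    let ?s = "int t + 1 - int i"
    have [measurable]: "z a (int r + 1 - int i) \<in> borel_measurable (past_sigma M e w ?s)"
      "z b (int r + 1 - int j) \<in> borel_measurable (past_sigma M e w ?s)" if "r < t" for r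
      using that ij by (auto intro!: zp)
    have [measurable]: "z b (int t + 1 - int j) \<in> borel_measurable (past_sigma M e w ?s)"
      using ij by (auto intro!: zp)
    have "expectation (\<lambda>x. (exp (l * (\<Sum>r<t. d a b i j r x)) * z b (int t + 1 - int j) x) * z a ?s x) =
      expectation (\<lambda>x. (exp (l * (\<Sum>r<t. d a b i j r x)) * z b (int t + 1 - int j) x) * 0)"
    proof (rule orth_of_cond_exp_const[OF sub _ zm _ zb zmean])
      show "(\<lambda>x. exp (l * (\<Sum>r<t. d a b i j r x)) * z b (int t + 1 - int j) x) \<in> borel_measurable (past_sigma M e w ?s)"
        unfolding d_def by measurable
      show "\<bar>exp (l * (\<Sum>r<t. d a b i j r x)) * z b (int t + 1 - int j) x\<bar> \<le> exp (\<bar>l\<bar> * (real t * (B * B + \<sigma>\<^sup>2))) * B"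
        if x: "x \<in> space M" for x
        unfolding abs_mult[of "exp _"] using Eb[OF x] zb[OF x] by (intro mult_mono) auto
    qed
    then show ?thesis using ij by (simp add: d_def mult_ac)
  qed
  consider "i < j" | "j < i" | "i = j" "a = b" | "i = j" "a \<noteq> b" by linarith
  then show ?thesis
  proof cases
    case 1
    then show ?thesis by (rule lt)
  next
    case 2
    have "d a b i j = d b a j i" unfolding d_def by (intro ext) auto
    then show ?thesis using lt[OF 2, of b a] by simp
  next
    case 3
    let ?s = "int t + 1 - int i"
    let ?E = "\<lambda>x. exp (l * (\<Sum>r<t. d a b i j r x))"
    have [measurable]: "z a (int r + 1 - int i) \<in> borel_measurable (past_sigma M e w ?s)" if "r < t" for r
      using that by (auto intro!: zp)
    have d3: "d a b i j = (\<lambda>r x. z a (int r + 1 - int i) x * z a (int r + 1 - int i) x - \<sigma>\<^sup>2)"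
      using 3 unfolding d_def by (intro ext) simp
    have Em: "?E \<in> borel_measurable (past_sigma M e w ?s)"
      unfolding d3 by measurable
    have EM [measurable]: "?E \<in> borel_measurable M" by (rule measurable_from_subalg[OF sub Em])
    have sq: "\<bar>(z a ?s x)\<^sup>2\<bar> \<le> B * B" if x: "x \<in> space M" for x
      using mult_mono[OF zb[OF x, of a ?s] zb[OF x, of a ?s]] B by (simp add: power2_eq_square)
    have eq: "expectation (\<lambda>x. ?E x * (z a ?s x)\<^sup>2) = expectation (\<lambda>x. ?E x * \<sigma>\<^sup>2)"
      by (rule orth_of_cond_exp_const[OF sub Em _ Eb sq zvar]) auto
    have i1: "integrable M ?E"
      by (rule integrable_const_bound[where B = "exp (\<bar>l\<bar> * (real t * (B * B + \<sigma>\<^sup>2)))"]) (use Eb in \<open>auto intro!: AE_I2\<close>)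
    have i2: "integrable M (\<lambda>x. ?E x * (z a ?s x)\<^sup>2)"
      by (rule Bochner_Integration.integrable_bound[where f = "\<lambda>x. ?E x * (B * B)"])
        (use sq B i1 in \<open>auto simp: abs_mult intro!: mult_left_mono\<close>)
    have "expectation (\<lambda>x. ?E x * d a b i j t x) = expectation (\<lambda>x. ?E x * (z a ?s x)\<^sup>2 - ?E x * \<sigma>\<^sup>2)"
      by (intro Bochner_Integration.integral_cong refl) (simp add: d3 power2_eq_square right_diff_distrib)
    also have "\<dots> = 0"
      by (subst Bochner_Integration.integral_diff) (use i1 i2 eq in auto)
    finally show ?thesis .
  next
    case 4
    \<comment> \<open>The conditional means of w and e separately do not determine that of their
      product at the same time, hence the recourse to \<open>cross_orth\<close>.\<close>
    let ?T = "(\<lambda>r. int r + 1 - int i) ` {..<t}"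
    have d: "d a b i j r x = w (int r + 1 - int i) x * e (int r + 1 - int i) x" for r x
      using 4 by (cases a; cases b) (auto simp: d_def z)
    have "expectation (\<lambda>x. exp (l * (\<Sum>r\<in>?T. w r x * e r x)) * (w (int t + 1 - int i) x * e (int t + 1 - int i) x)) = 0"
      by (rule cross_orth[OF indep meas wb eb mean(1)]) auto
    then show ?thesis by (simp add: d sum.reindex inj_on_def)
  qed
qed

text \<open>The factor 8 (2N+1)^2 counts four choices of processes, at most (2N+1)^2 pairs of lags
  and two for the two-sided deviation; the exponent 1/3 is 1 - 2/3.\<close>

lemma summable_union_bound:
  assumes "a > 0"
  shows "summable (\<lambda>N. 8 * (2 * real N + 1)\<^sup>2 * exp (- a * real N powr (1/3)))"
proof (rule summable_comparison_test_bigo)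
  show "summable (\<lambda>N. norm (1 / (real N)\<^sup>2))"
    using inverse_power_summable[of 2, where 'a = real] by (simp add: field_simps)
  show "(\<lambda>N. 8 * (2 * real N + 1)\<^sup>2 * exp (- a * real N powr (1/3))) \<in> O(\<lambda>N. 1 / (real N)\<^sup>2)"
    using assms by real_asymp
qed

text \<open>The number of lags grows with N, so a separate law of large numbers for each pair would
  not do: for each N one event unites the deviations at all lags, and Borel-Cantelli runs over
  N.\<close>

lemma cov_AE:
  fixes e w :: "int \<Rightarrow> 'a \<Rightarrow> real" and z :: "bool \<Rightarrow> int \<Rightarrow> 'a \<Rightarrow> real" and nN :: "nat \<Rightarrow> nat"
  assumes indep: "indep_var (Pi\<^sub>M UNIV (\<lambda>_. borel)) (\<lambda>x s. w s x) (Pi\<^sub>M UNIV (\<lambda>_. borel)) (\<lambda>x s. e s x)"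
    and meas [measurable]: "\<And>t. e t \<in> borel_measurable M" "\<And>t. w t \<in> borel_measurable M"
    and wb: "\<And>t x. x \<in> space M \<Longrightarrow> \<bar>w t x\<bar> \<le> B"
    and eb: "\<And>t x. x \<in> space M \<Longrightarrow> \<bar>e t x\<bar> \<le> B"
    and mean: "\<And>t. AE x in M. real_cond_exp M (past_sigma M e w t) (w t) x = 0"
      "\<And>t. AE x in M. real_cond_exp M (past_sigma M e w t) (e t) x = 0"
    and var: "\<And>t. AE x in M. real_cond_exp M (past_sigma M e w t) (\<lambda>x. (w t x)\<^sup>2) x = \<sigma>\<^sup>2"
      "\<And>t. AE x in M. real_cond_exp M (past_sigma M e w t) (\<lambda>x. (e t x)\<^sup>2) x = \<sigma>\<^sup>2"
    and z: "\<And>b. z b = (if b then w else e)"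
    and n: "\<forall>\<^sub>F N in sequentially. nN N \<le> N"
  shows "AE x in M. \<forall>\<^sub>F N in sequentially. \<forall>a b i j. i \<le> 2 * nN N \<longrightarrow> j \<le> 2 * nN N \<longrightarrow>
    \<bar>1 / real N * (\<Sum>t\<in>{1..int N}. z a (t - int i) x * z b (t - int j) x) - (if a = b \<and> i = j then \<sigma>\<^sup>2 else 0)\<bar>
      \<le> real N powr (-1/3)"
proof -
  define d where "d = (\<lambda>a b i j r x. z a (int r + 1 - int i) x * z b (int r + 1 - int j) x - (if a = b \<and> i = j then \<sigma>\<^sup>2 else 0))"
  \<comment> \<open>The added 1 ensures N^(-1/3) <= 1 <= 2c, the admissible range of deviations in
    \<open>azuma\<close>.\<close>
  define c where "c = B * B + \<sigma>\<^sup>2 + 1"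
  have zm [measurable]: "z b t \<in> borel_measurable M" for b t using z by simp
  have zb: "\<bar>z b t x\<bar> \<le> B" if "x \<in> space M" for b t x using wb[OF that] eb[OF that] by (simp add: z)
  have B: "B \<ge> 0" using not_empty wb[of _ 0] by (meson abs_ge_zero ex_in_conv order_trans)
  have c: "c \<ge> 1" using B by (simp add: c_def)
  have db: "\<bar>d a b i j r x\<bar> \<le> c" if x: "x \<in> space M" for a b i j r x
  proof -
    have "\<bar>z a s x * z b s' x\<bar> \<le> B * B" for s s'
      unfolding abs_mult using zb[OF x] B by (intro mult_mono) auto
    moreover have "\<bar>d a b i j r x\<bar> \<le> \<bar>z a (int r + 1 - int i) x * z b (int r + 1 - int j) x\<bar> + \<sigma>\<^sup>2"
      unfolding d_def using abs_triangle_ineq4[of "z a (int r + 1 - int i) x * z b (int r + 1 - int j) x" "if a = b \<and> i = j then \<sigma>\<^sup>2 else 0"]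
      by (auto split: if_splits)
    ultimately show ?thesis unfolding c_def by (smt (verit))
  qed
  have dm [measurable]: "d a b i j r \<in> borel_measurable M" for a b i j r unfolding d_def by measurable
  have orth: "expectation (\<lambda>x. exp (l * (\<Sum>r<t. d a b i j r x)) * d a b i j t x) = 0" for l t a b i j
    unfolding d_def by (rule cov_orth[OF indep meas wb eb mean var z])
  define bad where "bad N a b i j = {x\<in>space M. real N powr (-1/3) * real N \<le> \<bar>\<Sum>r<N. d a b i j r x\<bar>}" for N a b i j
  define A where "A N = (\<Union>(a,b,i,j)\<in>UNIV \<times> UNIV \<times> {..2 * nN N} \<times> {..2 * nN N}. bad N a b i j)" for N
  have bad_sets [measurable]: "bad N a b i j \<in> sets M" for N a b i j unfolding bad_def by measurable
  have A_sets: "A N \<in> sets M" for N unfolding A_def by (auto intro!: sets.finite_UN)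
  have bad_prob: "prob (bad N a b i j) \<le> 2 * exp (- (1 / (4 * c\<^sup>2)) * real N powr (1/3))" if "N \<ge> 1" for N a b i j
  proof -
    have "real N powr (-1/3) \<le> 1" using that powr_mono[of "-1/3" 0 "real N"] by simp
    then have "prob (bad N a b i j) \<le> 2 * exp (- real N * (real N powr (-1/3))\<^sup>2 / (4 * c\<^sup>2))"
      unfolding bad_def using that c
      by (intro azuma[OF dm db orth]) auto
    \<comment> \<open>Deviations of size N^(-1/3) leave N^(1/3) in the exponent.\<close>
    moreover have "real N * (real N powr (-1/3))\<^sup>2 = real N powr 1 * (real N powr (-2/3))"
      using that by (simp add: powr_powr power2_eq_square powr_add[symmetric])
    ultimately have "prob (bad N a b i j) \<le> 2 * exp (- (real N powr 1 * real N powr (-2/3)) / (4 * c\<^sup>2))"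
      using that by auto
    then show ?thesis unfolding powr_add[symmetric] by simp
  qed
  have A_prob: "prob (A N) \<le> 8 * (2 * real N + 1)\<^sup>2 * exp (- (1 / (4 * c\<^sup>2)) * real N powr (1/3))"
    if N: "N \<ge> 1" "nN N \<le> N" for N
  proof -
    let ?I = "(UNIV :: bool set) \<times> (UNIV :: bool set) \<times> {..2 * nN N} \<times> {..2 * nN N}"
    let ?q = "2 * exp (- (1 / (4 * c\<^sup>2)) * real N powr (1/3))"
    have "prob (A N) \<le> (\<Sum>(a,b,i,j)\<in>?I. prob (bad N a b i j))"
      unfolding A_def by (rule order_trans[OF measure_UNION_le]) (auto simp: case_prod_unfold)
    also have "\<dots> \<le> (\<Sum>p\<in>?I. ?q)"
      using bad_prob[OF N(1)] by (intro sum_mono) auto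
    also have "\<dots> = 4 * (2 * real (nN N) + 1)\<^sup>2 * ?q"
      by (simp add: card_cartesian_product power2_eq_square algebra_simps)
    also have "\<dots> \<le> 4 * (2 * real N + 1)\<^sup>2 * ?q"
      using N by (intro mult_right_mono mult_left_mono power_mono) auto
    finally show ?thesis by simp
  qed
  have "AE x in M. \<forall>\<^sub>F N in sequentially. x \<in> space M - A N"
  proof (rule borel_cantelli_AE1[OF A_sets])
    show "emeasure M (A N) < \<infinity>" for N by (simp add: less_top[symmetric])
    show "summable (\<lambda>N. measure M (A N))"
    proof (rule summable_comparison_test_ev)
      show "summable (\<lambda>N. 8 * (2 * real N + 1)\<^sup>2 * exp (- (1 / (4 * c\<^sup>2)) * real N powr (1/3)))"
        using c by (intro summable_union_bound) auto
      show "\<forall>\<^sub>F N in sequentially. norm (prob (A N)) \<le> 8 * (2 * real N + 1)\<^sup>2 * exp (- (1 / (4 * c\<^sup>2)) * real N powr (1/3))"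
        using n eventually_ge_at_top[of 1] by eventually_elim (use A_prob in simp)
    qed
  qed
  then show ?thesis
  proof (rule AE_mp, intro AE_I2 impI)
    fix x assume "\<forall>\<^sub>F N in sequentially. x \<in> space M - A N"
    then show "\<forall>\<^sub>F N in sequentially. \<forall>a b i j. i \<le> 2 * nN N \<longrightarrow> j \<le> 2 * nN N \<longrightarrow>
      \<bar>1 / real N * (\<Sum>t\<in>{1..int N}. z a (t - int i) x * z b (t - int j) x) - (if a = b \<and> i = j then \<sigma>\<^sup>2 else 0)\<bar>
        \<le> real N powr (-1/3)"
      using eventually_ge_at_top[of 1]
    proof (eventually_elim, intro allI impI)
      fix N a b i j
      assume x: "x \<in> space M - A N" and N: "1 \<le> N" and ij: "i \<le> 2 * nN N" "j \<le> 2 * nN N"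
      have "x \<notin> bad N a b i j"
      proof
        assume "x \<in> bad N a b i j"
        then have "x \<in> A N" unfolding A_def using ij by (intro UN_I[of "(a,b,i,j)"]) auto
        then show False using x by simp
      qed
      then have "\<bar>\<Sum>r<N. d a b i j r x\<bar> \<le> real N powr (-1/3) * real N"
        using x unfolding bad_def by auto
      moreover have "(\<Sum>r<N. d a b i j r x) = real N *
        (1 / real N * (\<Sum>t\<in>{1..int N}. z a (t - int i) x * z b (t - int j) x) - (if a = b \<and> i = j then \<sigma>\<^sup>2 else 0))"
        using N by (simp add: d_def sum_subtractf sum_int_interval right_diff_distrib)
      ultimately show "\<bar>1 / real N * (\<Sum>t\<in>{1..int N}. z a (t - int i) x * z b (t - int j) x) - (if a = b \<and> i = j then \<sigma>\<^sup>2 else 0)\<bar>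
        \<le> real N powr (-1/3)"
        using N by (simp add: abs_mult mult.commute)
    qed
  qed
qed

end

section \<open>Consistency\<close>

theorem theorem1:
  fixes M :: "'a measure"
    and e w :: "int \<Rightarrow> 'a \<Rightarrow> real"
    and Lo Fo Co Do Nu Du :: "real poly"
    and m :: nat and \<sigma> C :: real
    and nN :: "nat \<Rightarrow> nat"
  assumes prob: "prob_space M"
    and e_meas: "\<And>t. e t \<in> borel_measurable M"
    and w_meas: "\<And>t. w t \<in> borel_measurable M"
    \<comment> \<open>true plant G = Lo/Fo of order m, noise model H = Co/Do\<close>
    and Lo: "coeff Lo 0 = 0" "degree Lo \<le> m"
    and Fo: "coeff Fo 0 = 1" "degree Fo \<le> m"
    and order: "max (degree Lo) (degree Fo) = m"
    and LF_coprime: "coprime Lo Fo"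
    and Co: "coeff Co 0 = 1" and Do: "coeff Do 0 = 1"
    and CD_coprime: "coprime Co Do"
    and G_stable: "stable_filter Lo Fo"
    and H_stable: "stable_filter Co Do"
    and Hinv_stable: "stable_filter Do Co"
    \<comment> \<open>input filter F_u = Nu/Du: finite-dimensional, stable, inversely stable\<close>
    and Du: "coeff Du 0 = 1" and Nu: "coeff Nu 0 \<noteq> 0"
    and Fu_stable: "stable_filter Nu Du"
    and Fu_inv_stable: "stable_filter Du Nu"
    \<comment> \<open>w and e independent processes\<close>
    and indep: "prob_space.indep_var M (Pi\<^sub>M UNIV (\<lambda>_. borel)) (\<lambda>x s. w s x)
                                        (Pi\<^sub>M UNIV (\<lambda>_. borel)) (\<lambda>x s. e s x)"
    \<comment> \<open>martingale-difference conditions w.r.t. F_(t-1)\<close>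
    and sigma_pos: "\<sigma> > 0"
    and w_mean: "\<And>t. AE x in M. real_cond_exp M (past_sigma M e w t) (w t) x = 0"
    and w_var: "\<And>t. AE x in M. real_cond_exp M (past_sigma M e w t) (\<lambda>x. (w t x)\<^sup>2) x = \<sigma>\<^sup>2"
    and w_bound: "\<And>t x. x \<in> space M \<Longrightarrow> \<bar>w t x\<bar> \<le> C"
    and e_mean: "\<And>t. AE x in M. real_cond_exp M (past_sigma M e w t) (e t) x = 0"
    and e_var: "\<And>t. AE x in M. real_cond_exp M (past_sigma M e w t) (\<lambda>x. (e t x)\<^sup>2) x = \<sigma>\<^sup>2"
    and e_bound: "\<And>t x. x \<in> space M \<Longrightarrow> \<bar>e t x\<bar> ^ 10 \<le> C"
    \<comment> \<open>ARX order n(N)\<close>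
    and n_inf: "filterlim nN at_top sequentially"
    and n_rate: "\<exists>\<delta>>0. (\<lambda>N. real (nN N) powr (4 + \<delta>) / real N) \<longlonglongrightarrow> 0"
  shows "\<exists>\<delta>0>0. \<forall>\<delta>'. 0 < \<delta>' \<and> \<delta>' < \<delta>0 \<longrightarrow>
          (\<forall>k. AE x in M.
             (let u = (\<lambda>t. conv (imp Nu Du) (\<lambda>s. w s x) t);
                  y = (\<lambda>t. conv (imp Lo Fo) u t + conv (imp Co Do) (\<lambda>s. e s x) t)
              in \<forall>i < 2*m.
                   (\<lambda>N. morsm \<delta>' N (nN N) m y u k $ i) \<longlonglongrightarrow>
                   (if i < m then coeff Fo (i + 1) else coeff Lo (i - m + 1))))"
proof -
  interpret prob_space M by (rule prob)
  define z where "z b = (if b then w else e)" for b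
  \<comment> \<open>|e|^10 <= C bounds |e| by C only where |e| > 1, so a common bound for both
    innovations is the maximum of 1 and C.\<close>
  define B where "B = max 1 C"
  have eb: "\<bar>e t x\<bar> \<le> B" if "x \<in> space M" for t x
  proof (cases "\<bar>e t x\<bar> \<le> 1")
    case False
    then have "\<bar>e t x\<bar> \<le> \<bar>e t x\<bar> ^ 10" by (intro self_le_power) auto
    then show ?thesis using e_bound[OF that, of t] by (simp add: B_def)
  qed (simp add: B_def)
  have wb: "\<bar>w t x\<bar> \<le> B" if "x \<in> space M" for t x
    using w_bound[OF that, of t] by (simp add: B_def)
  obtain \<delta> where \<delta>: "\<delta> > 0" and rate: "(\<lambda>N. real (nN N) powr (4 + \<delta>) / real N) \<longlonglongrightarrow> 0"
    using n_rate by blast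
  have n1: "\<forall>\<^sub>F N in sequentially. nN N \<ge> 1" using n_inf by (simp add: filterlim_at_top)
  \<comment> \<open>The rate enters as n^4 <= N; the later comparisons need the two margins 1/4 <
    1/3 and 2/4 < 1.\<close>
  have n4: "\<forall>\<^sub>F N in sequentially. real (nN N) ^ 4 \<le> real N"
  proof -
    have "\<forall>\<^sub>F N in sequentially. real (nN N) powr (4 + \<delta>) / real N < 1"
      using rate by (rule order_tendstoD(2)) simp
    then show ?thesis using n1 eventually_ge_at_top[of 1]
    proof eventually_elim
      case (elim N)
      have "real (nN N) ^ 4 = real (nN N) powr 4" using elim by (simp add: powr_numeral)
      also have "\<dots> \<le> real (nN N) powr (4 + \<delta>)" using elim \<delta> by (intro powr_mono) auto
      also have "\<dots> \<le> real N" using elim by (simp add: field_simps)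
      finally show ?case .
    qed
  qed
  have n_le: "\<forall>\<^sub>F N in sequentially. nN N \<le> N"
    using n4 n1
  proof eventually_elim
    case (elim N)
    have "real (nN N) \<le> real (nN N) ^ 4" using elim by (intro self_le_power) auto
    then show ?case using elim by simp
  qed
  have n_root: "\<forall>\<^sub>F N in sequentially. real (nN N) \<le> real N powr (1/4)"
    using n4 n1
  proof eventually_elim
    case (elim N)
    have "real (nN N) ^ 4 = real (nN N) powr 4" using elim by (simp add: powr_numeral)
    then have "real (nN N) = (real (nN N) ^ 4) powr (1/4)" using elim by (simp only: powr_powr) simp
    also have "\<dots> \<le> real N powr (1/4)" using elim by (intro powr_mono2) auto
    finally show ?case .
  qed
  have n_eps: "(\<lambda>N. real (nN N) * real N powr (-1/3)) \<longlonglongrightarrow> 0"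
  proof (rule Lim_null_comparison)
    show "\<forall>\<^sub>F N in sequentially. norm (real (nN N) * real N powr (-1/3)) \<le> real N powr (1/4) * real N powr (-1/3)"
      using n_root by eventually_elim (simp add: mult_right_mono)
    show "(\<lambda>N. real N powr (1/4) * real N powr (-1/3)) \<longlonglongrightarrow> 0" by real_asymp
  qed
  have n_sq: "(\<lambda>N. (real (nN N))\<^sup>2 / real N) \<longlonglongrightarrow> 0"
  proof (rule Lim_null_comparison)
    show "\<forall>\<^sub>F N in sequentially. norm ((real (nN N))\<^sup>2 / real N) \<le> (real N powr (1/4))\<^sup>2 / real N"
      using n_root by eventually_elim (auto intro!: divide_right_mono power_mono)
    show "(\<lambda>N. (real N powr (1/4))\<^sup>2 / real N) \<longlonglongrightarrow> 0" by real_asymp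
  qed
  have cov: "AE x in M. \<forall>\<^sub>F N in sequentially. cov_close (\<lambda>b t. z b t x) \<sigma> N (2 * nN N) (real N powr (-1/3))"
    unfolding cov_close_def
    by (rule cov_AE[OF indep e_meas w_meas wb eb w_mean e_mean w_var e_var z_def n_le])
  \<comment> \<open>The constant has \<sigma> and the filters as its only arguments, so the
    threshold for \<delta>' can be fixed before a sample path is chosen.\<close>
  let ?d = "arx_data.pe_const \<sigma> Lo Fo Co Do Nu Du"
  have data: "arx_data (\<lambda>b t. z b t x) B \<sigma> Lo Fo Co Do Nu Du m nN (\<lambda>N. real N powr (-1/3))"
    if "x \<in> space M" "\<forall>\<^sub>F N in sequentially. cov_close (\<lambda>b t. z b t x) \<sigma> N (2 * nN N) (real N powr (-1/3))" for x
    using that(2) wb[OF that(1)] eb[OF that(1)] n_eps n_sq n_inf Lo Fo order LF_coprime Co Do CD_coprime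
      G_stable H_stable Hinv_stable Du Nu Fu_stable Fu_inv_stable sigma_pos
    by unfold_locales (auto simp: z_def intro!: bndI)
  \<comment> \<open>Positivity of the threshold is proved inside the locale and so needs one
    instance; a probability space cannot have an empty almost sure event.\<close>
  have "\<exists>x\<in>space M. \<forall>\<^sub>F N in sequentially. cov_close (\<lambda>b t. z b t x) \<sigma> N (2 * nN N) (real N powr (-1/3))"
  proof (rule ccontr)
    assume "\<not> ?thesis"
    then have "AE x in M. False" using cov by (auto elim!: AE_mp intro!: AE_I2)
    then show False by simp
  qed
  then have pos: "?d > 0" using data arx_data.pe_const_pos by blast
  have lim: "\<forall>i<2*m. (\<lambda>N. vec_index (morsm \<delta>' N (nN N) m
        (\<lambda>t. conv (imp Lo Fo) (conv (imp Nu Du) (\<lambda>s. w s x)) t + conv (imp Co Do) (\<lambda>s. e s x) t)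
        (conv (imp Nu Du) (\<lambda>s. w s x)) k) i) \<longlonglongrightarrow>
      (if i < m then coeff Fo (i + 1) else coeff Lo (i - m + 1))"
    if x: "x \<in> space M" "\<forall>\<^sub>F N in sequentially. cov_close (\<lambda>b t. z b t x) \<sigma> N (2 * nN N) (real N powr (-1/3))"
      and \<delta>': "0 < \<delta>'" "\<delta>' < ?d" for x \<delta>' k
  proof -
    interpret D: arx_data "\<lambda>b t. z b t x" B \<sigma> Lo Fo Co Do Nu Du m nN "\<lambda>N. real N powr (-1/3)"
      by (rule data[OF x])
    have imp_fps: "imp P Q = fps_nth (fps_of_poly P / fps_of_poly Q)" for P Q by (rule ext) (simp add: imp_def)
    have u: "D.u = conv (imp Nu Du) (\<lambda>s. w s x)" unfolding D.u_def D.U_def imp_fps by (simp add: z_def)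
    have y: "D.y = (\<lambda>t. conv (imp Lo Fo) (conv (imp Nu Du) (\<lambda>s. w s x)) t + conv (imp Co Do) (\<lambda>s. e s x) t)"
      unfolding D.y_def[abs_def] u D.G_def D.H_def imp_fps[of Lo] imp_fps[of Co] by (simp add: z_def)
    show ?thesis using D.morsm_LIMSEQ[OF \<delta>'] unfolding y u D.\<theta>0_def Suc_eq_plus1 by blast
  qed
  show ?thesis
  proof (intro exI[of _ ?d] conjI allI impI pos)
    fix \<delta>' k assume \<delta>': "0 < \<delta>' \<and> \<delta>' < ?d"
    show "AE x in M.
             (let u = (\<lambda>t. conv (imp Nu Du) (\<lambda>s. w s x) t);
                  y = (\<lambda>t. conv (imp Lo Fo) u t + conv (imp Co Do) (\<lambda>s. e s x) t)
              in \<forall>i < 2*m.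
                   (\<lambda>N. vec_index (morsm \<delta>' N (nN N) m y u k) i) \<longlonglongrightarrow>
                   (if i < m then coeff Fo (i + 1) else coeff Lo (i - m + 1)))"
      unfolding Let_def using cov
      by (rule AE_mp) (use lim \<delta>' in \<open>auto intro!: AE_I2\<close>)
  qed
qed

end
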